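(* Let $K$ be an algebraically closed field of characteristic zero, let $Q$ be a connected affine algebraic group over $K$, and let $\mathfrak q=\mathrm{Lie}\,Q$. Suppose that $\mathrm{ind}\,\mathfrak q=1$. Then $\mathfrak q$ is contact if and only if there is a generic stabiliser for the coadjoint action of $\mathfrak q$.
   Context: For $\alpha\in\mathfrak q^*$, let $d_{\mathfrak q}\alpha\in\wedge^2\mathfrak q^*$ be the Chevalley--Eilenberg differential of $\alpha$, i.e. (up to an irrelevant sign convention) $d_{\mathfrak q}\alpha(\xi,\eta)=-\alpha([\xi,\eta])$. A finite-dimensional Lie algebra $\mathfrak q$ is called contact if $\dim\mathfrak q=2n+1$ is odd and there is $\alpha\in\mathfrak q^*$ with $(d_{\mathfrak q}\alpha)^{\wedge n}\wedge\alpha\neq 0$. For $\gamma\in\mathfrak q^*$, set $\mathfrak q_\gamma=\{\xi\in\mathfrak q\mid\gamma([\xi,\mathfrak q])=0\}$, the stabiliser of $\gamma$ in $\mathfrak q$ for the coadjoint action. The index is $\mathrm{ind}\,\mathfrak q=\min_{\gamma\in\mathfrak q^*}\dim\mathfrak q_\gamma$. There is a generic stabiliser for the coadjoint action if there exist $\gamma\in\mathfrak q^*$ and a non-empty Zariski open subset $U\subset\mathfrak q^*$ such that, for each $\beta\in U$, the subalgebras $\mathfrak q_\gamma$ and $\mathfrak q_\beta$ are conjugate by an element of $Q$ (under the adjoint action); in this case $\mathfrak q_\gamma$ is called a generic stabiliser. *)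

theory Defs
  imports
    "HOL-Analysis.Analysis"
    "HOL-Library.Function_Algebras"
    "HOL-Computational_Algebra.Polynomial"
    "HOL-Algebra.Group"
begin

section \<open>Polynomial functions and Zariski topologies\<close>

text \<open>
  The algebra of functions generated by a set of functions \<open>S\<close>. Taking for \<open>S\<close> the coordinate
  functions of an affine space, or all evaluations on a dual space, gives the
  polynomial functions on that space, without a choice of basis.
\<close>

inductive_set poly_funs :: "('a \<Rightarrow> 'k::comm_ring_1) set \<Rightarrow> ('a \<Rightarrow> 'k) set"
  for S :: "('a \<Rightarrow> 'k) set" where
  gen: "f \<in> S \<Longrightarrow> f \<in> poly_funs S"
| const: "(\<lambda>_. c) \<in> poly_funs S"
| add: "f \<in> poly_funs S \<Longrightarrow> g \<in> poly_funs S \<Longrightarrow> (\<lambda>x. f x + g x) \<in> poly_funs S"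
| mult: "f \<in> poly_funs S \<Longrightarrow> g \<in> poly_funs S \<Longrightarrow> (\<lambda>x. f x * g x) \<in> poly_funs S"

definition coords :: "('k::comm_ring_1 ^ 'n \<Rightarrow> 'k) set" where
  "coords = range (\<lambda>i x. x $ i)"

definition coords2 :: "(('k::comm_ring_1 ^ 'n) \<times> ('k ^ 'n) \<Rightarrow> 'k) set" where
  "coords2 = range (\<lambda>i (x, y). x $ i) \<union> range (\<lambda>i (x, y). y $ i)"

text \<open>The Zariski topology on \<open>X\<close> whose closed sets are the common zero loci in \<open>X\<close> of families
  of polynomials in the functions \<open>S\<close>.\<close>

definition zariski_topology :: "'a set \<Rightarrow> ('a \<Rightarrow> 'k::idom) set \<Rightarrow> 'a topology" where
  "zariski_topology X S =
     topology (\<lambda>U. \<exists>F \<subseteq> poly_funs S. U = X - {x \<in> X. \<forall>f\<in>F. f x = 0})"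

lemma istopology_zariski:
  "istopology (\<lambda>U. \<exists>F \<subseteq> poly_funs (S :: ('a \<Rightarrow> 'k::idom) set).
     U = X - {x \<in> X. \<forall>f\<in>F. f x = 0})"
  unfolding istopology_def
proof (intro conjI allI impI)
  fix U V
  assume "\<exists>F \<subseteq> poly_funs S. U = X - {x \<in> X. \<forall>f\<in>F. f x = 0}"
    and "\<exists>F \<subseteq> poly_funs S. V = X - {x \<in> X. \<forall>f\<in>F. f x = 0}"
  then obtain F G where F: "F \<subseteq> poly_funs S" "U = X - {x \<in> X. \<forall>f\<in>F. f x = 0}"
    and G: "G \<subseteq> poly_funs S" "V = X - {x \<in> X. \<forall>f\<in>G. f x = 0}" by blast
  define H where "H = (\<Union>f\<in>F. (\<lambda>g x. f x * g x) ` G)"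
  have H: "H \<subseteq> poly_funs S"
    using F(1) G(1) unfolding H_def by (auto intro: poly_funs.mult)
  have zeros: "(\<forall>h\<in>H. h x = 0) \<longleftrightarrow> (\<forall>f\<in>F. f x = 0) \<or> (\<forall>g\<in>G. g x = 0)" for x
  proof -
    have "(\<forall>h\<in>H. h x = 0) \<longleftrightarrow> (\<forall>f\<in>F. \<forall>g\<in>G. f x * g x = 0)"
      unfolding H_def by simp
    also have "\<dots> \<longleftrightarrow> (\<forall>f\<in>F. \<forall>g\<in>G. f x = 0 \<or> g x = 0)"
      by (simp only: mult_eq_0_iff)
    also have "\<dots> \<longleftrightarrow> (\<forall>f\<in>F. f x = 0) \<or> (\<forall>g\<in>G. g x = 0)" by blast
    finally show ?thesis .
  qed
  have "U \<inter> V = X - {x \<in> X. \<forall>h\<in>H. h x = 0}"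
    unfolding F(2) G(2) zeros by blast
  with H show "\<exists>F \<subseteq> poly_funs S. U \<inter> V = X - {x \<in> X. \<forall>f\<in>F. f x = 0}"
    by (intro exI[of _ H] conjI)
next
  fix \<U>
  assume "\<forall>U\<in>\<U>. \<exists>F \<subseteq> poly_funs S. U = X - {x \<in> X. \<forall>f\<in>F. f x = 0}"
  from bchoice[OF this] obtain F where
    F: "\<forall>U\<in>\<U>. F U \<subseteq> poly_funs S \<and> U = X - {x \<in> X. \<forall>f\<in>F U. f x = 0}"
    by blast
  have "(\<lambda>U. U) ` \<U> = (\<lambda>U. X - {x \<in> X. \<forall>f\<in>F U. f x = 0}) ` \<U>"
    by (rule image_cong[OF refl]) (rule conjunct2[OF bspec[OF F]])
  then have "\<Union>\<U> = (\<Union>U\<in>\<U>. X - {x \<in> X. \<forall>f\<in>F U. f x = 0})"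
    by simp
  also have "\<dots> = X - {x \<in> X. \<forall>f\<in>(\<Union>U\<in>\<U>. F U). f x = 0}" by blast
  finally have "\<Union>\<U> = X - {x \<in> X. \<forall>f\<in>(\<Union>U\<in>\<U>. F U). f x = 0}" .
  moreover have "(\<Union>U\<in>\<U>. F U) \<subseteq> poly_funs S"
    using F by blast
  ultimately show "\<exists>G \<subseteq> poly_funs S. \<Union>\<U> = X - {x \<in> X. \<forall>f\<in>G. f x = 0}"
    by blast
qed

lemma openin_zariski:
  "openin (zariski_topology X S) U \<longleftrightarrow>
     (\<exists>F \<subseteq> poly_funs S. U = X - {x \<in> X. \<forall>f\<in>F. f x = 0})"
  unfolding zariski_topology_def topology_inverse'[OF istopology_zariski] ..

lemma topspace_zariski: "topspace (zariski_topology X S) = X"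
proof -
  have "openin (zariski_topology X S) X"
    unfolding openin_zariski
    by (rule exI[of _ "{\<lambda>_. 1}"]) (auto intro: poly_funs.const)
  then have "X \<subseteq> topspace (zariski_topology X S)" by (rule openin_subset)
  moreover have "topspace (zariski_topology X S) \<subseteq> X"
    using openin_topspace[of "zariski_topology X S"] unfolding openin_zariski by blast
  ultimately show ?thesis by blast
qed

section \<open>Lie algebras\<close>

text \<open>
  Tuples of vectors are encoded as sequences; a \<open>k\<close>-form only looks at the entries \<open>0, \<dots>, k - 1\<close>.
  For \<open>\<omega>\<close> of degree \<open>k\<close> and \<open>\<eta>\<close> of degree \<open>l\<close>:
\<close>

definition wedge ::
  "nat \<Rightarrow> nat \<Rightarrow> ((nat \<Rightarrow> 'v) \<Rightarrow> 'k) \<Rightarrow> ((nat \<Rightarrow> 'v) \<Rightarrow> 'k) \<Rightarrow> (nat \<Rightarrow> 'v) \<Rightarrow> 'k::field_char_0"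
where
  "wedge k l \<omega> \<eta> v =
     (\<Sum>\<sigma> | \<sigma> permutes {..<k + l}.
        of_int (sign \<sigma>) * \<omega> (\<lambda>i. v (\<sigma> i)) * \<eta> (\<lambda>i. v (\<sigma> (k + i)))) / (fact k * fact l)"

primrec wedge_power ::
  "nat \<Rightarrow> ((nat \<Rightarrow> 'v) \<Rightarrow> 'k) \<Rightarrow> nat \<Rightarrow> (nat \<Rightarrow> 'v) \<Rightarrow> 'k::field_char_0"
where
  "wedge_power d \<omega> 0 = (\<lambda>_. 1)"
| "wedge_power d \<omega> (Suc n) = wedge (d * n) d (wedge_power d \<omega> n) \<omega>"

locale lie_algebra = vector_space scale
  for scale :: "'k::field_char_0 \<Rightarrow> 'v::ab_group_add \<Rightarrow> 'v" +
  fixes L :: "'v set" and bracket :: "'v \<Rightarrow> 'v \<Rightarrow> 'v"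
  assumes subspace_L: "subspace L"
    and bracket_closed: "x \<in> L \<Longrightarrow> y \<in> L \<Longrightarrow> bracket x y \<in> L"
    and bracket_add_left:
      "x \<in> L \<Longrightarrow> y \<in> L \<Longrightarrow> z \<in> L \<Longrightarrow> bracket (x + y) z = bracket x z + bracket y z"
    and bracket_add_right:
      "x \<in> L \<Longrightarrow> y \<in> L \<Longrightarrow> z \<in> L \<Longrightarrow> bracket x (y + z) = bracket x y + bracket x z"
    and bracket_scale_left:
      "x \<in> L \<Longrightarrow> y \<in> L \<Longrightarrow> bracket (scale c x) y = scale c (bracket x y)"
    and bracket_scale_right:
      "x \<in> L \<Longrightarrow> y \<in> L \<Longrightarrow> bracket x (scale c y) = scale c (bracket x y)"
    and bracket_self: "x \<in> L \<Longrightarrow> bracket x x = 0"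
    and jacobi: "x \<in> L \<Longrightarrow> y \<in> L \<Longrightarrow> z \<in> L \<Longrightarrow>
      bracket x (bracket y z) + bracket y (bracket z x) + bracket z (bracket x y) = 0"
begin

text \<open>Functionals are extended by \<open>0\<close> outside \<open>L\<close>, so that equality is equality on \<open>L\<close>.\<close>

definition dual :: "('v \<Rightarrow> 'k) set" where
  "dual = {\<alpha>. (\<forall>x\<in>L. \<forall>y\<in>L. \<alpha> (x + y) = \<alpha> x + \<alpha> y) \<and>
              (\<forall>c. \<forall>x\<in>L. \<alpha> (scale c x) = c * \<alpha> x) \<and>
              (\<forall>x. x \<notin> L \<longrightarrow> \<alpha> x = 0)}"

definition dual_zariski :: "('v \<Rightarrow> 'k) topology" where
  "dual_zariski = zariski_topology dual ((\<lambda>\<xi> \<gamma>. \<gamma> \<xi>) ` L)"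

definition stabiliser :: "('v \<Rightarrow> 'k) \<Rightarrow> 'v set" where
  "stabiliser \<gamma> = {\<xi> \<in> L. \<forall>\<eta>\<in>L. \<gamma> (bracket \<xi> \<eta>) = 0}"

definition index :: nat where
  "index = (LEAST d. \<exists>\<gamma>\<in>dual. d = dim (stabiliser \<gamma>))"

definition ce_differential :: "('v \<Rightarrow> 'k) \<Rightarrow> (nat \<Rightarrow> 'v) \<Rightarrow> 'k" where
  "ce_differential \<alpha> v = - \<alpha> (bracket (v 0) (v 1))"

definition contact :: bool where
  "contact \<longleftrightarrow>
     (\<exists>n. dim L = 2 * n + 1 \<and>
       (\<exists>\<alpha>\<in>dual. \<exists>v. (\<forall>i. v i \<in> L) \<and>
          wedge (2 * n) 1 (wedge_power 2 (ce_differential \<alpha>) n) (\<lambda>v. \<alpha> (v 0)) v \<noteq> 0))"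

end

section \<open>Affine algebraic groups and their Lie algebras\<close>

text \<open>
  A group structure on a Zariski closed subset of an affine space, given by polynomial maps.
\<close>

locale affine_algebraic_group = group Q
  for Q :: "('k::field_char_0 ^ 'n) monoid" (structure) +
  assumes closed_carrier: "closedin (zariski_topology UNIV coords) (carrier Q)"
    and mult_poly: "\<exists>p\<in>poly_funs coords2. \<forall>x\<in>carrier Q. \<forall>y\<in>carrier Q. (x \<otimes> y) $ i = p (x, y)"
    and inv_poly: "\<exists>p\<in>poly_funs coords. \<forall>x\<in>carrier Q. (inv x) $ i = p x"

definition connected_group :: "('k::field_char_0 ^ 'n) monoid \<Rightarrow> bool" where
  "connected_group Q \<longleftrightarrow> connectedin (zariski_topology UNIV coords) (carrier Q)"

text \<open>Functions on the group are extended by \<open>0\<close> outside the carrier.\<close>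

definition on_group :: "('k::field_char_0 ^ 'n) monoid \<Rightarrow> ('k ^ 'n \<Rightarrow> 'k) \<Rightarrow> 'k ^ 'n \<Rightarrow> 'k" where
  "on_group Q f = (\<lambda>x. if x \<in> carrier Q then f x else 0)"

definition coordinate_ring :: "('k::field_char_0 ^ 'n) monoid \<Rightarrow> ('k ^ 'n \<Rightarrow> 'k) set" where
  "coordinate_ring Q = on_group Q ` poly_funs coords"

definition left_translate ::
  "('k::field_char_0 ^ 'n) monoid \<Rightarrow> 'k ^ 'n \<Rightarrow> ('k ^ 'n \<Rightarrow> 'k) \<Rightarrow> 'k ^ 'n \<Rightarrow> 'k" where
  "left_translate Q g f = on_group Q (\<lambda>x. f (inv\<^bsub>Q\<^esub> g \<otimes>\<^bsub>Q\<^esub> x))"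

type_synonym ('k, 'n) operator = "('k ^ 'n \<Rightarrow> 'k) \<Rightarrow> 'k ^ 'n \<Rightarrow> 'k"

definition scale_op :: "'k::field_char_0 \<Rightarrow> ('k, 'n) operator \<Rightarrow> ('k, 'n) operator" where
  "scale_op c D = (\<lambda>f x. c * D f x)"

definition commutator ::
  "('k::field_char_0, 'n) operator \<Rightarrow> ('k, 'n) operator \<Rightarrow> ('k, 'n) operator" where
  "commutator D E = (\<lambda>f. D (E f) - E (D f))"

text \<open>
  \<open>Lie Q\<close>: the left invariant derivations of the coordinate ring, extended by \<open>0\<close> outside the
  coordinate ring.
\<close>

definition Lie :: "('k::field_char_0 ^ 'n) monoid \<Rightarrow> ('k, 'n) operator set" where
  "Lie Q = {D.
     (\<forall>f\<in>coordinate_ring Q. D f \<in> coordinate_ring Q) \<and>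
     (\<forall>f. f \<notin> coordinate_ring Q \<longrightarrow> D f = 0) \<and>
     (\<forall>f\<in>coordinate_ring Q. \<forall>g\<in>coordinate_ring Q. D (f + g) = D f + D g) \<and>
     (\<forall>c. \<forall>f\<in>coordinate_ring Q. D (\<lambda>x. c * f x) = (\<lambda>x. c * D f x)) \<and>
     (\<forall>f\<in>coordinate_ring Q. \<forall>g\<in>coordinate_ring Q. D (f * g) = D f * g + f * D g) \<and>
     (\<forall>g\<in>carrier Q. \<forall>f\<in>coordinate_ring Q.
        D (left_translate Q g f) = left_translate Q g (D f))}"

text \<open>
  The differential of \<open>Int g : x \<mapsto> g x g\<inverse>\<close>. On derivations the differential of an automorphism
  \<open>\<phi>\<close> is \<open>D \<mapsto> (\<phi>\<^sup>*)\<inverse> \<circ> D \<circ> \<phi>\<^sup>*\<close>, where \<open>\<phi>\<^sup>* f = f \<circ> \<phi>\<close>.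
\<close>

definition Int_pullback ::
  "('k::field_char_0 ^ 'n) monoid \<Rightarrow> 'k ^ 'n \<Rightarrow> ('k ^ 'n \<Rightarrow> 'k) \<Rightarrow> 'k ^ 'n \<Rightarrow> 'k" where
  "Int_pullback Q g f = on_group Q (\<lambda>x. f (g \<otimes>\<^bsub>Q\<^esub> x \<otimes>\<^bsub>Q\<^esub> inv\<^bsub>Q\<^esub> g))"

definition Ad ::
  "('k::field_char_0 ^ 'n) monoid \<Rightarrow> 'k ^ 'n \<Rightarrow> ('k, 'n) operator \<Rightarrow> ('k, 'n) operator" where
  "Ad Q g D = (\<lambda>f. if f \<in> coordinate_ring Q
     then Int_pullback Q (inv\<^bsub>Q\<^esub> g) (D (Int_pullback Q g f)) else 0)"

lemma coordinate_ring_zero: "(0 :: 'k::field_char_0 ^ 'n \<Rightarrow> 'k) \<in> coordinate_ring Q"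
proof -
  have "(0 :: 'k ^ 'n \<Rightarrow> 'k) = on_group Q (\<lambda>_. 0)" by (simp add: on_group_def fun_eq_iff)
  then show ?thesis
    unfolding coordinate_ring_def by (auto intro: poly_funs.const)
qed

lemma coordinate_ring_add:
  assumes "f \<in> coordinate_ring Q" "g \<in> coordinate_ring Q"
  shows "f + g \<in> coordinate_ring Q"
proof -
  obtain p q where "p \<in> poly_funs coords" "q \<in> poly_funs coords"
    "f = on_group Q p" "g = on_group Q q"
    using assms unfolding coordinate_ring_def by blast
  moreover from this have "f + g = on_group Q (\<lambda>x. p x + q x)" by (simp add: on_group_def fun_eq_iff)
  ultimately show ?thesis
    unfolding coordinate_ring_def by (auto intro: poly_funs.add)
qed

lemma coordinate_ring_scale:
  assumes "f \<in> coordinate_ring Q"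
  shows "(\<lambda>x. c * f x) \<in> coordinate_ring Q"
proof -
  obtain p where p: "p \<in> poly_funs coords" "f = on_group Q p"
    using assms unfolding coordinate_ring_def by blast
  then have "(\<lambda>x. c * f x) = on_group Q (\<lambda>x. c * p x)" by (simp add: on_group_def fun_eq_iff)
  moreover have "(\<lambda>x. c * p x) \<in> poly_funs coords"
    using poly_funs.mult[OF poly_funs.const p(1)] .
  ultimately show ?thesis
    unfolding coordinate_ring_def by auto
qed

lemma coordinate_ring_diff:
  assumes "f \<in> coordinate_ring Q" "g \<in> coordinate_ring Q"
  shows "f - g \<in> coordinate_ring Q"
proof -
  have "f - g = f + (\<lambda>x. - 1 * g x)" by (simp add: fun_eq_iff)
  then show ?thesis
    using coordinate_ring_add[OF assms(1) coordinate_ring_scale[OF assms(2), of "- 1"]]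
    by (simp only:)
qed

lemma vector_space_scale_op: "vector_space scale_op"
  by unfold_locales (auto simp: scale_op_def fun_eq_iff algebra_simps)

lemma left_translate_add: "left_translate Q g (f + h) = left_translate Q g f + left_translate Q g h"
  and left_translate_diff: "left_translate Q g (f - h) = left_translate Q g f - left_translate Q g h"
  and left_translate_zero: "left_translate Q g 0 = 0"
  and left_translate_scale:
    "left_translate Q g (\<lambda>x. c * f x) = (\<lambda>x. c * left_translate Q g f x)"
  by (auto simp: left_translate_def on_group_def fun_eq_iff)

lemma LieD:
  assumes "D \<in> Lie Q"
  shows "f \<in> coordinate_ring Q \<Longrightarrow> D f \<in> coordinate_ring Q"
    and "f \<notin> coordinate_ring Q \<Longrightarrow> D f = 0"
    and "f \<in> coordinate_ring Q \<Longrightarrow> g \<in> coordinate_ring Q \<Longrightarrow> D (f + g) = D f + D g"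
    and "f \<in> coordinate_ring Q \<Longrightarrow> D (\<lambda>x. c * f x) = (\<lambda>x. c * D f x)"
    and "f \<in> coordinate_ring Q \<Longrightarrow> g \<in> coordinate_ring Q \<Longrightarrow> D (f * g) = D f * g + f * D g"
    and "a \<in> carrier Q \<Longrightarrow> f \<in> coordinate_ring Q \<Longrightarrow>
      D (left_translate Q a f) = left_translate Q a (D f)"
  using assms unfolding Lie_def by auto

lemma Lie_apply_closed: "D \<in> Lie Q \<Longrightarrow> D f \<in> coordinate_ring Q"
  using LieD(1)[of D Q f] LieD(2)[of D Q f] coordinate_ring_zero[of Q] by metis

lemma Lie_apply_zero: "D \<in> Lie Q \<Longrightarrow> D 0 = 0"
  using LieD(3)[of D Q 0 0] coordinate_ring_zero[of Q] by (metis add_cancel_left_left add_0)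

lemma Lie_apply_diff:
  assumes "D \<in> Lie Q" "f \<in> coordinate_ring Q" "g \<in> coordinate_ring Q"
  shows "D (f - g) = D f - D g"
  using LieD(3)[OF assms(1) coordinate_ring_diff[OF assms(2,3)] assms(3)]
  by (metis diff_add_cancel add_diff_cancel_right')

lemma commutator_closed:
  assumes D: "D \<in> Lie Q" and E: "E \<in> Lie Q"
  shows "commutator D E \<in> Lie Q"
  unfolding Lie_def commutator_def mem_Collect_eq
proof (intro conjI allI impI ballI)
  note cl = Lie_apply_closed[OF D] Lie_apply_closed[OF E]
  fix f c assume f: "f \<in> coordinate_ring Q"
  show "D (E f) - E (D f) \<in> coordinate_ring Q"
    using cl by (intro coordinate_ring_diff)
  show "D (E (\<lambda>x. c * f x)) - E (D (\<lambda>x. c * f x)) = (\<lambda>x. c * (D (E f) - E (D f)) x)"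
    by (rule ext) (simp only: LieD(4)[OF D f] LieD(4)[OF E f] LieD(4)[OF D cl(2)]
        LieD(4)[OF E cl(1)] fun_diff_def right_diff_distrib)
next
  note cl = Lie_apply_closed[OF D] Lie_apply_closed[OF E]
  fix f g assume fg: "f \<in> coordinate_ring Q" "g \<in> coordinate_ring Q"
  show "D (E (f + g)) - E (D (f + g)) = D (E f) - E (D f) + (D (E g) - E (D g))"
    by (simp only: LieD(3)[OF D fg] LieD(3)[OF E fg] LieD(3)[OF D cl(2) cl(2)]
        LieD(3)[OF E cl(1) cl(1)] add_diff_add)
  have mul: "p * q \<in> coordinate_ring Q"
    if "p \<in> coordinate_ring Q" "q \<in> coordinate_ring Q" for p q
  proof -
    obtain p' q' where pq: "p' \<in> poly_funs coords" "q' \<in> poly_funs coords"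
      "p = on_group Q p'" "q = on_group Q q'"
      using \<open>p \<in> _\<close> \<open>q \<in> _\<close> unfolding coordinate_ring_def by blast
    then have "p * q = on_group Q (\<lambda>x. p' x * q' x)" by (simp add: on_group_def fun_eq_iff)
    then show ?thesis
      using poly_funs.mult[OF pq(1,2)] unfolding coordinate_ring_def by auto
  qed
  show "D (E (f * g)) - E (D (f * g)) = (D (E f) - E (D f)) * g + f * (D (E g) - E (D g))"
    by (simp only: LieD(5)[OF D] LieD(5)[OF E] LieD(3)[OF D] LieD(3)[OF E] mul fg cl)
      (simp only: algebra_simps)
next
  note cl = Lie_apply_closed[OF D] Lie_apply_closed[OF E]
  fix g f assume "g \<in> carrier Q" "f \<in> coordinate_ring Q"
  then show "D (E (left_translate Q g f)) - E (D (left_translate Q g f)) =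
      left_translate Q g (D (E f) - E (D f))"
    by (simp only: LieD(6)[OF D] LieD(6)[OF E] cl left_translate_diff)
next
  fix f assume "f \<notin> coordinate_ring Q"
  then show "D (E f) - E (D f) = 0"
    by (simp only: LieD(2)[OF D] LieD(2)[OF E] Lie_apply_zero[OF D] Lie_apply_zero[OF E] diff_self
        not_False_eq_True)
qed

lemma Lie_zero: "0 \<in> Lie Q"
proof -
  define D where "D = (0 :: ('a, 'b) operator)"
  have D: "D f = 0" for f by (simp add: D_def)
  have "D \<in> Lie Q"
    unfolding Lie_def mem_Collect_eq D
  proof (intro conjI ballI allI impI)
    show "0 \<in> coordinate_ring Q" by (rule coordinate_ring_zero)
    show "(0 :: 'a ^ 'b \<Rightarrow> 'a) = 0 + 0" by (rule add_0[symmetric])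
    show "(0 :: 'a ^ 'b \<Rightarrow> 'a) = (\<lambda>x. c * 0 x)" for c by (rule ext) simp
    show "0 = 0 * g + f * 0" for f g :: "'a ^ 'b \<Rightarrow> 'a" by (rule ext) simp
    show "0 = left_translate Q g 0" for g by (rule left_translate_zero[symmetric])
  qed (rule refl)
  then show ?thesis unfolding D_def .
qed

lemma Lie_add:
  assumes D: "D \<in> Lie Q" and E: "E \<in> Lie Q"
  shows "D + E \<in> Lie Q"
proof -
  define S where "S = D + E"
  have S: "S f = D f + E f" for f unfolding S_def by (rule plus_fun_apply)
  have "S \<in> Lie Q"
    unfolding Lie_def mem_Collect_eq S
  proof (intro conjI allI impI ballI)
    fix f c assume f: "f \<in> coordinate_ring Q"
    show "D f + E f \<in> coordinate_ring Q"
      by (rule coordinate_ring_add[OF LieD(1)[OF D f] LieD(1)[OF E f]])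
    show "D (\<lambda>x. c * f x) + E (\<lambda>x. c * f x) = (\<lambda>x. c * (D f + E f) x)"
      unfolding LieD(4)[OF D f] LieD(4)[OF E f] by (rule ext) (simp add: distrib_left)
  next
    fix f assume f: "f \<notin> coordinate_ring Q"
    show "D f + E f = 0" by (simp only: LieD(2)[OF D f] LieD(2)[OF E f] add_0)
  next
    fix f g assume fg: "f \<in> coordinate_ring Q" "g \<in> coordinate_ring Q"
    show "D (f + g) + E (f + g) = D f + E f + (D g + E g)"
      by (simp only: LieD(3)[OF D fg] LieD(3)[OF E fg] ac_simps)
    show "D (f * g) + E (f * g) = (D f + E f) * g + f * (D g + E g)"
      by (simp only: LieD(5)[OF D fg] LieD(5)[OF E fg] distrib_left distrib_right ac_simps)
  next
    fix g f assume gf: "g \<in> carrier Q" "f \<in> coordinate_ring Q"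
    show "D (left_translate Q g f) + E (left_translate Q g f) = left_translate Q g (D f + E f)"
      by (simp only: LieD(6)[OF D gf] LieD(6)[OF E gf] left_translate_add)
  qed
  then show ?thesis unfolding S_def .
qed

lemma Lie_scale:
  assumes D: "D \<in> Lie Q"
  shows "scale_op c D \<in> Lie Q"
  unfolding Lie_def mem_Collect_eq scale_op_def
proof (intro conjI allI impI ballI)
  fix f b assume f: "f \<in> coordinate_ring Q"
  show "(\<lambda>x. c * D f x) \<in> coordinate_ring Q"
    by (rule coordinate_ring_scale[OF LieD(1)[OF D f]])
  show "(\<lambda>x. c * D (\<lambda>x. b * f x) x) = (\<lambda>x. b * (c * D f x))"
    by (rule ext) (simp only: LieD(4)[OF D f] mult.left_commute)
next
  fix f assume f: "f \<notin> coordinate_ring Q"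
  show "(\<lambda>x. c * D f x) = 0"
    by (rule ext) (simp only: LieD(2)[OF D f] zero_fun_apply mult_zero_right)
next
  fix f g assume fg: "f \<in> coordinate_ring Q" "g \<in> coordinate_ring Q"
  show "(\<lambda>x. c * D (f + g) x) = (\<lambda>x. c * D f x) + (\<lambda>x. c * D g x)"
    by (rule ext) (simp only: LieD(3)[OF D fg] plus_fun_apply distrib_left)
  show "(\<lambda>x. c * D (f * g) x) = (\<lambda>x. c * D f x) * g + f * (\<lambda>x. c * D g x)"
    by (rule ext) (simp only: LieD(5)[OF D fg] plus_fun_apply times_fun_apply distrib_left ac_simps)
next
  fix g f assume gf: "g \<in> carrier Q" "f \<in> coordinate_ring Q"
  show "(\<lambda>x. c * D (left_translate Q g f) x) = left_translate Q g (\<lambda>x. c * D f x)"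
    by (simp only: LieD(6)[OF D gf] left_translate_scale)
qed

lemma lie_algebra_Lie: "lie_algebra scale_op (Lie Q) commutator"
proof -
  interpret vector_space scale_op by (rule vector_space_scale_op)
  show ?thesis
  proof
    show "subspace (Lie Q)"
      by (rule subspaceI) (simp_all only: Lie_zero Lie_add Lie_scale)
  next
    fix D E assume D: "D \<in> Lie Q" and E: "E \<in> Lie Q"
    note cl = Lie_apply_closed[OF D] Lie_apply_closed[OF E]
    show "commutator D E \<in> Lie Q" by (rule commutator_closed[OF D E])
    show "commutator (scale_op c D) E = scale_op c (commutator D E)" for c
      by (intro ext) (simp only: commutator_def scale_op_def LieD(4)[OF E cl(1)]
          fun_diff_def right_diff_distrib)
    show "commutator D (scale_op c E) = scale_op c (commutator D E)" for c
      by (intro ext) (simp only: commutator_def scale_op_def LieD(4)[OF D cl(2)]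
          fun_diff_def right_diff_distrib)
    fix F assume F: "F \<in> Lie Q"
    note cl = cl Lie_apply_closed[OF F]
    show "commutator (D + E) F = commutator D F + commutator E F"
      by (rule ext) (simp only: commutator_def plus_fun_apply LieD(3)[OF F cl(1,2)] add_diff_add)
    show "commutator D (E + F) = commutator D E + commutator D F"
      by (rule ext) (simp only: commutator_def plus_fun_apply LieD(3)[OF D cl(2,3)] add_diff_add)
    show "commutator D (commutator E F) + commutator E (commutator F D) +
        commutator F (commutator D E) = 0"
    proof (rule ext)
      fix f
      have "(commutator D (commutator E F) + commutator E (commutator F D) +
          commutator F (commutator D E)) f =
        (D (E (F f)) - D (F (E f)) - (E (F (D f)) - F (E (D f)))) +
        (E (F (D f)) - E (D (F f)) - (F (D (E f)) - D (F (E f)))) +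
        (F (D (E f)) - F (E (D f)) - (D (E (F f)) - E (D (F f))))"
        by (simp only: commutator_def plus_fun_apply Lie_apply_diff[OF D] Lie_apply_diff[OF E]
            Lie_apply_diff[OF F] cl)
      also have "\<dots> = 0" by (simp only: algebra_simps diff_self)
      finally show "(commutator D (commutator E F) + commutator E (commutator F D) +
          commutator F (commutator D E)) f = 0 f" by (simp only: zero_fun_apply)
    qed
  next
    show "commutator D D = 0" for D :: "('a, 'b) operator"
      by (rule ext) (simp only: commutator_def diff_self zero_fun_apply)
  qed
qed

text \<open>The inner existential expresses that \<open>stabiliser \<gamma>\<close> is a generic stabiliser.\<close>

definition has_generic_stabiliser :: "('k::field_char_0 ^ 'n) monoid \<Rightarrow> bool" where
  "has_generic_stabiliser Q \<longleftrightarrow>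
     (\<exists>\<gamma>\<in>lie_algebra.dual scale_op (Lie Q).
        \<exists>U. openin (lie_algebra.dual_zariski scale_op (Lie Q)) U \<and> U \<noteq> {} \<and>
          (\<forall>\<beta>\<in>U. \<exists>g\<in>carrier Q.
             Ad Q g ` lie_algebra.stabiliser (Lie Q) commutator \<gamma> =
               lie_algebra.stabiliser (Lie Q) commutator \<beta>))"

end

theory Submission
  imports Defs
begin

text \<open>
  A form \<open>\<alpha>\<close> is contact iff \<open>\<alpha>\<close> does not vanish on any nonzero element of its stabiliser
  \<open>\<qq>\<^sub>\<alpha>\<close>. At such an \<open>\<alpha>\<close> the tangent space \<open>\<qq> \<cdot> \<alpha> + K \<alpha>\<close> of the orbit of \<open>K \<alpha>\<close> is all of
  \<open>\<qq>\<^sup>*\<close>, so \<open>Q \<cdot> K \<alpha>\<close> contains a nonempty open set, and all \<open>g \<cdot> c\<alpha>\<close> with \<open>c \<noteq> 0\<close> have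
  stabiliser \<open>Ad(g) \<qq>\<^sub>\<alpha>\<close>.

  Conversely, if \<open>\<qq>\<close> has index one and is not contact, then \<open>\<beta>(\<qq>\<^sub>\<beta>) = 0\<close> for all regular \<open>\<beta>\<close>.
  If \<open>K \<xi>\<close> is a generic stabiliser, then general \<open>\<beta>\<close> lie in \<open>Q \<cdot> V\<close>, where \<open>V\<close> is the annihilator of
  \<open>K \<xi> + [\<xi>, \<qq>]\<close>. The image of the differential of \<open>Q \<times> V \<rightarrow> \<qq>\<^sup>*\<close> at \<open>(1, w)\<close> is
  \<open>\<qq> \<cdot> w + V\<close>, which annihilates \<open>\<xi>\<close>; so the differential is nowhere surjective, contradicting
  generic smoothness in characteristic zero.

  Both directions lift general points, and tangent vectors at them, along a dominant morphism. This
  is an extension statement for homomorphisms into the dual numbers, proved by adjoining the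
  generators of the function ring one at a time.
\<close>

section \<open>Extending homomorphisms into the dual numbers\<close>

text \<open>Lifting along the morphism uses neither quotient rings nor fraction fields. It takes
  place in a ring of all functions on an ambient product, which has many zero divisors; statements
  are made modulo a prime ideal, and "nonzero" becomes "outside \<open>P\<close>". Functions
  vanishing on the source form an ideal that is prime only relative to the functions pulled back
  from the target, so it is first enlarged to a prime ideal with the same trace on them. Density of
  the saturation of \<open>K \<alpha>\<close> is read off from equations: the gradient of a
  polynomial vanishing there is killed by all tangent vectors, hence is zero. Its directional
  derivatives then vanish there as well, and in characteristic zero only the zero polynomial
  remains. Contact is defined by wedge powers, stabilisers by brackets; a Pfaffian connects them.
  Taking the \<open>2\<close>-form from one functional and the linear factor from another, fixed one
  gives a polynomial whose nonvanishing confines stabilisers to a line. This makes dimension one an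
  open condition without any rank computations.\<close>

definition unital_subring :: "'r::comm_ring_1 set \<Rightarrow> bool" where
  "unital_subring S \<longleftrightarrow> 1 \<in> S \<and> (\<forall>x\<in>S. \<forall>y\<in>S. x - y \<in> S \<and> x * y \<in> S)"

definition prime_ideal :: "'r::comm_ring_1 set \<Rightarrow> bool" where
  "prime_ideal P \<longleftrightarrow> 0 \<in> P \<and> 1 \<notin> P \<and> (\<forall>x\<in>P. \<forall>y\<in>P. x + y \<in> P) \<and>
     (\<forall>r. \<forall>x\<in>P. r * x \<in> P) \<and> (\<forall>x y. x * y \<in> P \<longrightarrow> x \<in> P \<or> y \<in> P)"

text \<open>Equivalently, \<open>\<phi> + \<epsilon>\<delta>\<close> is a ring homomorphism from \<open>S / (S \<inter> I)\<close> to the dual numbers over \<open>'k\<close>.\<close>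

definition dual_point :: "'r::comm_ring_1 set \<Rightarrow> 'r set \<Rightarrow> ('r \<Rightarrow> 'k::field) \<Rightarrow> ('r \<Rightarrow> 'k) \<Rightarrow> bool" where
  "dual_point S I \<phi> \<delta> \<longleftrightarrow> \<phi> 1 = 1 \<and>
     (\<forall>x\<in>S. \<forall>y\<in>S. \<phi> (x + y) = \<phi> x + \<phi> y \<and> \<delta> (x + y) = \<delta> x + \<delta> y \<and>
        \<phi> (x * y) = \<phi> x * \<phi> y \<and> \<delta> (x * y) = \<phi> x * \<delta> y + \<delta> x * \<phi> y) \<and>
     (\<forall>x\<in>S \<inter> I. \<phi> x = 0 \<and> \<delta> x = 0)"

definition polys_over :: "'r::comm_ring_1 set \<Rightarrow> 'r poly set" where
  "polys_over S = {p. \<forall>i. coeff p i \<in> S}"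

definition adjoin :: "'r::comm_ring_1 set \<Rightarrow> 'r \<Rightarrow> 'r set" where
  "adjoin S b = (\<lambda>p. poly p b) ` polys_over S"

text \<open>\<open>pderiv\<close> is only available over rings without zero divisors.\<close>

definition formal_deriv :: "'r::comm_ring_1 poly \<Rightarrow> 'r poly" where
  "formal_deriv p = (\<Sum>i<degree p. monom (of_nat (Suc i) * coeff p (Suc i)) i)"

lemma coeff_formal_deriv: "coeff (formal_deriv p) i = of_nat (Suc i) * coeff p (Suc i)"
proof -
  have "coeff (formal_deriv p) i =
      (\<Sum>j<degree p. if j = i then of_nat (Suc j) * coeff p (Suc j) else 0)"
    unfolding formal_deriv_def coeff_sum by (intro sum.cong) auto
  also have "\<dots> = of_nat (Suc i) * coeff p (Suc i)"
    by (auto simp: not_less coeff_eq_0)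
  finally show ?thesis .
qed

section \<open>Closure rules for subrings and prime ideals\<close>

lemma unital_subringD:
  assumes "unital_subring S"
  shows "0 \<in> S" "1 \<in> S"
    and "x \<in> S \<Longrightarrow> y \<in> S \<Longrightarrow> x - y \<in> S" "x \<in> S \<Longrightarrow> - x \<in> S"
    and "x \<in> S \<Longrightarrow> y \<in> S \<Longrightarrow> x + y \<in> S" "x \<in> S \<Longrightarrow> y \<in> S \<Longrightarrow> x * y \<in> S"
    and "x \<in> S \<Longrightarrow> x ^ n \<in> S" "of_nat n \<in> S"
    and "(\<And>i. i \<in> J \<Longrightarrow> f i \<in> S) \<Longrightarrow> sum f J \<in> S"
proof -
  show 1: "1 \<in> S" and m: "\<And>x y. x \<in> S \<Longrightarrow> y \<in> S \<Longrightarrow> x * y \<in> S"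
    and d: "\<And>x y. x \<in> S \<Longrightarrow> y \<in> S \<Longrightarrow> x - y \<in> S"
    using assms unfolding unital_subring_def by auto
  show 0: "0 \<in> S" using d[OF 1 1] by simp
  show n: "- x \<in> S" if "x \<in> S" for x using d[OF 0 that] by simp
  show a: "x + y \<in> S" if "x \<in> S" "y \<in> S" for x y using d[OF that(1) n[OF that(2)]] by simp
  show "x ^ n \<in> S" if "x \<in> S" using that 1 m by (induction n) auto
  show "of_nat n \<in> S" using 0 1 a by (induction n) auto
  show "sum f J \<in> S" if "\<And>i. i \<in> J \<Longrightarrow> f i \<in> S"
    using that by (induction J rule: infinite_finite_induct) (auto simp: 0 a)
qed

lemma prime_idealD:
  assumes "prime_ideal P"
  shows "0 \<in> P" "1 \<notin> P"
    and "x \<in> P \<Longrightarrow> y \<in> P \<Longrightarrow> x + y \<in> P" "x \<in> P \<Longrightarrow> r * x \<in> P" "x \<in> P \<Longrightarrow> x * r \<in> P"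
    and "x \<in> P \<Longrightarrow> - x \<in> P" "x \<in> P \<Longrightarrow> y \<in> P \<Longrightarrow> x - y \<in> P"
    and "x * y \<in> P \<Longrightarrow> x \<in> P \<or> y \<in> P" "x ^ n \<in> P \<Longrightarrow> x \<in> P"
    and "(\<And>i. i \<in> J \<Longrightarrow> f i \<in> P) \<Longrightarrow> sum f J \<in> P"
proof -
  show 0: "0 \<in> P" "1 \<notin> P" and a: "\<And>x y. x \<in> P \<Longrightarrow> y \<in> P \<Longrightarrow> x + y \<in> P"
    and m: "\<And>x r. x \<in> P \<Longrightarrow> r * x \<in> P" and p: "\<And>x y. x * y \<in> P \<Longrightarrow> x \<in> P \<or> y \<in> P"
    using assms unfolding prime_ideal_def by auto
  show "x * r \<in> P" if "x \<in> P" for x r using m[OF that] by (simp add: mult.commute)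
  show n: "- x \<in> P" if "x \<in> P" for x using m[OF that, of "- 1"] by simp
  show "x - y \<in> P" if "x \<in> P" "y \<in> P" for x y using a[OF that(1) n[OF that(2)]] by simp
  show "x ^ n \<in> P \<Longrightarrow> x \<in> P" using 0 p by (induction n) auto
  show "sum f J \<in> P" if "\<And>i. i \<in> J \<Longrightarrow> f i \<in> P"
    using that by (induction J rule: infinite_finite_induct) (auto simp: 0 a)
qed

lemma prime_ideal_add_cancel:
  assumes "prime_ideal P" "y \<in> P"
  shows "x + y \<in> P \<longleftrightarrow> x \<in> P"
  using assms prime_idealD(3,7)[OF assms(1)] by (metis add_diff_cancel_right')

lemma poly_in_ideal:
  assumes "prime_ideal P" "\<And>i. coeff p i \<in> P"
  shows "poly p x \<in> P"
  unfolding poly_altdef using assms by (intro prime_idealD(10) prime_idealD(5))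

section \<open>Division of polynomials modulo a prime ideal\<close>

context
  fixes S :: "'r::comm_ring_1 set"
  assumes S: "unital_subring S"
begin

lemma polys_over_add: "p \<in> polys_over S \<Longrightarrow> q \<in> polys_over S \<Longrightarrow> p + q \<in> polys_over S"
  and polys_over_diff: "p \<in> polys_over S \<Longrightarrow> q \<in> polys_over S \<Longrightarrow> p - q \<in> polys_over S"
  and polys_over_mult: "p \<in> polys_over S \<Longrightarrow> q \<in> polys_over S \<Longrightarrow> p * q \<in> polys_over S"
  and polys_over_smult: "c \<in> S \<Longrightarrow> p \<in> polys_over S \<Longrightarrow> smult c p \<in> polys_over S"
  and polys_over_monom: "c \<in> S \<Longrightarrow> monom c n \<in> polys_over S"
  and polys_over_const: "c \<in> S \<Longrightarrow> [:c:] \<in> polys_over S"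
  and polys_over_formal_deriv: "p \<in> polys_over S \<Longrightarrow> formal_deriv p \<in> polys_over S"
  and polys_over_0: "0 \<in> polys_over S"
  using unital_subringD[OF S]
  by (auto simp: polys_over_def coeff_mult coeff_pCons coeff_formal_deriv of_nat_Suc[symmetric]
      simp del: of_nat_Suc split: nat.split intro!: unital_subringD(9)[OF S])

lemma adjoin_base: "x \<in> S \<Longrightarrow> x \<in> adjoin S b"
  using polys_over_const[of x] unfolding adjoin_def by (intro image_eqI[of _ _ "[:x:]"]) auto

lemma adjoin_elem: "b \<in> adjoin S b"
  using polys_over_monom[of 1 1] unital_subringD[OF S] unfolding adjoin_def
  by (intro image_eqI[of _ _ "monom 1 1"]) (auto simp: poly_monom)

lemma unital_subring_adjoin: "unital_subring (adjoin S b)"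
proof -
  have "poly p b - poly q b \<in> adjoin S b" "poly p b * poly q b \<in> adjoin S b"
    if "p \<in> polys_over S" "q \<in> polys_over S" for p q
    using polys_over_diff[OF that] polys_over_mult[OF that] unfolding adjoin_def
    by (metis image_eqI poly_diff, metis image_eqI poly_mult)
  moreover have "1 \<in> adjoin S b" using adjoin_base unital_subringD[OF S] by blast
  ultimately show ?thesis unfolding unital_subring_def by (auto simp: adjoin_def)
qed

text \<open>Multiplying by the leading coefficient of \<open>g\<close> replaces dividing by it. The
  induction runs over a bound for the support of \<open>f\<close>, since degrees are unreliable in
  the presence of zero divisors. The remainder is bounded through its coefficients, so that a
  constant \<open>g\<close> leaves remainder zero.\<close>

lemma pseudo_division:
  assumes "f \<in> polys_over S" "g \<in> polys_over S" "\<And>i. i \<ge> N \<Longrightarrow> coeff f i = 0"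
  shows "\<exists>k q r. q \<in> polys_over S \<and> r \<in> polys_over S \<and> smult (lead_coeff g ^ k) f = q * g + r \<and>
    (\<forall>i\<ge>degree g. coeff r i = 0)"
  using assms
proof (induction N arbitrary: f)
  case 0
  then have "f = 0" by (intro poly_eqI) auto
  then show ?case using polys_over_0 by (intro exI[of _ 0]) auto
next
  case (Suc M)
  show ?case
  proof (cases "Suc M \<le> degree g")
    case True
    then show ?thesis using Suc.prems polys_over_0
      by (intro exI[of _ 0] exI[of _ f]) auto
  next
    case False
    define m where "m = monom (coeff f M) (M - degree g)"
    define f' where "f' = smult (lead_coeff g) f - m * g"
    have m: "m \<in> polys_over S"
      using Suc.prems(1) unfolding m_def by (intro polys_over_monom) (auto simp: polys_over_def)
    have lg: "lead_coeff g \<in> S" using Suc.prems(2) by (auto simp: polys_over_def)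
    have f': "f' \<in> polys_over S"
      unfolding f'_def using Suc.prems m lg
      by (intro polys_over_diff polys_over_smult polys_over_mult)
    have "coeff f' i = 0" if "i \<ge> M" for i
    proof (cases "i = M")
      case True
      then show ?thesis using False unfolding f'_def m_def by (simp add: coeff_monom_mult)
    next
      case *: False
      then have "coeff f i = 0" using Suc.prems(3) that by simp
      moreover have "coeff g (i - (M - degree g)) = 0"
        using False * that by (intro coeff_eq_0) auto
      ultimately show ?thesis unfolding f'_def m_def by (simp add: coeff_monom_mult)
    qed
    from Suc.IH[OF f' Suc.prems(2) this] obtain k q r where *:
      "q \<in> polys_over S" "r \<in> polys_over S" "smult (lead_coeff g ^ k) f' = q * g + r"
      "\<forall>i\<ge>degree g. coeff r i = 0" by blast
    have "smult (lead_coeff g ^ Suc k) f = smult (lead_coeff g ^ k) f' + smult (lead_coeff g ^ k) m * g"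
      unfolding f'_def by (simp add: smult_diff_right power_commutes)
    also have "\<dots> = (q + smult (lead_coeff g ^ k) m) * g + r"
      by (simp add: *(3) algebra_simps)
    finally have "smult (lead_coeff g ^ Suc k) f = (q + smult (lead_coeff g ^ k) m) * g + r" .
    moreover have "q + smult (lead_coeff g ^ k) m \<in> polys_over S"
      using * m lg unital_subringD(7)[OF S] by (intro polys_over_add polys_over_smult)
    ultimately show ?thesis using *(2,4) by blast
  qed
qed

context
  fixes P :: "'r set" and b :: 'r
  assumes P: "prime_ideal P"
begin

text \<open>\<open>degree\<close> refers to the ambient ring, not to the quotient by
  \<open>P\<close>. Deleting top coefficients that lie in \<open>P\<close> yields a congruent
  polynomial whose degree is also its degree modulo \<open>P\<close>.\<close>

lemma strip_leading_terms:
  assumes "f \<in> polys_over S" "coeff f j \<notin> P" "\<And>i. i \<ge> N \<Longrightarrow> coeff f i = 0"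
  shows "\<exists>g\<in>polys_over S. lead_coeff g \<notin> P \<and> degree g < N \<and> (\<forall>i. coeff (f - g) i \<in> P)"
  using assms
proof (induction N arbitrary: f)
  case 0
  then show ?case using prime_idealD(1)[OF P] by auto
next
  case (Suc M)
  show ?case
  proof (cases "coeff f M \<in> P")
    case False
    then have "degree f = M"
      using Suc.prems(3) prime_idealD(1)[OF P]
      by (metis Suc_le_eq coeff_0 degree_le le_antisym le_degree lessI)
    then show ?thesis using Suc.prems False prime_idealD(1)[OF P] by (intro bexI[of _ f]) auto
  next
    case True
    define f' where "f' = f - monom (coeff f M) M"
    have c: "coeff f' i = (if i = M then 0 else coeff f i)" for i unfolding f'_def by simp
    have "f' \<in> polys_over S"
      unfolding f'_def using Suc.prems(1)
      by (intro polys_over_diff polys_over_monom) (auto simp: polys_over_def)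
    moreover have "coeff f' j \<notin> P" using Suc.prems(2) True by (auto simp: c)
    moreover have "coeff f' i = 0" if "i \<ge> M" for i using that Suc.prems(3) by (auto simp: c)
    ultimately obtain g where g: "g \<in> polys_over S" "lead_coeff g \<notin> P" "degree g < M"
      "\<And>i. coeff (f' - g) i \<in> P" using Suc.IH by blast
    have "coeff (f - g) i \<in> P" for i
    proof -
      have "coeff (f - g) i = coeff (f' - g) i + (if i = M then coeff f M else 0)" by (simp add: c)
      moreover have "(if i = M then coeff f M else 0) \<in> P" using True prime_idealD(1)[OF P] by simp
      ultimately show ?thesis using prime_idealD(3)[OF P g(4)] by metis
    qed
    with g show ?thesis by (intro bexI[of _ g]) auto
  qed
qed

text \<open>Over the fraction field of \<open>S\<close> modulo \<open>P\<close>, the polynomials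
  with value at \<open>b\<close> in \<open>T\<close> would form a principal ideal; \<open>g\<close>
  is a generator of it up to powers of its leading coefficient. With \<open>T = P\<close> it is the
  minimal polynomial of \<open>b\<close>; with \<open>P\<close> enlarged by one more element it acts
  as a greatest common divisor.\<close>

lemma ideal_pseudo_generator:
  assumes PT: "P \<subseteq> T" and T_diff: "\<And>x y. x \<in> T \<Longrightarrow> y \<in> T \<Longrightarrow> x - y \<in> T"
    and T_mult: "\<And>u x. u \<in> adjoin S b \<Longrightarrow> x \<in> T \<Longrightarrow> u * x \<in> T"
    and f0: "f0 \<in> polys_over S" "poly f0 b \<in> T" "coeff f0 j \<notin> P"
  obtains g where "g \<in> polys_over S" "poly g b \<in> T" "lead_coeff g \<notin> P"
    "\<And>f. f \<in> polys_over S \<Longrightarrow> poly f b \<in> T \<Longrightarrow> lead_coeff f \<notin> P \<Longrightarrow> degree g \<le> degree f"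
    "\<And>f. f \<in> polys_over S \<Longrightarrow> poly f b \<in> T \<Longrightarrow> \<exists>k q r. q \<in> polys_over S \<and>
       (\<forall>i. coeff r i \<in> P) \<and> smult (lead_coeff g ^ k) f = q * g + r \<and> r \<in> polys_over S"
proof -
  define J where "J f \<longleftrightarrow> f \<in> polys_over S \<and> poly f b \<in> T \<and> lead_coeff f \<notin> P" for f
  have strip: "\<exists>g. J g \<and> degree g < N"
    if f: "f \<in> polys_over S" "poly f b \<in> T" "coeff f i \<notin> P" "\<And>i. i \<ge> N \<Longrightarrow> coeff f i = 0" for f i N
  proof -
    obtain g where g: "g \<in> polys_over S" "lead_coeff g \<notin> P" "degree g < N"
      "\<And>i. coeff (f - g) i \<in> P"
      using strip_leading_terms[OF f(1,3,4)] by blast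
    have "poly (f - g) b \<in> P" by (rule poly_in_ideal[OF P g(4)])
    then have "poly f b - poly (f - g) b \<in> T" using T_diff f(2) PT by blast
    then show ?thesis using g unfolding J_def by (intro exI[of _ g]) auto
  qed
  have "coeff f0 i = 0" if "i \<ge> Suc (degree f0)" for i using that by (intro coeff_eq_0) auto
  from strip[OF f0 this] obtain g0 where "J g0" by blast
  then obtain g where g: "J g" "\<And>f. J f \<Longrightarrow> degree g \<le> degree f"
    using exists_least_iff[of "\<lambda>n. \<exists>g. J g \<and> degree g = n"] by (metis not_less)
  have "\<exists>k q r. q \<in> polys_over S \<and> (\<forall>i. coeff r i \<in> P) \<and>
      smult (lead_coeff g ^ k) f = q * g + r \<and> r \<in> polys_over S"
    if f: "f \<in> polys_over S" "poly f b \<in> T" for f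
  proof -
    have "coeff f i = 0" if "i \<ge> Suc (degree f)" for i using that by (intro coeff_eq_0) auto
    from pseudo_division[OF f(1) _ this] g(1) obtain k q r where *: "q \<in> polys_over S"
      "r \<in> polys_over S" "smult (lead_coeff g ^ k) f = q * g + r" "\<And>i. i\<ge>degree g \<Longrightarrow> coeff r i = 0"
      unfolding J_def by blast
    have lg: "lead_coeff g \<in> S" using g(1) unfolding J_def by (auto simp: polys_over_def)
    have "r = smult (lead_coeff g ^ k) f - q * g" using *(3) by (simp add: algebra_simps)
    then have "poly r b = lead_coeff g ^ k * poly f b - poly q b * poly g b" by simp
    also have "\<dots> \<in> T"
    proof (intro T_diff T_mult)
      show "lead_coeff g ^ k \<in> adjoin S b" using lg unital_subringD(7)[OF S] adjoin_base by blast
      show "poly q b \<in> adjoin S b" using *(1) by (auto simp: adjoin_def)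
    qed (use f(2) g(1) J_def in auto)
    finally have "poly r b \<in> T" .
    \<comment> \<open>A remainder that is nonzero modulo \<open>P\<close> could be stripped to a
      competitor of degree below \<open>g\<close>.\<close>
    then have "coeff r i \<in> P" for i
      using strip[OF *(2) _ _ *(4)] g(2) by (metis not_less)
    with * show ?thesis by blast
  qed
  with g show ?thesis using that unfolding J_def by blast
qed

end

end

section \<open>Homomorphisms into the dual numbers and one new generator\<close>

lemma dual_pointD:
  assumes S: "unital_subring S" and pt: "dual_point S I \<phi> \<delta>"
  shows "\<phi> 1 = 1" "\<phi> 0 = 0" "\<delta> 0 = 0" "\<delta> 1 = 0"
    and "x \<in> S \<Longrightarrow> y \<in> S \<Longrightarrow> \<phi> (x + y) = \<phi> x + \<phi> y"
    and "x \<in> S \<Longrightarrow> y \<in> S \<Longrightarrow> \<delta> (x + y) = \<delta> x + \<delta> y"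
    and "x \<in> S \<Longrightarrow> y \<in> S \<Longrightarrow> \<phi> (x * y) = \<phi> x * \<phi> y"
    and "x \<in> S \<Longrightarrow> y \<in> S \<Longrightarrow> \<delta> (x * y) = \<phi> x * \<delta> y + \<delta> x * \<phi> y"
    and "x \<in> S \<Longrightarrow> x \<in> I \<Longrightarrow> \<phi> x = 0" "x \<in> S \<Longrightarrow> x \<in> I \<Longrightarrow> \<delta> x = 0"
    and "x \<in> S \<Longrightarrow> y \<in> S \<Longrightarrow> \<phi> (x - y) = \<phi> x - \<phi> y"
    and "x \<in> S \<Longrightarrow> y \<in> S \<Longrightarrow> \<delta> (x - y) = \<delta> x - \<delta> y"
    and "x \<in> S \<Longrightarrow> \<phi> (x ^ n) = \<phi> x ^ n" "\<phi> (of_nat n) = of_nat n"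
    and "(\<And>i. i \<in> J \<Longrightarrow> f i \<in> S) \<Longrightarrow> \<phi> (sum f J) = (\<Sum>i\<in>J. \<phi> (f i))"
    and "(\<And>i. i \<in> J \<Longrightarrow> f i \<in> S) \<Longrightarrow> \<delta> (sum f J) = (\<Sum>i\<in>J. \<delta> (f i))"
proof -
  show 1: "\<phi> 1 = 1"
    and a: "\<And>x y. x \<in> S \<Longrightarrow> y \<in> S \<Longrightarrow> \<phi> (x + y) = \<phi> x + \<phi> y"
      "\<And>x y. x \<in> S \<Longrightarrow> y \<in> S \<Longrightarrow> \<delta> (x + y) = \<delta> x + \<delta> y"
    and m: "\<And>x y. x \<in> S \<Longrightarrow> y \<in> S \<Longrightarrow> \<phi> (x * y) = \<phi> x * \<phi> y"
      "\<And>x y. x \<in> S \<Longrightarrow> y \<in> S \<Longrightarrow> \<delta> (x * y) = \<phi> x * \<delta> y + \<delta> x * \<phi> y"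
    and "x \<in> S \<Longrightarrow> x \<in> I \<Longrightarrow> \<phi> x = 0" "x \<in> S \<Longrightarrow> x \<in> I \<Longrightarrow> \<delta> x = 0"
    using pt unfolding dual_point_def by auto
  note SD = unital_subringD[OF S]
  show 0: "\<phi> 0 = 0" "\<delta> 0 = 0"
    using a[OF SD(1) SD(1)] by (metis add.right_neutral add_cancel_right_right)+
  show "\<delta> 1 = 0" using m(2)[OF SD(2) SD(2)] 1 by (metis add_cancel_right_right mult_1 mult_1_right)
  show "\<phi> (x - y) = \<phi> x - \<phi> y" "\<delta> (x - y) = \<delta> x - \<delta> y" if "x \<in> S" "y \<in> S"
    using a[of "x - y" y] SD(3) that by (auto simp: eq_diff_eq)
  show "\<phi> (x ^ n) = \<phi> x ^ n" if "x \<in> S"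
    using that 1 m(1) SD(7) by (induction n) auto
  show "\<phi> (of_nat n) = of_nat n"
    using 0 1 a(1)[OF SD(2) SD(8)] by (induction n) auto
  show "\<phi> (sum f J) = (\<Sum>i\<in>J. \<phi> (f i))" "\<delta> (sum f J) = (\<Sum>i\<in>J. \<delta> (f i))"
    if "\<And>i. i \<in> J \<Longrightarrow> f i \<in> S"
    using that by (induction J rule: infinite_finite_induct) (auto simp: 0 a SD(9))
qed

text \<open>The new generator \<open>b\<close> is sent to \<open>t + \<epsilon>s\<close>;
  \<open>E\<close> and \<open>D\<close> are the two components of the value of a polynomial there,
  with its coefficients mapped by \<open>\<phi> + \<epsilon>\<delta>\<close>. The hypothesis
  \<open>vanish\<close> says that the relations of \<open>b\<close> modulo \<open>P\<close> are
  respected; applied to the difference of two polynomials representing the same element, it makes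
  the choice in \<open>rep\<close> harmless.\<close>

lemma dual_point_extend_at:
  fixes \<phi> \<delta> :: "'r::comm_ring_1 \<Rightarrow> 'k::field_char_0"
  assumes S: "unital_subring S" and P: "prime_ideal P" and pt: "dual_point S P \<phi> \<delta>"
    and vanish: "\<And>f. f \<in> polys_over S \<Longrightarrow> poly f b \<in> P \<Longrightarrow> poly (map_poly \<phi> f) t = 0 \<and>
      poly (map_poly \<delta> f) t + s * poly (pderiv (map_poly \<phi> f)) t = 0"
    and q: "q \<in> polys_over S" "poly (map_poly \<phi> q) t \<noteq> 0"
  shows "\<exists>\<phi>' \<delta>'. dual_point (adjoin S b) P \<phi>' \<delta>' \<and> \<phi>' (poly q b) \<noteq> 0 \<and>
    (\<forall>x\<in>S. \<phi>' x = \<phi> x \<and> \<delta>' x = \<delta> x)"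
proof -
  note SD = unital_subringD[OF S] and pd = dual_pointD[OF S pt]
  define E where "E f = poly (map_poly \<phi> f) t" for f
  define D where "D f = poly (map_poly \<delta> f) t + s * poly (pderiv (map_poly \<phi> f)) t" for f
  note coeff_S = polys_over_def[THEN eqset_imp_iff, THEN iffD1, unfolded mem_Collect_eq, rule_format]
  have mp: "map_poly \<phi> (f + g) = map_poly \<phi> f + map_poly \<phi> g"
    "map_poly \<delta> (f + g) = map_poly \<delta> f + map_poly \<delta> g"
    "map_poly \<phi> (f - g) = map_poly \<phi> f - map_poly \<phi> g"
    "map_poly \<delta> (f - g) = map_poly \<delta> f - map_poly \<delta> g"
    "map_poly \<phi> (f * g) = map_poly \<phi> f * map_poly \<phi> g"
    "map_poly \<delta> (f * g) = map_poly \<phi> f * map_poly \<delta> g + map_poly \<delta> f * map_poly \<phi> g"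
    if "f \<in> polys_over S" "g \<in> polys_over S" for f g
    using coeff_S[OF that(1)] coeff_S[OF that(2)]
    by (auto intro!: poly_eqI sum.cong simp: coeff_map_poly coeff_mult pd SD sum.distrib[symmetric])
  have E: "E (f + g) = E f + E g" "E (f - g) = E f - E g" "E (f * g) = E f * E g"
    and D: "D (f + g) = D f + D g" "D (f - g) = D f - D g" "D (f * g) = E f * D g + D f * E g"
    if "f \<in> polys_over S" "g \<in> polys_over S" for f g
    unfolding E_def D_def mp[OF that]
    by (auto simp: pderiv_add pderiv_diff pderiv_mult algebra_simps)
  define rep where "rep x = (SOME f. f \<in> polys_over S \<and> poly f b = x)" for x
  have rep: "rep (poly f b) \<in> polys_over S \<and> poly (rep (poly f b)) b = poly f b"
    if "f \<in> polys_over S" for f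
    unfolding rep_def by (rule someI[of _ f]) (use that in auto)
  have ED_rep: "E (rep (poly f b)) = E f \<and> D (rep (poly f b)) = D f" if f: "f \<in> polys_over S" for f
  proof -
    let ?g = "rep (poly f b)"
    have g: "?g \<in> polys_over S" "poly (f - ?g) b = 0" using rep[OF f] by auto
    have "f - ?g \<in> polys_over S" using polys_over_diff[OF S] f g by blast
    from vanish[OF this] have "E (f - ?g) = 0" "D (f - ?g) = 0"
      unfolding E_def D_def using g(2) prime_idealD(1)[OF P] by auto
    then show ?thesis using E(2)[OF f g(1)] D(2)[OF f g(1)] by simp
  qed
  define \<phi>' where "\<phi>' x = E (rep x)" for x
  define \<delta>' where "\<delta>' x = D (rep x)" for x
  have val: "\<phi>' (poly f b) = E f" "\<delta>' (poly f b) = D f" if "f \<in> polys_over S" for f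
    using ED_rep[OF that] by (auto simp: \<phi>'_def \<delta>'_def)
  have const: "\<phi>' x = \<phi> x \<and> \<delta>' x = \<delta> x" if "x \<in> S" for x
  proof -
    have "map_poly \<phi> [:x:] = [:\<phi> x:]" "map_poly \<delta> [:x:] = [:\<delta> x:]"
      by (auto intro!: poly_eqI simp: coeff_map_poly pd coeff_pCons split: nat.split)
    then show ?thesis
      using val[OF polys_over_const[OF S that]] by (simp add: E_def D_def)
  qed
  have "dual_point (adjoin S b) P \<phi>' \<delta>'"
    unfolding dual_point_def adjoin_def
  proof (intro conjI ballI)
    show "\<phi>' 1 = 1" using const[OF SD(2)] pd(1) by simp
  next
    fix x y assume "x \<in> (\<lambda>p. poly p b) ` polys_over S" "y \<in> (\<lambda>p. poly p b) ` polys_over S"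
    then obtain f g where f: "f \<in> polys_over S" "x = poly f b" and g: "g \<in> polys_over S" "y = poly g b"
      by blast
    note fg = f(1) g(1)
    show "\<phi>' (x + y) = \<phi>' x + \<phi>' y" "\<delta>' (x + y) = \<delta>' x + \<delta>' y"
      using val[OF polys_over_add[OF S fg]] E(1)[OF fg] D(1)[OF fg] val[OF fg(1)] val[OF fg(2)]
      by (simp_all add: f g)
    show "\<phi>' (x * y) = \<phi>' x * \<phi>' y" "\<delta>' (x * y) = \<phi>' x * \<delta>' y + \<delta>' x * \<phi>' y"
      using val[OF polys_over_mult[OF S fg]] E(3)[OF fg] D(3)[OF fg] val[OF fg(1)] val[OF fg(2)]
      by (simp_all add: f g)
  next
    fix x assume "x \<in> (\<lambda>p. poly p b) ` polys_over S \<inter> P"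
    then obtain f where f: "f \<in> polys_over S" "x = poly f b" "poly f b \<in> P" by blast
    show "\<phi>' x = 0" "\<delta>' x = 0"
      using vanish[OF f(1,3)] val[OF f(1)] by (auto simp: f(2) E_def D_def)
  qed
  moreover have "\<phi>' (poly q b) \<noteq> 0" using val(1)[OF q(1)] q(2) by (simp add: E_def)
  ultimately show ?thesis using const by blast
qed

lemma exists_non_root:
  fixes p :: "'k::field_char_0 poly"
  assumes "p \<noteq> 0"
  shows "\<exists>t. poly p t \<noteq> 0"
  using poly_roots_finite[OF assms] infinite_UNIV_char_0[where 'a='k]
  by (metis (mono_tags, lifting) UNIV_eq_I mem_Collect_eq)

text \<open>No relation modulo \<open>P\<close> constrains the image of \<open>b\<close>, so its
  tangent component may be \<open>0\<close> and its value only has to avoid the roots of the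
  specialised \<open>q\<close>. For \<open>a\<close> serves any coefficient of \<open>q\<close>
  outside \<open>P\<close>: where it survives, the specialised \<open>q\<close> is not the zero
  polynomial.\<close>

lemma dual_point_extension_transcendental:
  fixes S P :: "'r::comm_ring_1 set"
  assumes S: "unital_subring S" and P: "prime_ideal P"
    and trans: "\<And>f i. f \<in> polys_over S \<Longrightarrow> poly f b \<in> P \<Longrightarrow> coeff f i \<in> P"
    and q: "q \<in> polys_over S" "poly q b \<notin> P"
  shows "\<exists>a\<in>S. a \<notin> P \<and> (\<forall>\<phi> \<delta>::'r \<Rightarrow> 'k::field_char_0. dual_point S P \<phi> \<delta> \<longrightarrow> \<phi> a \<noteq> 0 \<longrightarrow>
    (\<exists>\<phi>' \<delta>'. dual_point (adjoin S b) P \<phi>' \<delta>' \<and> \<phi>' (poly q b) \<noteq> 0 \<and>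
       (\<forall>x\<in>S. \<phi>' x = \<phi> x \<and> \<delta>' x = \<delta> x)))"
proof -
  obtain i where i: "coeff q i \<notin> P" using poly_in_ideal[OF P] q(2) by blast
  have coeff_S: "coeff f i \<in> S" if "f \<in> polys_over S" for f i using that by (auto simp: polys_over_def)
  show ?thesis
  proof (intro bexI[of _ "coeff q i"] conjI allI impI)
    fix \<phi> \<delta> :: "'r \<Rightarrow> 'k" assume pt: "dual_point S P \<phi> \<delta>" and nz: "\<phi> (coeff q i) \<noteq> 0"
    note pd = dual_pointD[OF S pt]
    have "map_poly \<phi> q \<noteq> 0" using nz by (metis coeff_map_poly coeff_0 pd(2))
    then obtain t where t: "poly (map_poly \<phi> q) t \<noteq> 0" using exists_non_root by blast
    have "map_poly \<phi> f = 0 \<and> map_poly \<delta> f = 0" if f: "f \<in> polys_over S" "poly f b \<in> P" for f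
      using trans[OF f] coeff_S[OF f(1)] by (auto intro!: poly_eqI simp: coeff_map_poly pd)
    then show "\<exists>\<phi>' \<delta>'. dual_point (adjoin S b) P \<phi>' \<delta>' \<and> \<phi>' (poly q b) \<noteq> 0 \<and>
        (\<forall>x\<in>S. \<phi>' x = \<phi> x \<and> \<delta>' x = \<delta> x)"
      using dual_point_extend_at[OF S P pt _ q(1) t, where s = 0] by simp
  qed (use i coeff_S q(1) in auto)
qed

text \<open>The value \<open>t\<close> of \<open>b\<close> must be a root of the specialised minimal
  polynomial \<open>p\<close>, and its tangent component then solves a linear equation with
  coefficient \<open>p'(t)\<close>. So \<open>t\<close> has to be a simple root, which is where
  characteristic zero enters: \<open>p'(b)\<close> is nonzero modulo \<open>P\<close>. Being
  algebraic, \<open>p'(b)\<close> and \<open>q(b)\<close> divide a nonzero element of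
  \<open>S\<close> modulo \<open>P\<close>, and nonvanishing of that element is a condition on the
  base alone.\<close>

lemma dual_point_extension_algebraic:
  fixes S P :: "'r::comm_ring_1 set"
  assumes S: "unital_subring S" and P: "prime_ideal P" and char: "\<And>n. n > 0 \<Longrightarrow> of_nat n \<notin> P"
    and p0: "p0 \<in> polys_over S" "poly p0 b \<in> P" "coeff p0 j \<notin> P"
    and q: "q \<in> polys_over S" "poly q b \<notin> P"
  shows "\<exists>a\<in>S. a \<notin> P \<and> (\<forall>\<phi> \<delta>::'r \<Rightarrow> 'k::{alg_closed_field, field_char_0}.
    dual_point S P \<phi> \<delta> \<longrightarrow> \<phi> a \<noteq> 0 \<longrightarrow>
    (\<exists>\<phi>' \<delta>'. dual_point (adjoin S b) P \<phi>' \<delta>' \<and> \<phi>' (poly q b) \<noteq> 0 \<and>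
       (\<forall>x\<in>S. \<phi>' x = \<phi> x \<and> \<delta>' x = \<delta> x)))"
proof -
  note SD = unital_subringD[OF S] and PD = prime_idealD[OF P]
  have coeff_S: "coeff f i \<in> S" if "f \<in> polys_over S" for f i using that by (auto simp: polys_over_def)
  obtain p where p: "p \<in> polys_over S" "poly p b \<in> P" "lead_coeff p \<notin> P"
    and p_min: "\<And>f. f \<in> polys_over S \<Longrightarrow> poly f b \<in> P \<Longrightarrow> lead_coeff f \<notin> P \<Longrightarrow> degree p \<le> degree f"
    and p_div: "\<And>f. f \<in> polys_over S \<Longrightarrow> poly f b \<in> P \<Longrightarrow> \<exists>k q r. q \<in> polys_over S \<and>
      (\<forall>i. coeff r i \<in> P) \<and> smult (lead_coeff p ^ k) f = q * p + r \<and> r \<in> polys_over S"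
    using ideal_pseudo_generator[OF S P subset_refl PD(7) PD(4) p0] by blast
  have low: "coeff f i \<in> P"
    if f: "f \<in> polys_over S" "poly f b \<in> P" "\<And>i. i \<ge> degree p \<Longrightarrow> coeff f i = 0" for f i
  proof (rule ccontr)
    assume "coeff f i \<notin> P"
    from strip_leading_terms[OF S P f(1) this f(3)] obtain g where
      g: "g \<in> polys_over S" "lead_coeff g \<notin> P" "degree g < degree p" "\<And>i. coeff (f - g) i \<in> P"
      by blast
    have "poly (f - g) b \<in> P" by (rule poly_in_ideal[OF P g(4)])
    then have "poly f b - poly (f - g) b \<in> P" using f(2) PD(7) by blast
    then have "poly g b \<in> P" by simp
    from p_min[OF g(1) this g(2)] g(3) show False by simp
  qed
  have deg_pos: "degree p > 0"
  proof (rule ccontr)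
    assume "\<not> degree p > 0"
    then have "poly p b = lead_coeff p" by (auto elim: degree_eq_zeroE)
    with p(2,3) show False by simp
  qed
  have dp: "formal_deriv p \<in> polys_over S" by (rule polys_over_formal_deriv[OF S p(1)])
  have dp_notin: "poly (formal_deriv p) b \<notin> P"
  proof
    assume "poly (formal_deriv p) b \<in> P"
    from low[OF dp this] have "coeff (formal_deriv p) (degree p - 1) \<in> P"
      by (auto simp: coeff_formal_deriv coeff_eq_0)
    then have "of_nat (degree p) * lead_coeff p \<in> P"
      using deg_pos unfolding coeff_formal_deriv by simp
    then show False using PD(8) p(3) char deg_pos by blast
  qed
  \<comment> \<open>One product controls both requirements at \<open>t\<close>: \<open>q\<close>
    stays nonzero and the root stays simple.\<close>
  define e where "e = q * formal_deriv p"
  have e: "e \<in> polys_over S" "poly e b \<notin> P"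
    using q dp dp_notin PD(8) polys_over_mult[OF S] unfolding e_def by auto
  \<comment> \<open>Multiples of \<open>e(b)\<close> modulo \<open>P\<close>. The goal is an element
    of \<open>S\<close> in \<open>T\<close> but outside \<open>P\<close>, that is, a
    pseudo-generator \<open>g\<close> of degree zero.\<close>
  define T where "T = {x. \<exists>u\<in>polys_over S. x - poly u b * poly e b \<in> P}"
  have T_diff: "x - y \<in> T" if "x \<in> T" "y \<in> T" for x y
  proof -
    from that obtain u v where uv: "u \<in> polys_over S" "x - poly u b * poly e b \<in> P"
      "v \<in> polys_over S" "y - poly v b * poly e b \<in> P" unfolding T_def by blast
    have "x - y - poly (u - v) b * poly e b =
        (x - poly u b * poly e b) - (y - poly v b * poly e b)" by (simp add: algebra_simps)
    also have "\<dots> \<in> P" using PD(7) uv by blast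
    finally show ?thesis unfolding T_def using polys_over_diff[OF S uv(1,3)] by blast
  qed
  have T_mult: "u * x \<in> T" if "u \<in> adjoin S b" "x \<in> T" for u x
  proof -
    from that obtain v w where vw: "v \<in> polys_over S" "u = poly v b" "w \<in> polys_over S"
      "x - poly w b * poly e b \<in> P" unfolding T_def adjoin_def by blast
    have "u * x - poly (v * w) b * poly e b = u * (x - poly w b * poly e b)"
      by (simp add: vw(2) algebra_simps)
    also have "\<dots> \<in> P" using PD(4) vw by blast
    finally show ?thesis unfolding T_def using polys_over_mult[OF S vw(1,3)] by blast
  qed
  have PT: "P \<subseteq> T" unfolding T_def using polys_over_0[OF S] by (auto intro!: bexI[of _ 0])
  have eT: "poly e b \<in> T"
    unfolding T_def using polys_over_const[OF S SD(2)] PD(1) by (auto intro!: bexI[of _ "[:1:]"])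
  obtain g where g: "g \<in> polys_over S" "poly g b \<in> T" "lead_coeff g \<notin> P"
    and g_min: "\<And>f. f \<in> polys_over S \<Longrightarrow> poly f b \<in> T \<Longrightarrow> lead_coeff f \<notin> P \<Longrightarrow> degree g \<le> degree f"
    and g_div: "\<And>f. f \<in> polys_over S \<Longrightarrow> poly f b \<in> T \<Longrightarrow> \<exists>k q r. q \<in> polys_over S \<and>
      (\<forall>i. coeff r i \<in> P) \<and> smult (lead_coeff g ^ k) f = q * g + r \<and> r \<in> polys_over S"
    using ideal_pseudo_generator[OF S P PT T_diff T_mult p(1) subsetD[OF PT p(2)] p(3)] by blast
  \<comment> \<open>This expresses the irreducibility of \<open>p\<close>: the pseudo-quotient
    \<open>r\<close> of \<open>p\<close> by \<open>g\<close> satisfies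
    \<open>r(b) g(b) \<in> P\<close>, and each of the two factors leads to a contradiction.\<close>
  have "degree g = 0"
  proof (rule ccontr)
    assume g_pos: "degree g \<noteq> 0"
    obtain k r s where *: "r \<in> polys_over S" "\<And>i. coeff s i \<in> P"
      "smult (lead_coeff g ^ k) p = r * g + s" using g_div[OF p(1)] p(2) PT by blast
    have "poly r b * poly g b = lead_coeff g ^ k * poly p b - poly s b"
      using arg_cong[OF *(3), of "\<lambda>f. poly f b"] by simp
    also have "\<dots> \<in> P" using PD(4,7) p(2) poly_in_ideal[OF P *(2)] by blast
    finally consider "poly r b \<in> P" | "poly g b \<in> P" using PD(8) by blast
    then show False
    proof cases
      case 1
      \<comment> \<open>If \<open>r\<close> survived modulo \<open>P\<close>, minimality would force
        its degree up to that of \<open>p\<close>, and \<open>r * g\<close> would be nonzero modulo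
        \<open>P\<close> in a degree above that of \<open>p\<close>.\<close>
      have "coeff r i \<in> P" for i
      proof (rule ccontr)
        assume "coeff r i \<notin> P"
        from strip_leading_terms[OF S P *(1) this coeff_eq_0[OF Suc_le_lessD]] obtain r' where
          r': "r' \<in> polys_over S" "lead_coeff r' \<notin> P" "\<And>i. coeff (r - r') i \<in> P"
          by blast
        have "poly r b - poly (r - r') b \<in> P" using 1 PD(7) poly_in_ideal[OF P r'(3)] by blast
        then have "degree p \<le> degree r'" using p_min[OF r'(1)] r'(2) by simp
        let ?m = "degree r' + degree g"
        have lead: "coeff (r' * g) ?m \<notin> P" using PD(8) r'(2) g(3) by (auto simp: coeff_mult_degree_sum)
        have "coeff (r * g) ?m = coeff (r' * g) ?m + coeff ((r - r') * g) ?m"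
          by (simp add: algebra_simps)
        moreover have "coeff ((r - r') * g) ?m \<in> P"
          unfolding coeff_mult using r'(3) by (intro PD(10) PD(5))
        moreover have "coeff (r * g) ?m = - coeff s ?m"
        proof -
          have "coeff (r * g + s) ?m = 0"
            using \<open>degree p \<le> degree r'\<close> g_pos unfolding *(3)[symmetric] by (simp add: coeff_eq_0)
          then show ?thesis by (simp add: add_eq_0_iff)
        qed
        ultimately have "- coeff s ?m = coeff (r' * g) ?m + coeff ((r - r') * g) ?m"
          and "coeff ((r - r') * g) ?m \<in> P" by auto
        with PD(6)[OF *(2)[of ?m]] lead prime_ideal_add_cancel[OF P] show False by auto
      qed
      then have "coeff (r * g + s) (degree p) \<in> P"
        using *(2) by (auto simp: coeff_mult intro!: PD(3) PD(10) PD(5))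
      then show False using PD(8,9) g(3) p(3) unfolding *(3)[symmetric] by auto
    next
      case 2
      \<comment> \<open>Here \<open>g\<close> has at least the degree of \<open>p\<close>, whereas
        the remainder of \<open>e\<close> modulo \<open>p\<close> represents an element of
        \<open>T\<close> of smaller degree.\<close>
      have "coeff e i = 0" if "i \<ge> Suc (degree e)" for i using that by (intro coeff_eq_0) auto
      from pseudo_division[OF S e(1) p(1) this] obtain k r s where *:
        "r \<in> polys_over S" "s \<in> polys_over S" "smult (lead_coeff p ^ k) e = r * p + s"
        "\<And>i. i \<ge> degree p \<Longrightarrow> coeff s i = 0" by blast
      have s_eq: "lead_coeff p ^ k * poly e b = poly r b * poly p b + poly s b"
        using arg_cong[OF *(3), of "\<lambda>f. poly f b"] by simp
      have "poly s b \<notin> P"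
        using PD(8)[of "lead_coeff p ^ k" "poly e b"] PD(9)[of "lead_coeff p" k] p(3) e(2) PD(3,4) p(2)
        unfolding s_eq by blast
      then obtain i where "coeff s i \<notin> P" using poly_in_ideal[OF P] by blast
      from strip_leading_terms[OF S P *(2) this *(4)] obtain s' where
        s': "s' \<in> polys_over S" "lead_coeff s' \<notin> P" "degree s' < degree p" "\<And>i. coeff (s - s') i \<in> P"
        by blast
      have "poly s' b = lead_coeff p ^ k * poly e b - (poly r b * poly p b + poly (s - s') b)"
        using s_eq by (simp add: algebra_simps)
      also have "\<dots> \<in> T"
      proof (intro T_diff T_mult eT)
        show "lead_coeff p ^ k \<in> adjoin S b"
          using coeff_S[OF p(1)] SD(7) adjoin_base[OF S] by blast
        show "poly r b * poly p b + poly (s - s') b \<in> T"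
          using PT PD(3,4) p(2) poly_in_ideal[OF P s'(4)] by blast
      qed
      finally have "degree g \<le> degree s'" using g_min[OF s'(1) _ s'(2)] by blast
      moreover have "degree p \<le> degree g" using p_min[OF g(1) 2 g(3)] .
      ultimately show False using s'(3) by simp
    qed
  qed
  then obtain a0 where a0: "g = [:a0:]" by (auto elim: degree_eq_zeroE)
  have a0': "a0 \<notin> P" "a0 \<in> S" using g(3) coeff_S[OF g(1), of 0] by (auto simp: a0)
  obtain u where u: "u \<in> polys_over S" "a0 - poly u b * poly e b \<in> P"
    using g(2) unfolding T_def a0 by auto
  show ?thesis
  \<comment> \<open>The factor \<open>lead_coeff p\<close> keeps the degree of the specialised
    \<open>p\<close> positive, so that it has a root, and makes pseudo-division by \<open>p\<close>
    survive specialisation. The factor \<open>a0\<close> keeps \<open>e\<close> nonzero at that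
    root, because \<open>a0\<close> is a multiple of \<open>e(b)\<close> modulo
    \<open>P\<close>.\<close>
  proof (intro bexI[of _ "lead_coeff p * a0"] conjI allI impI)
    show "lead_coeff p * a0 \<in> S" using SD(6) a0' coeff_S[OF p(1)] by blast
    show "lead_coeff p * a0 \<notin> P" using PD(8) a0' p(3) by blast
    fix \<phi> \<delta> :: "'r \<Rightarrow> 'k" assume pt: "dual_point S P \<phi> \<delta>" and nz: "\<phi> (lead_coeff p * a0) \<noteq> 0"
    note pd = dual_pointD[OF S pt]
    have nz: "\<phi> (lead_coeff p) \<noteq> 0" "\<phi> a0 \<noteq> 0"
      using nz pd(7)[OF coeff_S[OF p(1)] a0'(2)] by auto
    have mult: "map_poly \<phi> (f * g) = map_poly \<phi> f * map_poly \<phi> g"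
      "map_poly \<delta> (f * g) = map_poly \<phi> f * map_poly \<delta> g + map_poly \<delta> f * map_poly \<phi> g"
      and add: "map_poly \<phi> (f + g) = map_poly \<phi> f + map_poly \<phi> g"
      "map_poly \<delta> (f + g) = map_poly \<delta> f + map_poly \<delta> g"
      and diff: "map_poly \<phi> (f - g) = map_poly \<phi> f - map_poly \<phi> g"
      if "f \<in> polys_over S" "g \<in> polys_over S" for f g
      using coeff_S[OF that(1)] coeff_S[OF that(2)]
      by (auto intro!: poly_eqI sum.cong simp: coeff_map_poly coeff_mult pd SD sum.distrib[symmetric])
    have smult: "map_poly \<phi> (smult c f) = smult (\<phi> c) (map_poly \<phi> f)"
      "map_poly \<delta> (smult c f) = smult (\<phi> c) (map_poly \<delta> f) + smult (\<delta> c) (map_poly \<phi> f)"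
      if "c \<in> S" "f \<in> polys_over S" for c f
      using that(1) coeff_S[OF that(2)] by (auto intro!: poly_eqI simp: coeff_map_poly pd)
    have const: "map_poly \<phi> [:a0:] = [:\<phi> a0:]"
      by (rule poly_eqI) (simp add: coeff_map_poly pd coeff_pCons split: nat.split)
    have van: "map_poly \<phi> r = 0 \<and> map_poly \<delta> r = 0"
      if "r \<in> polys_over S" "\<And>i. coeff r i \<in> P" for r
      using that(2) coeff_S[OF that(1)] by (auto intro!: poly_eqI simp: coeff_map_poly pd)
    have "degree (map_poly \<phi> p) > 0"
      using nz(1) deg_pos by (metis coeff_map_poly le_degree less_le_trans pd(2))
    then obtain t where t: "poly (map_poly \<phi> p) t = 0" using alg_closed_imp_poly_has_root by blast
    have E_van: "poly (map_poly \<phi> f) t = 0" if f: "f \<in> polys_over S" "poly f b \<in> P" for f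
    proof -
      obtain k r s where *: "r \<in> polys_over S" "\<And>i. coeff s i \<in> P" "s \<in> polys_over S"
        "smult (lead_coeff p ^ k) f = r * p + s" using p_div[OF f] by blast
      have "smult (\<phi> (lead_coeff p ^ k)) (map_poly \<phi> f) = map_poly \<phi> r * map_poly \<phi> p"
        using arg_cong[OF *(4), of "map_poly \<phi>"] smult(1)[OF SD(7)[OF coeff_S[OF p(1)]] f(1)]
          add(1)[OF polys_over_mult[OF S *(1) p(1)] *(3)] mult(1)[OF *(1) p(1)] van[OF *(3,2)]
        by simp
      from arg_cong[OF this, of "\<lambda>f. poly f t"] t nz(1) show ?thesis
        using pd(13)[OF coeff_S[OF p(1)]] by simp
    qed
    have "[:a0:] - u * e \<in> polys_over S"
      using a0'(2) u(1) e(1) polys_over_const[OF S] polys_over_mult[OF S] polys_over_diff[OF S] by blast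
    then have "poly (map_poly \<phi> ([:a0:] - u * e)) t = 0" by (rule E_van) (use u(2) in simp)
    then have "\<phi> a0 = poly (map_poly \<phi> u) t * poly (map_poly \<phi> e) t"
      using diff[OF polys_over_const[OF S a0'(2)] polys_over_mult[OF S u(1) e(1)]] mult(1)[OF u(1) e(1)]
        const by simp
    then have "poly (map_poly \<phi> e) t \<noteq> 0" using nz(2) by auto
    then have nz': "poly (map_poly \<phi> q) t \<noteq> 0" "poly (map_poly \<phi> (formal_deriv p)) t \<noteq> 0"
      unfolding e_def mult(1)[OF q(1) dp] by auto
    have "map_poly \<phi> (formal_deriv p) = pderiv (map_poly \<phi> p)"
      using coeff_S[OF p(1)] SD(8)
      by (intro poly_eqI)
        (simp only: coeff_map_poly pd coeff_formal_deriv coeff_pderiv)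
    with nz'(2) have sep: "poly (pderiv (map_poly \<phi> p)) t \<noteq> 0" by simp
    \<comment> \<open>The solution of the linear equation \<open>D p = 0\<close> for the tangent
      component of \<open>b\<close>.\<close>
    define s where "s = - poly (map_poly \<delta> p) t / poly (pderiv (map_poly \<phi> p)) t"
    define D where "D f = poly (map_poly \<delta> f) t + s * poly (pderiv (map_poly \<phi> f)) t" for f
    have Dp: "D p = 0" unfolding D_def s_def using sep by simp
    have D_van: "D f = 0" if f: "f \<in> polys_over S" "poly f b \<in> P" for f
    proof -
      obtain k r s' where *: "r \<in> polys_over S" "\<And>i. coeff s' i \<in> P" "s' \<in> polys_over S"
        "smult (lead_coeff p ^ k) f = r * p + s'" using p_div[OF f] by blast
      note ck = SD(7)[OF coeff_S[OF p(1)], of "degree p" k]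
      have "D (smult (lead_coeff p ^ k) f) = \<phi> (lead_coeff p ^ k) * D f + \<delta> (lead_coeff p ^ k) * 0"
        unfolding D_def smult[OF ck f(1)] using E_van[OF f]
        by (simp add: pderiv_smult algebra_simps)
      moreover have "D (r * p + s') = 0"
      proof -
        have "D (r * p + s') = poly (map_poly \<phi> r) t * D p"
          unfolding D_def add[OF polys_over_mult[OF S *(1) p(1)] *(3)] mult[OF *(1) p(1)]
          using t van[OF *(3,2)] by (simp add: pderiv_mult algebra_simps)
        then show ?thesis using Dp by simp
      qed
      ultimately show ?thesis using *(4) nz(1) pd(13)[OF coeff_S[OF p(1)]] by simp
    qed
    show "\<exists>\<phi>' \<delta>'. dual_point (adjoin S b) P \<phi>' \<delta>' \<and> \<phi>' (poly q b) \<noteq> 0 \<and>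
        (\<forall>x\<in>S. \<phi>' x = \<phi> x \<and> \<delta>' x = \<delta> x)"
      using dual_point_extend_at[OF S P pt conjI[OF E_van D_van[unfolded D_def]] q(1) nz'(1)] .
  qed
qed

text \<open>The clause about \<open>h\<close> exists for the induction: the element that has to stay
  nonzero for the later generators becomes the \<open>h\<close> of the first one, and the condition
  is thus pushed down to \<open>S\<close>.\<close>

lemma dual_point_extension_finite:
  fixes S P :: "'r::comm_ring_1 set"
  assumes "unital_subring S" and P: "prime_ideal P" and char: "\<And>n. n > 0 \<Longrightarrow> of_nat n \<notin> P"
    and "h \<in> foldl adjoin S bs" "h \<notin> P"
  shows "\<exists>a\<in>S. a \<notin> P \<and> (\<forall>\<phi> \<delta>::'r \<Rightarrow> 'k::{alg_closed_field, field_char_0}.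
    dual_point S P \<phi> \<delta> \<longrightarrow> \<phi> a \<noteq> 0 \<longrightarrow>
    (\<exists>\<phi>' \<delta>'. dual_point (foldl adjoin S bs) P \<phi>' \<delta>' \<and> \<phi>' h \<noteq> 0 \<and>
       (\<forall>x\<in>S. \<phi>' x = \<phi> x \<and> \<delta>' x = \<delta> x)))"
  using assms(1,4,5)
proof (induction bs arbitrary: S)
  case Nil
  then show ?case by auto
next
  case (Cons b bs)
  note S = Cons.prems(1)
  from Cons.IH[OF unital_subring_adjoin[OF S]] Cons.prems(2,3) obtain a' where
    a': "a' \<in> adjoin S b" "a' \<notin> P" and
    ext: "\<And>\<phi> \<delta> :: 'r \<Rightarrow> 'k. dual_point (adjoin S b) P \<phi> \<delta> \<Longrightarrow> \<phi> a' \<noteq> 0 \<Longrightarrow>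
      \<exists>\<phi>' \<delta>'. dual_point (foldl adjoin S (b # bs)) P \<phi>' \<delta>' \<and> \<phi>' h \<noteq> 0 \<and>
       (\<forall>x\<in>adjoin S b. \<phi>' x = \<phi> x \<and> \<delta>' x = \<delta> x)"
    unfolding foldl_Cons by blast
  obtain q where q: "q \<in> polys_over S" "a' = poly q b" using a'(1) unfolding adjoin_def by blast
  have "\<exists>a\<in>S. a \<notin> P \<and> (\<forall>\<phi> \<delta>::'r \<Rightarrow> 'k. dual_point S P \<phi> \<delta> \<longrightarrow> \<phi> a \<noteq> 0 \<longrightarrow>
    (\<exists>\<phi>' \<delta>'. dual_point (adjoin S b) P \<phi>' \<delta>' \<and> \<phi>' (poly q b) \<noteq> 0 \<and>
       (\<forall>x\<in>S. \<phi>' x = \<phi> x \<and> \<delta>' x = \<delta> x)))"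
  proof (cases "\<exists>p0 j. p0 \<in> polys_over S \<and> poly p0 b \<in> P \<and> coeff p0 j \<notin> P")
    case True
    then obtain p0 j where "p0 \<in> polys_over S" "poly p0 b \<in> P" "coeff p0 j \<notin> P" by blast
    from dual_point_extension_algebraic[OF S P char this q(1) a'(2)[unfolded q(2)]]
    show ?thesis .
  next
    case False
    then have "\<And>f i. f \<in> polys_over S \<Longrightarrow> poly f b \<in> P \<Longrightarrow> coeff f i \<in> P" by blast
    from dual_point_extension_transcendental[OF S P this q(1) a'(2)[unfolded q(2)]]
    show ?thesis .
  qed
  then obtain a where a: "a \<in> S" "a \<notin> P" and
    ext1: "\<And>\<phi> \<delta> :: 'r \<Rightarrow> 'k. dual_point S P \<phi> \<delta> \<Longrightarrow> \<phi> a \<noteq> 0 \<Longrightarrow>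
      \<exists>\<phi>' \<delta>'. dual_point (adjoin S b) P \<phi>' \<delta>' \<and> \<phi>' a' \<noteq> 0 \<and>
       (\<forall>x\<in>S. \<phi>' x = \<phi> x \<and> \<delta>' x = \<delta> x)"
    unfolding q(2) by blast
  show ?case
  proof (intro bexI[of _ a] conjI allI impI a)
    fix \<phi> \<delta> :: "'r \<Rightarrow> 'k" assume "dual_point S P \<phi> \<delta>" "\<phi> a \<noteq> 0"
    from ext1[OF this] obtain \<phi>1 \<delta>1 where 1: "dual_point (adjoin S b) P \<phi>1 \<delta>1" "\<phi>1 a' \<noteq> 0"
      "\<And>x. x \<in> S \<Longrightarrow> \<phi>1 x = \<phi> x \<and> \<delta>1 x = \<delta> x" by blast
    from ext[OF 1(1,2)] obtain \<phi>' \<delta>' where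
      "dual_point (foldl adjoin S (b # bs)) P \<phi>' \<delta>'" "\<phi>' h \<noteq> 0"
      "\<And>x. x \<in> adjoin S b \<Longrightarrow> \<phi>' x = \<phi>1 x \<and> \<delta>' x = \<delta>1 x" by blast
    then show "\<exists>\<phi>' \<delta>'. dual_point (foldl adjoin S (b # bs)) P \<phi>' \<delta>' \<and> \<phi>' h \<noteq> 0 \<and>
       (\<forall>x\<in>S. \<phi>' x = \<phi> x \<and> \<delta>' x = \<delta> x)"
      using 1(3) adjoin_base[OF S] by (intro exI[of _ \<phi>'] exI[of _ \<delta>']) simp
  qed
qed

lemma foldl_adjoin:
  assumes "unital_subring S"
  shows "unital_subring (foldl adjoin S bs) \<and> S \<union> set bs \<subseteq> foldl adjoin S bs"
  using assms
proof (induction bs arbitrary: S)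
  case (Cons b bs)
  from Cons.IH[OF unital_subring_adjoin[OF Cons.prems]] adjoin_base[OF Cons.prems, of _ b]
    adjoin_elem[OF Cons.prems, of b]
  show ?case by (auto simp: subset_iff)
qed auto

text \<open>An ideal maximal among those that contain \<open>I\<close> and miss a multiplicative set
  \<open>M\<close> is prime. With \<open>M\<close> the complement of \<open>I\<close> in a subring,
  the prime ideal meets that subring exactly in its intersection with \<open>I\<close>.\<close>

lemma exists_prime_ideal:
  fixes I M :: "'r::comm_ring_1 set"
  assumes I: "0 \<in> I" "\<And>x y. x \<in> I \<Longrightarrow> y \<in> I \<Longrightarrow> x + y \<in> I" "\<And>r x. x \<in> I \<Longrightarrow> r * x \<in> I"
    and M: "1 \<in> M" "\<And>x y. x \<in> M \<Longrightarrow> y \<in> M \<Longrightarrow> x * y \<in> M" and disj: "I \<inter> M = {}"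
  shows "\<exists>P. prime_ideal P \<and> I \<subseteq> P \<and> P \<inter> M = {}"
proof -
  define id where "id J \<longleftrightarrow> 0 \<in> J \<and> (\<forall>x\<in>J. \<forall>y\<in>J. x + y \<in> J) \<and> (\<forall>r. \<forall>x\<in>J. r * x \<in> J)"
    for J :: "'r set"
  define \<A> where "\<A> = {J. id J \<and> I \<subseteq> J \<and> J \<inter> M = {}}"
  have "I \<in> \<A>" using I disj by (auto simp: \<A>_def id_def)
  moreover have "\<Union>\<C> \<in> \<A>" if "\<C> \<noteq> {}" "subset.chain \<A> \<C>" for \<C>
  proof -
    have c: "\<C> \<subseteq> \<A>" "\<And>J K. J \<in> \<C> \<Longrightarrow> K \<in> \<C> \<Longrightarrow> J \<subseteq> K \<or> K \<subseteq> J"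
      using that(2) by (auto simp: subset.chain_def)
    have "x + y \<in> \<Union>\<C>" if "x \<in> \<Union>\<C>" "y \<in> \<Union>\<C>" for x y
    proof -
      from that obtain J K where JK: "J \<in> \<C>" "K \<in> \<C>" "x \<in> J" "y \<in> K" by blast
      with c(2)[OF JK(1,2)] obtain L where L: "L \<in> \<C>" "x \<in> L" "y \<in> L" by blast
      then have "x + y \<in> L" using c(1) by (auto simp: \<A>_def id_def)
      with L(1) show ?thesis by blast
    qed
    moreover have "I \<subseteq> \<Union>\<C>" "0 \<in> \<Union>\<C>" using that(1) c(1) by (auto simp: \<A>_def id_def)
    moreover have "r * x \<in> \<Union>\<C>" if x: "x \<in> \<Union>\<C>" for r x
    proof -
      from x obtain J where J: "J \<in> \<C>" "x \<in> J" by blast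
      then have "r * x \<in> J" using c(1) by (auto simp: \<A>_def id_def)
      with J(1) show ?thesis by blast
    qed
    moreover have "\<Union>\<C> \<inter> M = {}" using c(1) by (auto simp: \<A>_def)
    ultimately show ?thesis unfolding \<A>_def id_def by blast
  qed
  ultimately obtain P where P: "P \<in> \<A>" and max: "\<And>X. X \<in> \<A> \<Longrightarrow> P \<subseteq> X \<Longrightarrow> X = P"
    using subset_Zorn_nonempty[of \<A>] by blast
  have idP: "0 \<in> P" "\<And>x y. x \<in> P \<Longrightarrow> y \<in> P \<Longrightarrow> x + y \<in> P" "\<And>r x. x \<in> P \<Longrightarrow> r * x \<in> P"
    and IP: "I \<subseteq> P" "P \<inter> M = {}"
    using P by (auto simp: \<A>_def id_def)
  \<comment> \<open>Otherwise the ideal generated by \<open>P\<close> and \<open>x\<close> would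
    miss \<open>M\<close> too, against maximality.\<close>
  have meet: "\<exists>p\<in>P. \<exists>r. p + r * x \<in> M" if x: "x \<notin> P" for x
  proof (rule ccontr)
    assume no: "\<not> (\<exists>p\<in>P. \<exists>r. p + r * x \<in> M)"
    define X where "X = {p + r * x |p r. p \<in> P}"
    have "0 + 0 * x \<in> X" unfolding X_def using idP(1) by blast
    moreover have "y + z \<in> X" if "y \<in> X" "z \<in> X" for y z
    proof -
      from that obtain p r p' r' where "p \<in> P" "y = p + r * x" "p' \<in> P" "z = p' + r' * x"
        unfolding X_def by blast
      then have "y + z = (p + p') + (r + r') * x" "p + p' \<in> P"
        using idP(2) by (auto simp: algebra_simps)
      then show ?thesis unfolding X_def by blast
    qed
    moreover have "c * y \<in> X" if "y \<in> X" for y c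
    proof -
      from that obtain p r where "p \<in> P" "y = p + r * x" unfolding X_def by blast
      moreover from this have "c * y = c * p + (c * r) * x" by (simp add: algebra_simps)
      moreover have "c * p \<in> P" using idP(3) \<open>p \<in> P\<close> by blast
      ultimately show ?thesis unfolding X_def by blast
    qed
    moreover have PX: "p \<in> X" if "p \<in> P" for p
    proof -
      have "p + 0 * x \<in> X" unfolding X_def using that by blast
      then show ?thesis by simp
    qed
    ultimately have "X \<in> \<A>" using no IP(1) unfolding \<A>_def id_def X_def by auto
    then have "X = P" using max PX by blast
    moreover have "0 + 1 * x \<in> X" unfolding X_def using idP(1) by blast
    ultimately show False using x by simp
  qed
  have "x \<in> P \<or> y \<in> P" if xy: "x * y \<in> P" for x y
  proof (rule ccontr)
    assume "\<not> (x \<in> P \<or> y \<in> P)"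
    then obtain p r p' r' where *: "p \<in> P" "p + r * x \<in> M" "p' \<in> P" "p' + r' * y \<in> M"
      using meet by metis
    have "(p + r * x) * (p' + r' * y) = ((p' + r' * y) * p + (r * x) * p') + (r * r') * (x * y)"
      by (simp add: algebra_simps)
    also have "\<dots> \<in> P" by (intro idP(2,3) * xy)
    finally show False using M(2)[OF *(2,4)] IP(2) by blast
  qed
  moreover have "1 \<notin> P" using IP(2) M(1) by blast
  ultimately have "prime_ideal P" using idP unfolding prime_ideal_def by simp
  with IP show ?thesis by blast
qed

text \<open>Applied to the function rings of a dominant morphism, this says that a general point of the
  target, together with any tangent vector at it, lifts to the source: it combines Chevalley's
  theorem with generic smoothness.\<close>

theorem dual_point_extension:
  fixes A I :: "'r::comm_ring_1 set"
  assumes A: "unital_subring A" and B: "finite B"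
    and I: "0 \<in> I" "\<And>x y. x \<in> I \<Longrightarrow> y \<in> I \<Longrightarrow> x + y \<in> I" "\<And>r x. x \<in> I \<Longrightarrow> r * x \<in> I"
    and prime: "1 \<notin> I" "\<And>x y. x \<in> A \<Longrightarrow> y \<in> A \<Longrightarrow> x * y \<in> I \<Longrightarrow> x \<in> I \<or> y \<in> I"
    and char: "\<And>n. n > 0 \<Longrightarrow> \<exists>y::'r. y * of_nat n = 1"
  shows "\<exists>a\<in>A. a \<notin> I \<and> (\<forall>\<phi> \<delta>::'r \<Rightarrow> 'k::{alg_closed_field, field_char_0}.
    dual_point A I \<phi> \<delta> \<longrightarrow> \<phi> a \<noteq> 0 \<longrightarrow>
    (\<exists>S \<phi>' \<delta>'. unital_subring S \<and> A \<union> B \<subseteq> S \<and> dual_point S I \<phi>' \<delta>' \<and>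
       (\<forall>x\<in>A. \<phi>' x = \<phi> x \<and> \<delta>' x = \<delta> x)))"
proof -
  obtain bs where bs: "set bs = B" using finite_list[OF B] by blast
  \<comment> \<open>\<open>P\<close> and \<open>I\<close> have the same intersection with
    \<open>A\<close>, so dual points on \<open>A\<close> are the same for both; upstairs, vanishing
    on \<open>P\<close> implies vanishing on \<open>I\<close>.\<close>
  obtain P where P: "prime_ideal P" "I \<subseteq> P" "P \<inter> (A - I) = {}"
  proof -
    have "1 \<in> A - I" "I \<inter> (A - I) = {}" using prime(1) unital_subringD(2)[OF A] by auto
    moreover have "x * y \<in> A - I" if "x \<in> A - I" "y \<in> A - I" for x y
      using that prime(2) unital_subringD(6)[OF A] by blast
    ultimately show ?thesis using exists_prime_ideal[OF I, of "A - I"] that by metis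
  qed
  have charP: "of_nat n \<notin> P" if n: "n > 0" for n
    using char[OF n] prime_idealD(2,4)[OF P(1)] by metis
  have S: "unital_subring (foldl adjoin A bs)" "A \<union> B \<subseteq> foldl adjoin A bs"
    using foldl_adjoin[OF A, of bs] bs by auto
  obtain a where a: "a \<in> A" "a \<notin> P" and
    ext: "\<And>\<phi> \<delta> :: 'r \<Rightarrow> 'k. dual_point A P \<phi> \<delta> \<Longrightarrow> \<phi> a \<noteq> 0 \<Longrightarrow>
      \<exists>\<phi>' \<delta>'. dual_point (foldl adjoin A bs) P \<phi>' \<delta>' \<and> (\<forall>x\<in>A. \<phi>' x = \<phi> x \<and> \<delta>' x = \<delta> x)"
    using dual_point_extension_finite[OF A P(1) charP unital_subringD(2)[OF S(1)]
      prime_idealD(2)[OF P(1)], where 'k='k] by blast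
  show ?thesis
  proof (intro bexI[of _ a] conjI allI impI)
    show "a \<in> A" "a \<notin> I" using a P(2) by auto
    fix \<phi> \<delta> :: "'r \<Rightarrow> 'k" assume pt: "dual_point A I \<phi> \<delta>" and nz: "\<phi> a \<noteq> 0"
    have "A \<inter> P = A \<inter> I" using P by blast
    with pt have "dual_point A P \<phi> \<delta>" unfolding dual_point_def by simp
    from ext[OF this nz] obtain \<phi>' \<delta>' where *: "dual_point (foldl adjoin A bs) P \<phi>' \<delta>'"
      "\<forall>x\<in>A. \<phi>' x = \<phi> x \<and> \<delta>' x = \<delta> x" by blast
    have "dual_point (foldl adjoin A bs) I \<phi>' \<delta>'"
      using *(1) P(2) unfolding dual_point_def by blast
    with * S show "\<exists>S \<phi>' \<delta>'. unital_subring S \<and> A \<union> B \<subseteq> S \<and> dual_point S I \<phi>' \<delta>' \<and>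
       (\<forall>x\<in>A. \<phi>' x = \<phi> x \<and> \<delta>' x = \<delta> x)" by blast
  qed
qed

section \<open>Alternating sums and top degree forms\<close>

lemma sign_compose_permutes:
  assumes "\<sigma> permutes S" "\<tau> permutes T" "finite S" "finite T"
  shows "sign (\<sigma> \<circ> \<tau>) = sign \<sigma> * sign \<tau>"
  using assms by (intro sign_compose) (auto simp: permutation_permutes)

lemma sum_permutes_compose_left:
  assumes \<tau>: "\<tau> permutes S"
  shows "sum f {\<sigma>. \<sigma> permutes S} = (\<Sum>\<sigma> | \<sigma> permutes S. f (\<tau> \<circ> \<sigma>))"
  by (rule sum.reindex_bij_witness[where i = "\<lambda>\<sigma>. \<tau> \<circ> \<sigma>" and j = "\<lambda>\<sigma>. inv_into UNIV \<tau> \<circ> \<sigma>"])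
    (use \<tau> in \<open>auto simp: o_assoc permutes_inv_o intro: permutes_compose permutes_inv\<close>)

lemma sum_permutes_compose_right:
  assumes \<tau>: "\<tau> permutes S"
  shows "sum f {\<sigma>. \<sigma> permutes S} = (\<Sum>\<sigma> | \<sigma> permutes S. f (\<sigma> \<circ> \<tau>))"
  by (rule sum.reindex_bij_witness[where i = "\<lambda>\<sigma>. \<sigma> \<circ> \<tau>" and j = "\<lambda>\<sigma>. \<sigma> \<circ> inv_into UNIV \<tau>"])
    (use \<tau> in \<open>auto simp: comp_assoc permutes_inv_o intro: permutes_compose permutes_inv\<close>)

definition alt_sum :: "nat \<Rightarrow> ((nat \<Rightarrow> 'v) \<Rightarrow> 'k) \<Rightarrow> (nat \<Rightarrow> 'v) \<Rightarrow> 'k::field_char_0" where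
  "alt_sum N F v = (\<Sum>\<sigma> | \<sigma> permutes {..<N}. of_int (sign \<sigma>) * F (v \<circ> \<sigma>))"

lemma alt_sum_permute:
  assumes \<tau>: "\<tau> permutes {..<N}"
  shows "alt_sum N F (v \<circ> \<tau>) = of_int (sign \<tau>) * alt_sum N F v"
proof -
  have "alt_sum N F v =
      (\<Sum>\<sigma> | \<sigma> permutes {..<N}. of_int (sign (\<tau> \<circ> \<sigma>)) * F (v \<circ> (\<tau> \<circ> \<sigma>)))"
    unfolding alt_sum_def by (rule sum_permutes_compose_left[OF \<tau>])
  also have "\<dots> = (\<Sum>\<sigma> | \<sigma> permutes {..<N}. of_int (sign \<tau>) * (of_int (sign \<sigma>) * F (v \<circ> \<tau> \<circ> \<sigma>)))"
    using \<tau> by (intro sum.cong) (auto simp: sign_compose_permutes comp_assoc)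
  also have "\<dots> = of_int (sign \<tau>) * alt_sum N F (v \<circ> \<tau>)"
    unfolding alt_sum_def by (simp add: sum_distrib_left)
  finally have "alt_sum N F v = of_int (sign \<tau>) * alt_sum N F (v \<circ> \<tau>)" .
  then show ?thesis by (simp add: sign_def)
qed

text \<open>Each permutation \<open>\<tau>\<close> of the first \<open>k\<close> slots can be
  absorbed into the permutation of all slots, so the double sum is \<open>fact k\<close> copies of a
  single one. This cancels the \<open>fact k\<close> in the definition of the wedge product, and
  iterated products collapse to one alternating sum.\<close>

lemma wedge_alt_sum:
  fixes F :: "(nat \<Rightarrow> 'v) \<Rightarrow> 'k::field_char_0"
  assumes \<omega>: "\<And>v. \<omega> v = c * alt_sum k F v"
  shows "wedge k l \<omega> \<eta> v = c / fact l * alt_sum (k + l) (\<lambda>w. F w * \<eta> (\<lambda>i. w (k + i))) v"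
proof -
  let ?G = "\<lambda>w. F w * \<eta> (\<lambda>i. w (k + i))"
  let ?P = "{\<sigma>. \<sigma> permutes {..<k + l}}" and ?R = "{\<tau>. \<tau> permutes {..<k}}"
  have R: "\<tau> permutes {..<k + l}" if "\<tau> \<in> ?R" for \<tau>
    using that by (auto intro: permutes_subset)
  have "(\<Sum>\<sigma>\<in>?P. of_int (sign \<sigma>) * \<omega> (\<lambda>i. v (\<sigma> i)) * \<eta> (\<lambda>i. v (\<sigma> (k + i)))) =
      (\<Sum>\<sigma>\<in>?P. \<Sum>\<tau>\<in>?R. c * (of_int (sign (\<sigma> \<circ> \<tau>)) * ?G (v \<circ> (\<sigma> \<circ> \<tau>))))"
  proof (intro sum.cong refl)
    fix \<sigma> assume \<sigma>: "\<sigma> \<in> ?P"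
    have "of_int (sign \<sigma>) * (of_int (sign \<tau>) * F ((\<lambda>i. v (\<sigma> i)) \<circ> \<tau>)) * \<eta> (\<lambda>i. v (\<sigma> (k + i))) =
        of_int (sign (\<sigma> \<circ> \<tau>)) * ?G (v \<circ> (\<sigma> \<circ> \<tau>))" if \<tau>: "\<tau> \<in> ?R" for \<tau>
    proof -
      have "\<tau> (k + i) = k + i" for i using \<tau> by (auto simp: permutes_def)
      moreover have "sign (\<sigma> \<circ> \<tau>) = sign \<sigma> * sign \<tau>"
        using \<sigma> \<tau> by (intro sign_compose_permutes) auto
      ultimately show ?thesis by (simp add: comp_def)
    qed
    then show "of_int (sign \<sigma>) * \<omega> (\<lambda>i. v (\<sigma> i)) * \<eta> (\<lambda>i. v (\<sigma> (k + i))) =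
        (\<Sum>\<tau>\<in>?R. c * (of_int (sign (\<sigma> \<circ> \<tau>)) * ?G (v \<circ> (\<sigma> \<circ> \<tau>))))"
      unfolding \<omega> alt_sum_def
      by (simp add: sum_distrib_left sum_distrib_right mult.left_commute mult.assoc)
  qed
  also have "\<dots> = (\<Sum>\<tau>\<in>?R. \<Sum>\<sigma>\<in>?P. c * (of_int (sign (\<sigma> \<circ> \<tau>)) * ?G (v \<circ> (\<sigma> \<circ> \<tau>))))"
    by (rule sum.swap)
  also have "\<dots> = (\<Sum>\<tau>\<in>?R. c * alt_sum (k + l) ?G v)"
  proof (intro sum.cong refl)
    fix \<tau> assume "\<tau> \<in> ?R"
    from sum_permutes_compose_right[OF R[OF this],
        of "\<lambda>\<sigma>. c * (of_int (sign \<sigma>) * ?G (v \<circ> \<sigma>))"]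
    show "(\<Sum>\<sigma>\<in>?P. c * (of_int (sign (\<sigma> \<circ> \<tau>)) * ?G (v \<circ> (\<sigma> \<circ> \<tau>)))) = c * alt_sum (k + l) ?G v"
      unfolding alt_sum_def by (simp add: sum_distrib_left)
  qed
  also have "\<dots> = fact k * (c * alt_sum (k + l) ?G v)"
    by (simp add: card_permutations[where n = k])
  finally show ?thesis unfolding wedge_def by simp
qed

lemma wedge_power_alt_sum:
  fixes \<omega> :: "(nat \<Rightarrow> 'v) \<Rightarrow> 'k::field_char_0"
  shows "wedge_power 2 \<omega> n v =
    (1 / 2) ^ n * alt_sum (2 * n) (\<lambda>w. \<Prod>i<n. \<omega> (\<lambda>j. w (2 * i + j))) v"
proof (induction n arbitrary: v)
  case 0
  show ?case by (simp add: alt_sum_def)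
next
  case (Suc n)
  show ?case
    unfolding wedge_power.simps wedge_alt_sum[OF Suc.IH] by (simp add: fact_numeral mult.commute)
qed

text \<open>The Gram matrix of the standard symplectic form with hyperbolic pairs
  \<open>(2i, 2i + 1)\<close>: \<open>1\<close> in this order, \<open>- 1\<close> in the reverse
  order, \<open>0\<close> otherwise.\<close>

definition pair_sign :: "nat \<Rightarrow> nat \<Rightarrow> int" where
  "pair_sign k l = (if k div 2 = l div 2 then int (l mod 2) - int (k mod 2) else 0)"

definition partner :: "nat \<Rightarrow> nat" where
  "partner k = (if even k then k + 1 else k - 1)"

lemma partner: "partner (partner k) = k" "even (partner k) \<longleftrightarrow> odd k" "k < 2 * n \<Longrightarrow> partner k < 2 * n"
  by (auto simp: partner_def elim!: oddE evenE)

lemma pair_sign_partner: "pair_sign (partner l) l = (if even l then - 1 else 1)"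
proof (cases "even l")
  case True
  then show ?thesis by (auto simp: pair_sign_def partner_def elim!: evenE)
next
  case False
  then obtain m where "l = 2 * m + 1" by (rule oddE)
  then show ?thesis by (simp add: pair_sign_def partner_def)
qed

lemma pair_sign_eq_0:
  assumes "k \<noteq> partner l"
  shows "pair_sign k l = 0"
proof (cases "k div 2 = l div 2 \<and> k \<noteq> l")
  case True
  then have "k = partner l" unfolding partner_def by presburger
  with assms show ?thesis by simp
qed (auto simp: pair_sign_def)

text \<open>The nonzero terms of the Pfaffian of the standard symplectic form all equal \<open>1\<close>: such a
  permutation preserves the set of pairs, and moving a pair into the last place is an even
  permutation.\<close>

lemma sign_mult_pair_sign:
  assumes "\<sigma> permutes {..<2 * n}"
  shows "sign \<sigma> * (\<Prod>i<n. pair_sign (\<sigma> (2 * i)) (\<sigma> (2 * i + 1))) \<in> {0, 1}"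
  using assms
proof (induction n arbitrary: \<sigma>)
  case 0
  then show ?case by simp
next
  case (Suc n)
  let ?p = "\<lambda>\<sigma> i. pair_sign (\<sigma> (2 * i)) (\<sigma> (2 * i + 1))"
  show ?case
  proof (cases "?p \<sigma> n = 0")
    case True
    then show ?thesis by simp
  next
    case False
    \<comment> \<open>A nonzero last factor means that both members of the last pair are sent to one
      pair, the \<open>j\<close>-th.\<close>
    define j where "j = \<sigma> (2 * n) div 2"
    have j: "\<sigma> (2 * n + 1) div 2 = j" using False by (auto simp: pair_sign_def j_def split: if_splits)
    have "\<sigma> (2 * n) < 2 * Suc n" using permutes_in_image[OF Suc.prems, of "2 * n"] by simp
    then have "j \<le> n" unfolding j_def by auto
    define \<rho> where "\<rho> = Transposition.transpose j n"
    \<comment> \<open>Exchanges pair \<open>j\<close> with pair \<open>n\<close> and keeps positions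
      within pairs. As a product of two transpositions it is even, and it leaves every
      \<open>pair_sign\<close> unchanged.\<close>
    define \<tau> where "\<tau> k = 2 * \<rho> (k div 2) + k mod 2" for k
    have \<rho>: "\<rho> j = n" "\<rho> n = j" "\<And>a b. \<rho> a = \<rho> b \<longleftrightarrow> a = b"
      unfolding \<rho>_def by (simp_all add: inj_eq)
    have \<tau>_div: "\<tau> k div 2 = \<rho> (k div 2)" "\<tau> k mod 2 = k mod 2" for k by (auto simp: \<tau>_def)
    have ps: "pair_sign (\<tau> k) (\<tau> l) = pair_sign k l" for k l
      by (simp add: pair_sign_def \<tau>_div \<rho>)
    have \<tau>_eq: "\<tau> = Transposition.transpose (2 * j) (2 * n) \<circ> Transposition.transpose (2 * j + 1) (2 * n + 1)"
    proof
      fix k :: nat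
      have "k = 2 * (k div 2) + k mod 2" "k mod 2 = 0 \<or> k mod 2 = 1" by auto
      then show "\<tau> k = (Transposition.transpose (2 * j) (2 * n) \<circ> Transposition.transpose (2 * j + 1) (2 * n + 1)) k"
        unfolding \<tau>_def \<rho>_def Transposition.transpose_def comp_def by (smt (verit) Suc_eq_plus1 add_cancel_right_right even_Suc even_mult_iff even_numeral mult_cancel1 add_right_cancel numeral_eq_Suc zero_neq_numeral dvd_triv_left odd_two_times_div_two_succ)
    qed
    have \<tau>: "\<tau> permutes {..<2 * Suc n}"
      unfolding \<tau>_eq using \<open>j \<le> n\<close> by (intro permutes_compose permutes_swap_id) auto
    have sign_\<tau>: "sign \<tau> = 1"
      unfolding \<tau>_eq by (simp add: sign_compose permutation_swap_id sign_swap_id)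
    define \<sigma>1 where "\<sigma>1 = \<tau> \<circ> \<sigma>"
    have \<sigma>1: "\<sigma>1 permutes {..<2 * Suc n}" unfolding \<sigma>1_def by (rule permutes_compose[OF Suc.prems \<tau>])
    have sign1: "sign \<sigma>1 = sign \<sigma>"
      unfolding \<sigma>1_def using sign_\<tau> \<tau> Suc.prems
      by (subst sign_compose_permutes) auto
    have p1: "?p \<sigma>1 i = ?p \<sigma> i" for i by (simp add: \<sigma>1_def ps)
    have eq1: "sign \<sigma> * (\<Prod>i<Suc n. ?p \<sigma> i) = sign \<sigma>1 * ((\<Prod>i<n. ?p \<sigma>1 i) * ?p \<sigma>1 n)"
      unfolding sign1 p1 prod.lessThan_Suc ..
    have div1: "\<sigma>1 (2 * n) div 2 = n" "\<sigma>1 (2 * n + 1) div 2 = n"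
      using j by (simp_all add: \<sigma>1_def \<tau>_div \<rho> j_def[symmetric])
    have inj1: "\<sigma>1 a = \<sigma>1 b \<longleftrightarrow> a = b" for a b using permutes_inj[OF \<sigma>1] by (auto dest: injD)
    have perm_low: "\<pi> permutes {..<2 * n}"
      if "\<pi> permutes {..<2 * Suc n}" "\<pi> (2 * n) = 2 * n" "\<pi> (2 * n + 1) = 2 * n + 1" for \<pi>
    proof (rule permutes_superset[OF that(1)])
      fix x assume "x \<in> {..<2 * Suc n} - {..<2 * n}"
      then have "x = 2 * n \<or> x = 2 * n + 1" by auto
      then show "\<pi> x = x" using that(2,3) by auto
    qed
    have cases: "\<sigma>1 (2 * n) = 2 * n \<and> \<sigma>1 (2 * n + 1) = 2 * n + 1 \<or>
        \<sigma>1 (2 * n) = 2 * n + 1 \<and> \<sigma>1 (2 * n + 1) = 2 * n"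
    proof -
      have "\<sigma>1 (2 * n) \<noteq> \<sigma>1 (2 * n + 1)" by (simp add: inj1)
      then show ?thesis using div1 by arith
    qed
    then show ?thesis
    proof
      assume fix1: "\<sigma>1 (2 * n) = 2 * n \<and> \<sigma>1 (2 * n + 1) = 2 * n + 1"
      then have "?p \<sigma>1 n = 1" by (simp add: pair_sign_def)
      moreover have "\<sigma>1 permutes {..<2 * n}" using perm_low[OF \<sigma>1] fix1 by blast
      ultimately show ?thesis using Suc.IH unfolding eq1 by (simp only: mult_1_right)
    next
      assume flip: "\<sigma>1 (2 * n) = 2 * n + 1 \<and> \<sigma>1 (2 * n + 1) = 2 * n"
      \<comment> \<open>The last pair is preserved but reversed. Undoing the reversal changes the
        sign of the permutation, which compensates the last factor \<open>- 1\<close>.\<close>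
      define f where "f = Transposition.transpose (2 * n) (2 * n + 1)"
      define \<sigma>2 where "\<sigma>2 = f \<circ> \<sigma>1"
      have f: "f permutes {..<2 * Suc n}" unfolding f_def by (rule permutes_swap_id) auto
      have \<sigma>2: "\<sigma>2 permutes {..<2 * Suc n}" unfolding \<sigma>2_def by (rule permutes_compose[OF \<sigma>1 f])
      have low: "\<sigma>2 permutes {..<2 * n}" by (rule perm_low[OF \<sigma>2]) (use flip in \<open>auto simp: \<sigma>2_def f_def\<close>)
      have sign2: "sign \<sigma>2 = - sign \<sigma>1"
        unfolding \<sigma>2_def using f \<sigma>1
        by (subst sign_compose_permutes) (auto simp: f_def sign_swap_id)
      have "\<sigma>2 k = \<sigma>1 k" if "k < 2 * n" for k
      proof -
        have "\<sigma>1 k \<noteq> 2 * n" "\<sigma>1 k \<noteq> 2 * n + 1"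
          using that inj1[of k "2 * n"] inj1[of k "2 * n + 1"] flip by auto
        then show ?thesis by (simp add: \<sigma>2_def f_def Transposition.transpose_def)
      qed
      then have "(\<Prod>i<n. ?p \<sigma>2 i) = (\<Prod>i<n. ?p \<sigma>1 i)" by (intro prod.cong) auto
      moreover have "?p \<sigma>1 n = - 1" using flip by (simp add: pair_sign_def)
      ultimately show ?thesis
        using Suc.IH[OF low] unfolding eq1 sign2 by simp
    qed
  qed
qed

section \<open>Independence and span of indexed families\<close>

context vector_space
begin

lemma independent_family:
  fixes v :: "nat \<Rightarrow> 'b"
  assumes "\<And>c j. (\<Sum>i<N. scale (c i) (v i)) = 0 \<Longrightarrow> j < N \<Longrightarrow> c j = 0"
  shows "inj_on v {..<N} \<and> independent (v ` {..<N})"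
proof -
  have inj: "inj_on v {..<N}"
  proof (rule inj_onI, rule ccontr)
    fix k l assume *: "k \<in> {..<N}" "l \<in> {..<N}" "v k = v l" "k \<noteq> l"
    define c where "c i = (if i = k then 1 else if i = l then - 1 else 0 :: 'a)" for i
    have "(\<Sum>i<N. scale (c i) (v i)) = (\<Sum>i\<in>{k, l}. scale (c i) (v i))"
      using * by (intro sum.mono_neutral_right) (auto simp: c_def)
    also have "\<dots> = 0" using * by (simp add: c_def)
    finally have "c k = 0" by (rule assms) (use * in auto)
    then show False by (simp add: c_def)
  qed
  have "independent (v ` {..<N})"
  proof (rule independent_if_scalars_zero)
    fix f x assume *: "(\<Sum>x\<in>v ` {..<N}. scale (f x) x) = 0" "x \<in> v ` {..<N}"
    then have "(\<Sum>i<N. scale (f (v i)) (v i)) = 0" by (simp add: sum.reindex[OF inj])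
    from assms[OF this] *(2) show "f x = 0" by auto
  qed simp
  with inj show ?thesis by blast
qed

lemma span_family:
  fixes v :: "nat \<Rightarrow> 'b"
  assumes "x \<in> span (v ` {..<N})"
  obtains c where "x = (\<Sum>i<N. scale (c i) (v i))"
proof -
  define X where "X = {(\<Sum>i<N. scale (c i) (v i)) |c. True}"
  have "span (v ` {..<N}) \<subseteq> X"
  proof (rule span_minimal)
    show "v ` {..<N} \<subseteq> X"
    proof
      fix y assume "y \<in> v ` {..<N}"
      then obtain k where k: "k < N" "y = v k" by auto
      have "(\<Sum>i<N. scale (if i = k then 1 else 0) (v i)) = (\<Sum>i<N. if i = k then v i else 0)"
        by (intro sum.cong) auto
      also have "\<dots> = y" using k by simp
      finally show "y \<in> X"
        unfolding X_def by (intro CollectI exI[of _ "\<lambda>i. if i = k then 1 else 0"]) simp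
    qed
    show "subspace X"
    proof (rule subspaceI)
      have "(\<Sum>i<N. scale 0 (v i)) = 0" by simp
      then show "0 \<in> X" unfolding X_def by (intro CollectI exI[of _ "\<lambda>_. 0"]) simp
    next
      fix a b assume "a \<in> X" "b \<in> X"
      then obtain c d where "a = (\<Sum>i<N. scale (c i) (v i))" "b = (\<Sum>i<N. scale (d i) (v i))"
        unfolding X_def by blast
      then have "a + b = (\<Sum>i<N. scale (c i + d i) (v i))"
        by (simp add: scale_left_distrib sum.distrib)
      then show "a + b \<in> X" unfolding X_def by (intro CollectI exI[of _ "\<lambda>i. c i + d i"]) simp
    next
      fix r a assume "a \<in> X"
      then obtain c where "a = (\<Sum>i<N. scale (c i) (v i))" unfolding X_def by blast
      then have "scale r a = (\<Sum>i<N. scale (r * c i) (v i))" by (simp add: scale_sum_right)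
      then show "scale r a \<in> X" unfolding X_def by (intro CollectI exI[of _ "\<lambda>i. r * c i"]) simp
    qed
  qed
  with assms that show ?thesis unfolding X_def by blast
qed

end

text \<open>A pair of a \<open>2\<close>-form \<open>B\<close> and a linear form \<open>\<alpha>\<close>. Up to a nonzero factor \<open>top_form n\<close> is
  \<open>B\<^sup>n \<and> \<alpha>\<close>.\<close>

locale form_pair = vector_space scale
  for scale :: "'k::field_char_0 \<Rightarrow> 'v::ab_group_add \<Rightarrow> 'v" +
  fixes L :: "'v set" and B :: "'v \<Rightarrow> 'v \<Rightarrow> 'k" and \<alpha> :: "'v \<Rightarrow> 'k"
  assumes subspace_L: "subspace L"
    and B_add_left: "x \<in> L \<Longrightarrow> y \<in> L \<Longrightarrow> z \<in> L \<Longrightarrow> B (x + y) z = B x z + B y z"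
    and B_scale_left: "x \<in> L \<Longrightarrow> z \<in> L \<Longrightarrow> B (scale c x) z = c * B x z"
    and B_self: "x \<in> L \<Longrightarrow> B x x = 0"
    and B_skew: "x \<in> L \<Longrightarrow> y \<in> L \<Longrightarrow> B x y = - B y x"
    and \<alpha>_add: "x \<in> L \<Longrightarrow> y \<in> L \<Longrightarrow> \<alpha> (x + y) = \<alpha> x + \<alpha> y"
    and \<alpha>_scale: "x \<in> L \<Longrightarrow> \<alpha> (scale c x) = c * \<alpha> x"
begin

definition top_term :: "nat \<Rightarrow> (nat \<Rightarrow> 'v) \<Rightarrow> 'k" where
  "top_term n w = (\<Prod>i<n. B (w (2 * i)) (w (2 * i + 1))) * \<alpha> (w (2 * n))"

definition top_form :: "nat \<Rightarrow> (nat \<Rightarrow> 'v) \<Rightarrow> 'k" where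
  "top_form n = alt_sum (2 * n + 1) (top_term n)"

lemmas L_closed = subspace_add[OF subspace_L] subspace_scale[OF subspace_L]
  subspace_0[OF subspace_L] subspace_diff[OF subspace_L] subspace_sum[OF subspace_L]

lemma B_zero: "z \<in> L \<Longrightarrow> B 0 z = 0" "z \<in> L \<Longrightarrow> B z 0 = 0"
  using B_scale_left[of z z 0] B_scale_left[of 0 z 0] B_skew[of z 0] L_closed(3) by auto

lemma \<alpha>_zero: "\<alpha> 0 = 0"
  using \<alpha>_scale[of 0 0] L_closed(3) by simp

lemma B_add_right: "x \<in> L \<Longrightarrow> y \<in> L \<Longrightarrow> z \<in> L \<Longrightarrow> B z (x + y) = B z x + B z y"
  using B_skew B_add_left L_closed(1) by (metis minus_add_distrib)

lemma B_scale_right: "x \<in> L \<Longrightarrow> z \<in> L \<Longrightarrow> B z (scale c x) = c * B z x"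
  using B_skew B_scale_left L_closed(2) by (metis mult_minus_right)

lemma B_diff_left: "x \<in> L \<Longrightarrow> y \<in> L \<Longrightarrow> z \<in> L \<Longrightarrow> B (x - y) z = B x z - B y z"
  using B_add_left[of "x - y" y z] L_closed(4) by (simp add: eq_diff_eq)

lemma B_diff_right: "x \<in> L \<Longrightarrow> y \<in> L \<Longrightarrow> z \<in> L \<Longrightarrow> B z (x - y) = B z x - B z y"
  using B_add_right[of "x - y" y z] L_closed(4) by (simp add: eq_diff_eq)

lemma \<alpha>_diff: "x \<in> L \<Longrightarrow> y \<in> L \<Longrightarrow> \<alpha> (x - y) = \<alpha> x - \<alpha> y"
  using \<alpha>_add[of "x - y" y] L_closed(4) by (simp add: eq_diff_eq)

lemma \<alpha>_sum: "(\<And>i. i \<in> J \<Longrightarrow> f i \<in> L) \<Longrightarrow> \<alpha> (sum f J) = (\<Sum>i\<in>J. \<alpha> (f i))"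
  by (induction J rule: infinite_finite_induct) (auto simp: \<alpha>_zero \<alpha>_add L_closed)

lemma B_sum_left: "(\<And>i. i \<in> J \<Longrightarrow> f i \<in> L) \<Longrightarrow> z \<in> L \<Longrightarrow> B (sum f J) z = (\<Sum>i\<in>J. B (f i) z)"
  by (induction J rule: infinite_finite_induct) (auto simp: B_zero B_add_left L_closed)

text \<open>With the other arguments frozen, a term is a scalar multiple of a single linear form in
  the chosen slot: \<open>\<alpha>\<close> in the last one, elsewhere \<open>B\<close> against the
  other member of the pair. Multilinearity of the top form, and its vanishing on common kernel
  vectors, both reduce to this.\<close>

lemma top_term_slot:
  assumes "k < 2 * n + 1" "range w \<subseteq> L"
  obtains C where "\<And>x. top_term n (w(k := x)) =
    C * (if k = 2 * n then \<alpha> x else if even k then B x (w (k + 1)) else B (w (k - 1)) x)"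
proof (cases "k = 2 * n")
  case True
  have "(\<Prod>i<n. B ((w(k := x)) (2 * i)) ((w(k := x)) (2 * i + 1))) =
      (\<Prod>i<n. B (w (2 * i)) (w (2 * i + 1)))" for x
    using True by (intro prod.cong) auto
  then show ?thesis using that[of "\<Prod>i<n. B (w (2 * i)) (w (2 * i + 1))"] True
    unfolding top_term_def by simp
next
  case False
  define i0 where "i0 = k div 2"
  have i0: "i0 < n" and k: "k = 2 * i0 \<or> k = 2 * i0 + 1" using assms(1) False by (auto simp: i0_def)
  have key: "top_term n (w(k := x)) =
      ((\<Prod>i\<in>{..<n} - {i0}. B (w (2 * i)) (w (2 * i + 1))) * \<alpha> (w (2 * n))) *
      (if even k then B x (w (k + 1)) else B (w (k - 1)) x)" for x
  proof -
    have "(\<Prod>i\<in>{..<n} - {i0}. B ((w(k := x)) (2 * i)) ((w(k := x)) (2 * i + 1))) =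
        (\<Prod>i\<in>{..<n} - {i0}. B (w (2 * i)) (w (2 * i + 1)))"
    proof (rule prod.cong[OF refl])
      fix i assume "i \<in> {..<n} - {i0}"
      then have "2 * i \<noteq> k" "2 * i + 1 \<noteq> k" using k by auto
      then show "B ((w(k := x)) (2 * i)) ((w(k := x)) (2 * i + 1)) = B (w (2 * i)) (w (2 * i + 1))"
        by simp
    qed
    moreover have "B ((w(k := x)) (2 * i0)) ((w(k := x)) (2 * i0 + 1)) =
        (if even k then B x (w (k + 1)) else B (w (k - 1)) x)" using k by auto
    ultimately show ?thesis
      unfolding top_term_def using i0 False by (simp add: prod.remove[of _ i0] mult_ac)
  qed
  show ?thesis
  proof (rule that)
    fix x show "top_term n (w(k := x)) =
        ((\<Prod>i\<in>{..<n} - {i0}. B (w (2 * i)) (w (2 * i + 1))) * \<alpha> (w (2 * n))) *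
        (if k = 2 * n then \<alpha> x else if even k then B x (w (k + 1)) else B (w (k - 1)) x)"
      unfolding key using False by simp
  qed
qed

lemma upd_comp_perm:
  assumes "\<sigma> permutes {..<N::nat}"
  shows "(v(j := x)) \<circ> \<sigma> = (v \<circ> \<sigma>)(inv_into UNIV \<sigma> j := x)"
  using permutes_inverses[OF assms] by (auto simp: fun_eq_iff)

lemma top_term_slot':
  assumes "j < 2 * n + 1" "range v \<subseteq> L" "\<sigma> permutes {..<2 * n + 1}"
  obtains C k where "\<And>x. top_term n (v(j := x) \<circ> \<sigma>) = C *
    (if k = 2 * n then \<alpha> x else if even k then B x (v (\<sigma> (k + 1))) else B (v (\<sigma> (k - 1))) x)"
proof -
  let ?k = "inv_into UNIV \<sigma> j"
  have "?k < 2 * n + 1"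
    using permutes_in_image[OF permutes_inv[OF assms(3)], of j] assms(1) by simp
  moreover have "range (v \<circ> \<sigma>) \<subseteq> L" using assms(2) by auto
  ultimately show ?thesis
    using top_term_slot[of ?k n "v \<circ> \<sigma>"] that upd_comp_perm[OF assms(3)] by (metis comp_apply)
qed

lemma top_form_slot_linear:
  assumes j: "j < 2 * n + 1" and v: "range v \<subseteq> L" and x: "x \<in> L" and y: "y \<in> L"
  shows "top_form n (v(j := x + y)) = top_form n (v(j := x)) + top_form n (v(j := y))"
    and "top_form n (v(j := scale c x)) = c * top_form n (v(j := x))"
proof -
  have vL: "v i \<in> L" for i using v by auto
  have "top_term n (v(j := x + y) \<circ> \<sigma>) = top_term n (v(j := x) \<circ> \<sigma>) + top_term n (v(j := y) \<circ> \<sigma>) \<and>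
      top_term n (v(j := scale c x) \<circ> \<sigma>) = c * top_term n (v(j := x) \<circ> \<sigma>)"
    if \<sigma>: "\<sigma> permutes {..<2 * n + 1}" for \<sigma>
    by (rule top_term_slot'[OF j v \<sigma>])
      (simp add: x y vL \<alpha>_add \<alpha>_scale B_add_left B_add_right B_scale_left B_scale_right algebra_simps)
  then show "top_form n (v(j := x + y)) = top_form n (v(j := x)) + top_form n (v(j := y))"
    "top_form n (v(j := scale c x)) = c * top_form n (v(j := x))"
    unfolding top_form_def alt_sum_def
    by (simp_all add: sum.distrib[symmetric] sum_distrib_left algebra_simps)
qed

text \<open>Cramer's rule: in the multilinear expansion every term with a repeated vector equals its
  own negative, and only the \<open>j\<close>-th one is left.\<close>

lemma top_form_combination:
  assumes j: "j < 2 * n + 1" and v: "range v \<subseteq> L"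
  shows "top_form n (v(j := (\<Sum>i<2 * n + 1. scale (c i) (v i)))) = c j * top_form n v"
proof -
  have vL: "v i \<in> L" for i using v by auto
  have repeat: "top_form n (v(j := v i)) = 0" if "i < 2 * n + 1" "i \<noteq> j" for i
  proof -
    define \<tau> where "\<tau> = Transposition.transpose i j"
    have \<tau>: "\<tau> permutes {..<2 * n + 1}" unfolding \<tau>_def using that j by (intro permutes_swap_id) auto
    have "v(j := v i) \<circ> \<tau> = v(j := v i)"
      by (auto simp: \<tau>_def Transposition.transpose_def fun_eq_iff)
    then show ?thesis
      using alt_sum_permute[OF \<tau>, of "top_term n" "v(j := v i)"] that(2)
      by (simp add: top_form_def \<tau>_def sign_swap_id)
  qed
  have zero: "top_form n (v(j := 0)) = 0"
    by (rule top_form_slot_linear(2)[OF j v vL[of j] vL[of j], where c = 0,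
        unfolded scale_zero_left mult_zero_left])
  have "top_form n (v(j := (\<Sum>i\<in>J. scale (c i) (v i)))) = (\<Sum>i\<in>J. c i * top_form n (v(j := v i)))"
    if "finite J" for J
    using that
  proof induction
    case (insert k J)
    have "(\<Sum>i\<in>J. scale (c i) (v i)) \<in> L" by (intro L_closed vL)
    then show ?case
      by (simp only: sum.insert[OF insert.hyps] insert.IH
          top_form_slot_linear(1)[OF j v L_closed(2)[OF vL[of k]]]
          top_form_slot_linear(2)[OF j v vL[of k] vL[of k]])
  qed (simp only: sum.empty zero)
  then have "top_form n (v(j := (\<Sum>i<2 * n + 1. scale (c i) (v i)))) =
      (\<Sum>i<2 * n + 1. c i * top_form n (v(j := v i)))" by blast
  also have "\<dots> = (\<Sum>i\<in>{j}. c i * top_form n (v(j := v i)))"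
    using j repeat by (intro sum.mono_neutral_right) auto
  finally show ?thesis by simp
qed

text \<open>By Cramer's rule the \<open>v i\<close> are independent, hence span \<open>L\<close> for
  reasons of dimension. The \<open>j\<close>-th coefficient of \<open>\<xi>\<close> times the top
  form is the top form with \<open>\<xi>\<close> in slot \<open>j\<close>, and this is zero because
  each linear form occurring in a slot kills \<open>\<xi>\<close>.\<close>

lemma common_kernel_trivial:
  assumes nz: "top_form n v \<noteq> 0" and dim: "dim L = 2 * n + 1" and v: "range v \<subseteq> L"
    and \<xi>: "\<xi> \<in> L" "\<And>\<eta>. \<eta> \<in> L \<Longrightarrow> B \<xi> \<eta> = 0" "\<alpha> \<xi> = 0"
  shows "\<xi> = 0"
proof -
  let ?N = "2 * n + 1"
  have vL: "v i \<in> L" for i using v by auto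
  have coeff: "c j = 0" if "(\<Sum>i<?N. scale (c i) (v i)) = 0" "j < ?N" for c j
    using top_form_combination[OF that(2) v, of c] top_form_slot_linear(2)[OF that(2) v vL[of j] vL[of j], where c = 0] nz
    by (simp add: that(1)[simplified])
  have fam: "inj_on v {..<?N} \<and> independent (v ` {..<?N})"
    by (rule independent_family) (rule coeff)
  obtain Bs where Bs: "Bs \<subseteq> L" "L \<subseteq> span Bs" "card Bs = ?N"
    using basis_exists[of L] dim by metis
  then have "finite Bs" using card_gt_0_iff by force
  have "\<xi> \<in> span (v ` {..<?N})"
  proof (rule ccontr)
    assume out: "\<xi> \<notin> span (v ` {..<?N})"
    have "independent (insert \<xi> (v ` {..<?N}))" by (rule independent_insertI[OF out conjunct2[OF fam]])
    moreover have new: "\<xi> \<notin> v ` {..<?N}" using out span_base[of \<xi> "v ` {..<?N}"] by auto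
    moreover have "insert \<xi> (v ` {..<?N}) \<subseteq> span Bs" using \<xi>(1) vL Bs(2) by auto
    ultimately have "card (insert \<xi> (v ` {..<?N})) \<le> ?N"
      using independent_span_bound[OF \<open>finite Bs\<close>] Bs(3) by metis
    then show False using new card_image[of v "{..<?N}"] fam by simp
  qed
  then obtain c where c: "\<xi> = (\<Sum>i<?N. scale (c i) (v i))" by (rule span_family)
  have "c j = 0" if j: "j < ?N" for j
  proof -
    have "top_term n (v(j := \<xi>) \<circ> \<sigma>) = 0" if \<sigma>: "\<sigma> permutes {..<?N}" for \<sigma>
    proof (rule top_term_slot'[OF j v \<sigma>])
      have "B (v i) \<xi> = 0" for i using B_skew[OF vL \<xi>(1)] \<xi>(2)[OF vL] by simp
      then show "top_term n (v(j := \<xi>) \<circ> \<sigma>) = 0"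
        if "\<And>x. top_term n (v(j := x) \<circ> \<sigma>) = C * (if k = 2 * n then \<alpha> x
          else if even k then B x (v (\<sigma> (k + 1))) else B (v (\<sigma> (k - 1))) x)" for C k
        unfolding that using \<xi> vL by simp
    qed
    then have "top_form n (v(j := \<xi>)) = 0" unfolding top_form_def alt_sum_def by simp
    then show ?thesis using top_form_combination[OF j v, of c, folded c] nz by simp
  qed
  then show ?thesis unfolding c by (simp del: lessThan_Suc sum.lessThan_Suc)
qed

text \<open>The symplectic basis of \<open>ker \<alpha>\<close> comes from a maximal family of hyperbolic pairs.\<close>

lemma exists_top_form_nonzero:
  assumes fin: "finite T" "L \<subseteq> span T"
    and \<xi>: "\<xi> \<in> L" "\<And>\<eta>. \<eta> \<in> L \<Longrightarrow> B \<xi> \<eta> = 0" "\<alpha> \<xi> \<noteq> 0"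
    and radical: "\<And>x. x \<in> L \<Longrightarrow> (\<And>\<eta>. \<eta> \<in> L \<Longrightarrow> B x \<eta> = 0) \<Longrightarrow> \<exists>c. x = scale c \<xi>"
  shows "\<exists>n v. dim L = 2 * n + 1 \<and> range v \<subseteq> L \<and> top_form n v \<noteq> 0"
proof -
  \<comment> \<open>The first \<open>2 * n\<close> vectors are \<open>n\<close> mutually orthogonal
    hyperbolic pairs inside the kernel of \<open>\<alpha>\<close>.\<close>
  define symp where "symp n v \<longleftrightarrow> range v \<subseteq> L \<and> (\<forall>k<2 * n. \<alpha> (v k) = 0) \<and>
    (\<forall>k<2 * n. \<forall>l<2 * n. B (v k) (v l) = of_int (pair_sign k l))" for n and v :: "nat \<Rightarrow> 'v"
  have ps: "pair_sign (2 * i) (2 * i + 1) = 1" "pair_sign (2 * i + 1) (2 * i) = - 1" for i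
    by (simp_all add: pair_sign_def)
  have pair_sum: "(\<Sum>i<n. f (2 * i) + f (2 * i + 1)) = (\<Sum>k<2 * n. f k)" for f :: "nat \<Rightarrow> 'c::comm_monoid_add" and n
    by (induction n) (simp_all add: add.assoc)
  have symp_coeff: "c j = 0"
    if "symp n v" and sum: "\<And>l. l < 2 * n \<Longrightarrow> B (\<Sum>k<2 * n. scale (c k) (v k)) (v l) = 0" and j: "j < 2 * n"
    for n v c j
  proof -
    have vL: "v i \<in> L" for i using that(1) by (auto simp: symp_def)
    have B: "B (\<Sum>k<2 * n. scale (c k) (v k)) (v l) = (\<Sum>k<2 * n. c k * of_int (pair_sign k l))"
      if "l < 2 * n" for l
      using \<open>symp n v\<close> that vL
      by (subst B_sum_left) (auto intro!: L_closed sum.cong simp: B_scale_left symp_def)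
    define l where "l = partner j"
    have l: "l < 2 * n" "pair_sign j l \<noteq> 0" "\<And>k. k \<noteq> j \<Longrightarrow> pair_sign k l = 0"
      using partner[of j] j pair_sign_partner[of l] pair_sign_eq_0[of _ l] by (auto simp: l_def)
    have "(\<Sum>k<2 * n. c k * of_int (pair_sign k l)) = (\<Sum>k\<in>{j}. c k * of_int (pair_sign k l))"
      using j l(3) by (intro sum.mono_neutral_right) auto
    then show ?thesis using B[OF l(1)] sum[OF l(1)] l(2) by simp
  qed
  \<comment> \<open>Hyperbolic pairs are independent, so their number is bounded and a maximal
    family exists.\<close>
  have symp_bound: "2 * n \<le> card T" if "symp n v" for n v
  proof -
    have vL: "v i \<in> L" for i using that by (auto simp: symp_def)
    have "inj_on v {..<2 * n} \<and> independent (v ` {..<2 * n})"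
    proof (rule independent_family)
      fix c j assume "(\<Sum>i<2 * n. scale (c i) (v i)) = 0" "j < 2 * n"
      then show "c j = 0" using symp_coeff[OF that, of c] B_zero(1)[OF vL] by simp
    qed
    moreover have "v ` {..<2 * n} \<subseteq> span T" using vL fin by auto
    ultimately show ?thesis using independent_span_bound[OF fin(1)] card_image by (metis card_lessThan)
  qed
  have "symp 0 (\<lambda>_. 0)" by (auto simp: symp_def L_closed)
  then obtain n v where nv: "symp n v" and max: "\<And>m u. symp m u \<Longrightarrow> m \<le> n"
  proof -
    have bdd: "\<forall>m. (\<exists>v. symp m v) \<longrightarrow> m \<le> card T" using symp_bound by fastforce
    have ex: "\<exists>v. symp 0 v" using \<open>symp 0 (\<lambda>_. 0)\<close> by blast
    define n where "n = (GREATEST m. \<exists>v. symp m v)"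
    have "\<exists>v. symp n v" unfolding n_def by (rule GreatestI_nat[of "\<lambda>m. \<exists>v. symp m v", OF ex]) (use bdd in auto)
    moreover have "m \<le> n" if "symp m u" for m u
      unfolding n_def by (rule Greatest_le_nat[of "\<lambda>m. \<exists>v. symp m v" m "card T"]) (use bdd that in auto)
    ultimately show ?thesis using that by blast
  qed
  have vL: "v i \<in> L" for i using nv by (auto simp: symp_def)
  have v\<alpha>: "\<alpha> (v k) = 0" if "k < 2 * n" for k using nv that by (auto simp: symp_def)
  have vB: "B (v k) (v l) = of_int (pair_sign k l)" if "k < 2 * n" "l < 2 * n" for k l
    using nv that by (auto simp: symp_def)
  \<comment> \<open>Coefficients of the \<open>B\<close>-orthogonal projection to the span of the
    pairs. Pairing with \<open>v l\<close> only sees the coefficient at the partner of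
    \<open>l\<close>, and the sign undoes \<open>pair_sign_partner\<close>.\<close>
  define a where "a x k = (if even k then B x (v (partner k)) else - B x (v (partner k)))" for x k
  define proj where "proj x = (\<Sum>k<2 * n. scale (a x k) (v k))" for x
  have projL: "proj x \<in> L" for x unfolding proj_def by (intro L_closed vL)
  have proj\<alpha>: "\<alpha> (proj x) = 0" for x
    unfolding proj_def by (subst \<alpha>_sum) (auto intro!: L_closed vL simp: \<alpha>_scale vL v\<alpha>)
  have proj_B: "B (proj x) (v l) = B x (v l)" if "l < 2 * n" for x l
  proof -
    define j where "j = partner l"
    have j: "j < 2 * n" "\<And>k. k \<noteq> j \<Longrightarrow> pair_sign k l = 0" "a x j * of_int (pair_sign j l) = B x (v l)"
      using that partner[of l] pair_sign_partner[of l] pair_sign_eq_0[of _ l] by (auto simp: j_def a_def)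
    have "B (proj x) (v l) = (\<Sum>k<2 * n. a x k * of_int (pair_sign k l))"
      unfolding proj_def using that by (subst B_sum_left) (auto intro!: L_closed vL sum.cong simp: B_scale_left vL vB)
    also have "\<dots> = (\<Sum>k\<in>{j}. a x k * of_int (pair_sign k l))"
      using j(1,2) by (intro sum.mono_neutral_right) auto
    finally show ?thesis using j(3) by simp
  qed
  \<comment> \<open>Maximality: a nonzero \<open>x\<close> in the kernel of \<open>\<alpha>\<close>
    is outside the radical, on whose nonzero vectors \<open>\<alpha>\<close> does not vanish. So
    \<open>x\<close> pairs nontrivially with some \<open>y\<close>, and together they would yield
    one more hyperbolic pair.\<close>
  have orth: "x = 0" if x: "x \<in> L" "\<alpha> x = 0" "\<And>k. k < 2 * n \<Longrightarrow> B x (v k) = 0" for x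
  proof (rule ccontr)
    assume "x \<noteq> 0"
    have "\<exists>y\<in>L. B x y \<noteq> 0"
    proof (rule ccontr)
      assume "\<not> (\<exists>y\<in>L. B x y \<noteq> 0)"
      then obtain c where "x = scale c \<xi>" using radical[OF x(1)] by blast
      then show False using x(2) \<alpha>_scale[OF \<xi>(1)] \<xi>(3) \<open>x \<noteq> 0\<close> by simp
    qed
    then obtain y where y: "y \<in> L" "B x y \<noteq> 0" by blast
    \<comment> \<open>Moving along the radical brings \<open>y\<close> into the kernel of
      \<open>\<alpha>\<close> without changing \<open>B x y\<close>.\<close>
    define y1 where "y1 = y - scale (\<alpha> y / \<alpha> \<xi>) \<xi>"
    have y1: "y1 \<in> L" "\<alpha> y1 = 0" "B x y1 = B x y"
      using y \<xi> x(1) B_skew[OF x(1) \<xi>(1)]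
      by (simp_all add: y1_def L_closed \<alpha>_diff \<alpha>_scale B_diff_right B_scale_right)
    have "B x (proj y1) = 0"
    proof -
      have "B (proj y1) x = (\<Sum>k<2 * n. a y1 k * B (v k) x)"
        unfolding proj_def using x(1) by (subst B_sum_left) (auto intro!: L_closed vL simp: B_scale_left vL)
      also have "\<dots> = 0" using x B_skew[OF vL x(1)] by (intro sum.neutral) auto
      finally show ?thesis using B_skew[OF x(1) projL] by simp
    qed
    \<comment> \<open>Removing the projection makes it orthogonal to the old pairs; \<open>x\<close>
      is orthogonal to them already, so its pairing is unaffected and can be normalised to
      \<open>1\<close>.\<close>
    define y2 where "y2 = scale (1 / B x y) (y1 - proj y1)"
    have y2: "y2 \<in> L" "\<alpha> y2 = 0" "B x y2 = 1" "\<And>k. k < 2 * n \<Longrightarrow> B y2 (v k) = 0"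
      using y y1 projL[of y1] x(1) \<open>B x (proj y1) = 0\<close> proj_B[of _ y1] vL
      by (simp_all add: y2_def L_closed \<alpha>_diff \<alpha>_scale B_diff_right B_scale_right B_diff_left
          B_scale_left proj\<alpha>)
    define u where "u k = (if k = 2 * n then x else if k = 2 * n + 1 then y2 else v k)" for k
    have "B (u k) (u l) = of_int (pair_sign k l)" if kl: "k < 2 * Suc n" "l < 2 * Suc n" for k l
    proof -
      have flip: "B (v i) x = 0" "B (v i) y2 = 0" if "i < 2 * n" for i
        using B_skew[OF vL x(1)] B_skew[OF vL y2(1)] x(3)[OF that] y2(4)[OF that] by auto
      have B_y2_x: "B y2 x = - 1" using B_skew[OF y2(1) x(1)] y2(3) by simp
      consider "k < 2 * n" "l < 2 * n" | "k < 2 * n" "l = 2 * n \<or> l = 2 * n + 1"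
        | "k = 2 * n \<or> k = 2 * n + 1" "l < 2 * n"
        | "k = 2 * n \<or> k = 2 * n + 1" "l = 2 * n \<or> l = 2 * n + 1" using kl by fastforce
      then show ?thesis
      proof cases
        case 1 then show ?thesis by (auto simp: u_def vB)
      next
        case 2
        then have "pair_sign k l = 0" by (auto simp: pair_sign_def)
        with 2 flip show ?thesis by (auto simp: u_def)
      next
        case 3
        then have "pair_sign k l = 0" by (auto simp: pair_sign_def)
        with 3 x(3) y2(4) show ?thesis by (auto simp: u_def)
      next
        case 4
        then show ?thesis using y2 B_self x(1) B_y2_x by (auto simp: u_def pair_sign_def)
      qed
    qed
    moreover have "range u \<subseteq> L" using vL x y2 by (auto simp: u_def)
    moreover have "\<alpha> (u k) = 0" if "k < 2 * Suc n" for k using that v\<alpha> x y2 by (auto simp: u_def)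
    ultimately have "symp (Suc n) u" by (auto simp: symp_def)
    from max[OF this] show False by simp
  qed
  \<comment> \<open>The radical vector goes into slot \<open>2 * n\<close>, the one on which
    \<open>\<alpha>\<close> is evaluated.\<close>
  define u where "u = v(2 * n := \<xi>)"
  have u: "u (2 * n) = \<xi>" "\<And>k. k < 2 * n \<Longrightarrow> u k = v k" by (auto simp: u_def)
  have uL: "range u \<subseteq> L" using vL \<xi> by (auto simp: u_def)
  have u_sum: "(\<Sum>i<2 * n + 1. scale (c i) (u i)) = (\<Sum>i<2 * n. scale (c i) (v i)) + scale (c (2 * n)) \<xi>" for c
    by (simp add: u)
  have "c j = 0" if c: "(\<Sum>i<2 * n + 1. scale (c i) (u i)) = 0" and j: "j < 2 * n + 1" for c j
  proof -
    have vs: "(\<Sum>i<2 * n. scale (c i) (v i)) \<in> L" "\<alpha> (\<Sum>i<2 * n. scale (c i) (v i)) = 0"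
      by (auto intro!: L_closed vL sum.neutral simp: \<alpha>_sum L_closed vL \<alpha>_scale v\<alpha>)
    have *: "(\<Sum>i<2 * n. scale (c i) (v i)) + scale (c (2 * n)) \<xi> = 0" using c unfolding u_sum .
    then have "\<alpha> ((\<Sum>i<2 * n. scale (c i) (v i)) + scale (c (2 * n)) \<xi>) = 0" by (simp add: \<alpha>_zero)
    then have last: "c (2 * n) = 0" using vs \<xi> by (simp add: \<alpha>_add L_closed \<alpha>_scale)
    then have "(\<Sum>i<2 * n. scale (c i) (v i)) = 0" using * by simp
    then have "c j = 0" if "j < 2 * n" using symp_coeff[OF nv _ that, of c] B_zero vL by auto
    with last j show ?thesis by (cases "j = 2 * n") auto
  qed
  then have fam: "inj_on u {..<2 * n + 1} \<and> independent (u ` {..<2 * n + 1})"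
    by (rule independent_family)
  have "L \<subseteq> span (u ` {..<2 * n + 1})"
  proof
    fix x assume x: "x \<in> L"
    define x1 where "x1 = x - scale (\<alpha> x / \<alpha> \<xi>) \<xi>"
    have x1: "x1 \<in> L" "\<alpha> x1 = 0"
      using x \<xi> by (simp_all add: x1_def L_closed \<alpha>_diff \<alpha>_scale)
    have "x1 - proj x1 = 0"
      using x1 projL vL proj_B proj\<alpha> by (intro orth) (simp_all add: L_closed \<alpha>_diff B_diff_left)
    then have "x = (\<Sum>k<2 * n. scale (a x1 k) (u k)) + scale (\<alpha> x / \<alpha> \<xi>) (u (2 * n))"
      using u by (simp add: x1_def proj_def algebra_simps)
    also have "\<dots> \<in> span (u ` {..<2 * n + 1})"
      by (intro span_add span_sum span_scale span_base) auto
    finally show "x \<in> span (u ` {..<2 * n + 1})" .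
  qed
  then have "dim L = 2 * n + 1"
    using fam uL by (intro dim_unique[of "u ` {..<2 * n + 1}"]) (auto simp: card_image)
  moreover have "top_form n u \<noteq> 0"
  proof -
    define t where "t \<sigma> = sign \<sigma> * (\<Prod>i<n. pair_sign (\<sigma> (2 * i)) (\<sigma> (2 * i + 1)))" for \<sigma> :: "nat \<Rightarrow> nat"
    let ?P = "{\<sigma>. \<sigma> permutes {..<2 * n + 1}}" and ?Q = "{\<sigma>. \<sigma> permutes {..<2 * n}}"
    have term_Q: "of_int (sign \<sigma>) * top_term n (u \<circ> \<sigma>) = of_int (t \<sigma>) * \<alpha> \<xi>" if \<sigma>: "\<sigma> \<in> ?Q" for \<sigma>
    proof -
      have \<sigma>_low: "\<sigma> k < 2 * n" if "k < 2 * n" for k using permutes_in_image[of \<sigma> "{..<2 * n}" k] \<sigma> that by auto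
      have "\<sigma> (2 * n) = 2 * n" using \<sigma> by (auto simp: permutes_def)
      moreover have "B (u (\<sigma> (2 * i))) (u (\<sigma> (2 * i + 1))) = of_int (pair_sign (\<sigma> (2 * i)) (\<sigma> (2 * i + 1)))"
        if "i < n" for i
        using \<sigma>_low[of "2 * i"] \<sigma>_low[of "2 * i + 1"] that u(2) vB by simp
      ultimately show ?thesis by (simp add: top_term_def t_def u)
    qed
    \<comment> \<open>A permutation moving the last index puts a vector of a hyperbolic pair into
      the argument of \<open>\<alpha>\<close>.\<close>
    have term_P: "of_int (sign \<sigma>) * top_term n (u \<circ> \<sigma>) = 0" if \<sigma>: "\<sigma> \<in> ?P - ?Q" for \<sigma>
    proof -
      have "\<sigma> (2 * n) \<noteq> 2 * n"
      proof
        assume "\<sigma> (2 * n) = 2 * n"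
        moreover have "x = 2 * n" if "x \<in> {..<2 * n + 1} - {..<2 * n}" for x using that by auto
        ultimately have "\<sigma> x = x" if "x \<in> {..<2 * n + 1} - {..<2 * n}" for x using that by metis
        then have "\<sigma> permutes {..<2 * n}"
          using \<sigma> permutes_superset[of \<sigma> "{..<2 * n + 1}" "{..<2 * n}"] by blast
        then show False using \<sigma> by blast
      qed
      moreover have "\<sigma> (2 * n) < 2 * n + 1" using permutes_in_image[of \<sigma> "{..<2 * n + 1}" "2 * n"] \<sigma> by auto
      ultimately show ?thesis by (simp add: top_term_def u v\<alpha>)
    qed
    have "top_form n u = (\<Sum>\<sigma>\<in>?Q. of_int (t \<sigma>) * \<alpha> \<xi>)"
    proof -
      have "top_form n u = (\<Sum>\<sigma>\<in>?Q. of_int (sign \<sigma>) * top_term n (u \<circ> \<sigma>))"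
        unfolding top_form_def alt_sum_def
      proof (rule sum.mono_neutral_right)
        show "finite ?P" by (simp add: finite_permutations)
        show "?Q \<subseteq> ?P" by (auto intro: permutes_subset)
        show "\<forall>\<sigma>\<in>?P - ?Q. of_int (sign \<sigma>) * top_term n (u \<circ> \<sigma>) = 0" using term_P by blast
      qed
      then show ?thesis using term_Q by simp
    qed
    also have "\<dots> = of_int (\<Sum>\<sigma>\<in>?Q. t \<sigma>) * \<alpha> \<xi>" by (simp add: sum_distrib_right)
    finally have sum: "top_form n u = of_int (\<Sum>\<sigma>\<in>?Q. t \<sigma>) * \<alpha> \<xi>" .
    \<comment> \<open>Every summand is \<open>0\<close> or \<open>1\<close>, and the identity
      contributes \<open>1\<close>; positivity of this integer replaces the evaluation of the
      Pfaffian.\<close>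
    have "(\<Sum>\<sigma>\<in>?Q. t \<sigma>) > 0"
    proof (rule sum_pos2)
      show "finite ?Q" by (simp add: finite_permutations)
      show "id \<in> ?Q" by (simp add: permutes_id)
      show "0 < t id" by (simp add: t_def sign_id pair_sign_def)
      show "0 \<le> t \<sigma>" if "\<sigma> \<in> ?Q" for \<sigma> using sign_mult_pair_sign[of \<sigma> n, folded t_def] that by auto
    qed
    then show ?thesis unfolding sum using \<xi>(3) by (simp del: of_int_sum)
  qed
  ultimately show ?thesis using uL by blast
qed

end

section \<open>Contact forms and polynomial functions on the dual\<close>

lemma poly_funs_sum: "(\<And>i. i \<in> J \<Longrightarrow> f i \<in> poly_funs S) \<Longrightarrow> (\<lambda>x. \<Sum>i\<in>J. f i x) \<in> poly_funs S"
  by (induction J rule: infinite_finite_induct) (auto intro: poly_funs.const poly_funs.add)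

lemma poly_funs_prod: "(\<And>i. i \<in> J \<Longrightarrow> f i \<in> poly_funs S) \<Longrightarrow> (\<lambda>x. \<Prod>i\<in>J. f i x) \<in> poly_funs S"
  by (induction J rule: infinite_finite_induct) (auto intro: poly_funs.const poly_funs.mult)

lemma poly_funs_uminus: "f \<in> poly_funs S \<Longrightarrow> (\<lambda>x. - f x) \<in> poly_funs S"
  using poly_funs.mult[OF poly_funs.const[of "- 1"]] by fastforce

lemma poly_funs_diff: "f \<in> poly_funs S \<Longrightarrow> g \<in> poly_funs S \<Longrightarrow> (\<lambda>x. f x - g x) \<in> poly_funs S"
  using poly_funs.add[OF _ poly_funs_uminus] by fastforce

lemma poly_zero_cofinite:
  fixes p :: "'k::field_char_0 poly"
  assumes "\<And>t. t \<noteq> a \<Longrightarrow> poly p t = 0"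
  shows "p = 0"
proof (rule ccontr)
  assume "p \<noteq> 0"
  then have "finite {t. poly p t = 0}" by (rule poly_roots_finite)
  moreover have "UNIV \<subseteq> insert a {t. poly p t = 0}" using assms by auto
  ultimately show False using infinite_UNIV_char_0[where 'a='k] finite_subset by blast
qed

lemma poly_eq_all:
  fixes p q :: "'k::field_char_0 poly"
  assumes "\<And>t. poly p t = poly q t"
  shows "p = q"
  using poly_zero_cofinite[of _ "p - q"] assms by auto

section \<open>Functionals, contact forms and stabilisers\<close>

context lie_algebra
begin

abbreviation evals :: "(('v \<Rightarrow> 'k) \<Rightarrow> 'k) set" where
  "evals \<equiv> (\<lambda>\<xi> \<gamma>. \<gamma> \<xi>) ` L"

lemma bracket_skew:
  assumes "x \<in> L" "y \<in> L"
  shows "bracket x y = - bracket y x"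
proof -
  have xy: "x + y \<in> L" using assms subspace_add[OF subspace_L] by blast
  have "0 = bracket x (x + y) + bracket y (x + y)"
    using assms bracket_self[OF xy] bracket_add_left[OF _ _ xy] by simp
  also have "\<dots> = bracket x y + bracket y x"
    using assms by (simp add: bracket_add_right bracket_self)
  finally show ?thesis by (simp add: eq_neg_iff_add_eq_0)
qed

lemma dualD:
  assumes "\<alpha> \<in> dual"
  shows "x \<in> L \<Longrightarrow> y \<in> L \<Longrightarrow> \<alpha> (x + y) = \<alpha> x + \<alpha> y"
    and "x \<in> L \<Longrightarrow> \<alpha> (scale c x) = c * \<alpha> x" "x \<notin> L \<Longrightarrow> \<alpha> x = 0" "\<alpha> 0 = 0"
    and "x \<in> L \<Longrightarrow> \<alpha> (- x) = - \<alpha> x" "x \<in> L \<Longrightarrow> y \<in> L \<Longrightarrow> \<alpha> (x - y) = \<alpha> x - \<alpha> y"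
    and "(\<And>i. i \<in> J \<Longrightarrow> f i \<in> L) \<Longrightarrow> \<alpha> (sum f J) = (\<Sum>i\<in>J. \<alpha> (f i))"
proof -
  show a: "\<And>x y. x \<in> L \<Longrightarrow> y \<in> L \<Longrightarrow> \<alpha> (x + y) = \<alpha> x + \<alpha> y"
    and s: "\<And>x c. x \<in> L \<Longrightarrow> \<alpha> (scale c x) = c * \<alpha> x" and "x \<notin> L \<Longrightarrow> \<alpha> x = 0"
    using assms unfolding dual_def by auto
  note L0 = subspace_0[OF subspace_L]
  show z: "\<alpha> 0 = 0" using s[OF L0, of 0] by simp
  show n: "\<alpha> (- x) = - \<alpha> x" if "x \<in> L" for x using s[OF that, of "- 1"] by simp
  show "\<alpha> (x - y) = \<alpha> x - \<alpha> y" if "x \<in> L" "y \<in> L"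
    using a[OF that(1) subspace_neg[OF subspace_L that(2)]] n[OF that(2)] by simp
  show "\<alpha> (sum f J) = (\<Sum>i\<in>J. \<alpha> (f i))" if "\<And>i. i \<in> J \<Longrightarrow> f i \<in> L"
    using that
    by (induction J rule: infinite_finite_induct) (auto simp: z a subspace_sum[OF subspace_L])
qed

lemma dual_add: "\<alpha> \<in> dual \<Longrightarrow> \<beta> \<in> dual \<Longrightarrow> (\<lambda>x. \<alpha> x + t * \<beta> x) \<in> dual"
  unfolding dual_def by (auto simp: algebra_simps)

lemma dual_scale: "\<alpha> \<in> dual \<Longrightarrow> (\<lambda>x. c * \<alpha> x) \<in> dual"
  unfolding dual_def by (auto simp: algebra_simps)

lemma zero_in_dual: "(\<lambda>_. 0) \<in> dual"
  unfolding dual_def by auto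

lemma exists_dual_nonzero:
  assumes "\<xi> \<in> L" "\<xi> \<noteq> 0"
  shows "\<exists>\<alpha>\<in>dual. \<alpha> \<xi> = 1"
proof -
  interpret K: vector_space "(*) :: 'k \<Rightarrow> 'k \<Rightarrow> 'k" by unfold_locales (auto simp: algebra_simps)
  interpret P: vector_space_pair scale "(*) :: 'k \<Rightarrow> 'k \<Rightarrow> 'k" ..
  obtain f where f: "Vector_Spaces.linear scale (*) f" "f \<xi> = 1"
    using P.linear_independent_extend[of "{\<xi>}" "\<lambda>_. 1"] assms(2) by auto
  interpret f: Vector_Spaces.linear scale "(*)" f by fact
  have "(\<lambda>x. if x \<in> L then f x else 0) \<in> dual"
    unfolding dual_def using subspace_add[OF subspace_L] subspace_scale[OF subspace_L]
    by (auto simp: f.add f.scale)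
  then show ?thesis using f(2) assms(1) by (intro bexI) auto
qed

lemma form_pair_dual:
  assumes "\<beta> \<in> dual" "\<alpha> \<in> dual"
  shows "form_pair scale L (\<lambda>x y. - \<beta> (bracket x y)) \<alpha>"
proof (unfold_locales, goal_cases)
  case 1
  then show ?case by (rule subspace_L)
next
  case (5 x y)
  then show ?case using bracket_skew[of x y] dualD(5)[OF assms(1)] bracket_closed by simp
qed (simp_all add: dualD[OF assms(1)] dualD[OF assms(2)] bracket_closed bracket_add_left
    bracket_scale_left bracket_self)

text \<open>The two functionals are kept apart on purpose: \<open>\<beta> = \<alpha>\<close> decides
  whether \<open>\<alpha>\<close> is contact, while for fixed \<open>\<alpha>\<close> and fixed
  vectors the value is a polynomial in \<open>\<beta>\<close>.\<close>

definition contact_form :: "('v \<Rightarrow> 'k) \<Rightarrow> ('v \<Rightarrow> 'k) \<Rightarrow> nat \<Rightarrow> (nat \<Rightarrow> 'v) \<Rightarrow> 'k" where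
  "contact_form \<beta> \<alpha> = form_pair.top_form (\<lambda>x y. - \<beta> (bracket x y)) \<alpha>"

lemma contact_form_eq:
  assumes "\<beta> \<in> dual" "\<alpha> \<in> dual"
  shows "contact_form \<beta> \<alpha> n =
    alt_sum (2 * n + 1) (\<lambda>w. (\<Prod>i<n. - \<beta> (bracket (w (2 * i)) (w (2 * i + 1)))) * \<alpha> (w (2 * n)))"
  unfolding contact_form_def form_pair.top_form_def[OF form_pair_dual[OF assms]]
    form_pair.top_term_def[OF form_pair_dual[OF assms]] ..

lemma contact_iff:
  "contact \<longleftrightarrow> (\<exists>n. dim L = 2 * n + 1 \<and>
     (\<exists>\<alpha>\<in>dual. \<exists>v. range v \<subseteq> L \<and> contact_form \<alpha> \<alpha> n v \<noteq> 0))"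
proof -
  have "wedge (2 * n) 1 (wedge_power 2 (ce_differential \<alpha>) n) (\<lambda>v. \<alpha> (v 0)) v =
      (1 / 2) ^ n * contact_form \<alpha> \<alpha> n v" if "\<alpha> \<in> dual" for n \<alpha> v
    unfolding wedge_alt_sum[OF wedge_power_alt_sum] contact_form_eq[OF that that]
    by (simp add: ce_differential_def)
  then show ?thesis unfolding contact_def by (auto simp: image_subset_iff)
qed

text \<open>The stabiliser is the radical of the \<open>2\<close>-form. The odd dimension supplies
  \<open>\<eta>\<close>: if \<open>\<alpha>\<close> vanished on \<open>L\<close>, then all of
  \<open>L\<close> would lie in the stabiliser and in the kernel of \<open>\<alpha>\<close>, hence
  be zero.\<close>

lemma contact_imp_trivial_kernel:
  assumes contact
  obtains \<alpha> \<eta> where "\<alpha> \<in> dual" "\<eta> \<in> L" "\<alpha> \<eta> \<noteq> 0"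
    "\<And>\<xi>. \<xi> \<in> stabiliser \<alpha> \<Longrightarrow> \<alpha> \<xi> = 0 \<Longrightarrow> \<xi> = 0"
proof -
  from assms obtain n \<alpha> v where *: "dim L = 2 * n + 1" "\<alpha> \<in> dual" "range v \<subseteq> L"
    "contact_form \<alpha> \<alpha> n v \<noteq> 0" unfolding contact_iff by blast
  have ker: "\<xi> = 0" if "\<xi> \<in> stabiliser \<alpha>" "\<alpha> \<xi> = 0" for \<xi>
    using form_pair.common_kernel_trivial[OF form_pair_dual[OF *(2,2)] *(4)[unfolded contact_form_def] *(1,3)]
      that unfolding stabiliser_def by auto
  have "\<exists>\<eta>\<in>L. \<alpha> \<eta> \<noteq> 0"
  proof (rule ccontr)
    assume no: "\<not> (\<exists>\<eta>\<in>L. \<alpha> \<eta> \<noteq> 0)"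
    then have "L \<subseteq> {0}" using ker bracket_closed unfolding stabiliser_def by auto
    then have "dim L = 0" using subspace_0[OF subspace_L] by (intro dim_unique[of "{}"]) (auto simp: independent_empty)
    then show False using *(1) by simp
  qed
  with ker * that show ?thesis by blast
qed

context
  fixes T :: "'v set"
  assumes fin: "finite T" "L \<subseteq> span T"
begin

lemma exists_contact_form_nonzero:
  assumes "\<beta> \<in> dual" "\<alpha> \<in> dual" "\<xi> \<in> stabiliser \<beta>" "stabiliser \<beta> \<subseteq> range (\<lambda>c. scale c \<xi>)" "\<alpha> \<xi> \<noteq> 0"
  obtains n v where "dim L = 2 * n + 1" "range v \<subseteq> L" "contact_form \<beta> \<alpha> n v \<noteq> 0"
proof -
  have "\<exists>n v. dim L = 2 * n + 1 \<and> range v \<subseteq> L \<and> contact_form \<beta> \<alpha> n v \<noteq> 0"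
    unfolding contact_form_def
  proof (rule form_pair.exists_top_form_nonzero[OF form_pair_dual[OF assms(1,2)] fin])
    show "\<xi> \<in> L" "\<alpha> \<xi> \<noteq> 0" "\<And>\<eta>. \<eta> \<in> L \<Longrightarrow> - \<beta> (bracket \<xi> \<eta>) = 0"
      using assms by (auto simp: stabiliser_def)
    show "\<exists>c. x = scale c \<xi>" if "x \<in> L" "\<And>\<eta>. \<eta> \<in> L \<Longrightarrow> - \<beta> (bracket x \<eta>) = 0" for x
      using assms(4) that by (auto simp: stabiliser_def)
  qed
  with that show ?thesis by blast
qed

lemma contactI:
  assumes "\<alpha> \<in> dual" "\<xi> \<in> stabiliser \<alpha>" "stabiliser \<alpha> \<subseteq> range (\<lambda>c. scale c \<xi>)" "\<alpha> \<xi> \<noteq> 0"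
  shows contact
  using exists_contact_form_nonzero[OF assms(1,1,2,3,4)] assms(1) unfolding contact_iff by metis

text \<open>\<open>s\<close> is the top form with \<open>\<alpha>\<close> and the vectors frozen.
  Where it does not vanish, the kernel of \<open>\<alpha>\<close> meets the stabiliser trivially, so
  \<open>\<alpha>\<close> embeds the stabiliser into the field and its dimension is at most
  one.\<close>

lemma stabiliser_semicontinuous:
  assumes \<beta>: "\<beta> \<in> dual" and \<xi>: "\<xi> \<in> stabiliser \<beta>" "stabiliser \<beta> \<subseteq> range (\<lambda>c. scale c \<xi>)" "\<xi> \<noteq> 0"
  obtains s \<alpha> where "s \<in> poly_funs evals" "s \<beta> \<noteq> 0" "\<alpha> \<in> dual"
    "\<And>\<gamma> \<eta>. \<gamma> \<in> dual \<Longrightarrow> s \<gamma> \<noteq> 0 \<Longrightarrow> \<eta> \<in> stabiliser \<gamma> \<Longrightarrow> \<alpha> \<eta> = 0 \<Longrightarrow> \<eta> = 0"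
proof -
  have "\<xi> \<in> L" using \<xi>(1) by (simp add: stabiliser_def)
  then obtain \<alpha> where \<alpha>: "\<alpha> \<in> dual" "\<alpha> \<xi> = 1" using exists_dual_nonzero \<xi>(3) by blast
  then have "\<alpha> \<xi> \<noteq> 0" by simp
  from exists_contact_form_nonzero[OF \<beta> \<alpha>(1) \<xi>(1,2) this]
  obtain n v where nv: "dim L = 2 * n + 1" "range v \<subseteq> L" "contact_form \<beta> \<alpha> n v \<noteq> 0" by blast
  have vL: "v i \<in> L" for i using nv(2) by auto
  define s where "s \<gamma> = (\<Sum>\<sigma> | \<sigma> permutes {..<2 * n + 1}. of_int (sign \<sigma>) *
    ((\<Prod>i<n. - \<gamma> (bracket (v (\<sigma> (2 * i))) (v (\<sigma> (2 * i + 1))))) * \<alpha> (v (\<sigma> (2 * n)))))" for \<gamma>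
  have s_eq: "contact_form \<gamma> \<alpha> n v = s \<gamma>" if "\<gamma> \<in> dual" for \<gamma>
    unfolding contact_form_eq[OF that \<alpha>(1)] alt_sum_def s_def by simp
  show ?thesis
  proof (rule that[of s])
    show "s \<in> poly_funs evals"
      unfolding s_def
      by (intro poly_funs_sum poly_funs.mult poly_funs_prod poly_funs_uminus poly_funs.const
          poly_funs.gen imageI bracket_closed vL)
    show "s \<beta> \<noteq> 0" using nv(3) s_eq[OF \<beta>] by simp
    show "\<alpha> \<in> dual" by fact
    show "\<eta> = 0" if "\<gamma> \<in> dual" "s \<gamma> \<noteq> 0" "\<eta> \<in> stabiliser \<gamma>" "\<alpha> \<eta> = 0" for \<gamma> \<eta>
      using form_pair.common_kernel_trivial[OF form_pair_dual[OF that(1) \<alpha>(1)] _ nv(1,2), of \<eta>]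
        that s_eq[OF that(1)] unfolding contact_form_def stabiliser_def by auto
  qed
qed

end

text \<open>The differential of \<open>p\<close> at \<open>\<gamma>\<close> is a functional on the
  dual, encoded by the vector \<open>P \<gamma>\<close> of \<open>L\<close>. A relation suffices,
  because \<open>P\<close> can be read off from any expression of \<open>p\<close>; no uniqueness is
  claimed.\<close>

inductive gradient :: "(('v \<Rightarrow> 'k) \<Rightarrow> 'k) \<Rightarrow> (('v \<Rightarrow> 'k) \<Rightarrow> 'v) \<Rightarrow> bool" where
  gradient_eval: "\<eta> \<in> L \<Longrightarrow> gradient (\<lambda>\<gamma>. \<gamma> \<eta>) (\<lambda>_. \<eta>)"
| gradient_const: "gradient (\<lambda>_. c) (\<lambda>_. 0)"
| gradient_add: "gradient p P \<Longrightarrow> gradient q R \<Longrightarrow> gradient (\<lambda>\<gamma>. p \<gamma> + q \<gamma>) (\<lambda>\<gamma>. P \<gamma> + R \<gamma>)"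
| gradient_mult: "gradient p P \<Longrightarrow> gradient q R \<Longrightarrow>
    gradient (\<lambda>\<gamma>. p \<gamma> * q \<gamma>) (\<lambda>\<gamma>. scale (p \<gamma>) (R \<gamma>) + scale (q \<gamma>) (P \<gamma>))"

lemma exists_gradient:
  assumes "p \<in> poly_funs evals"
  shows "\<exists>P. gradient p P"
  using assms by induction (blast intro: gradient.intros)+

lemma gradient_in_L:
  assumes "gradient p P"
  shows "P \<gamma> \<in> L"
  using assms
  by induction (auto intro: subspace_add[OF subspace_L] subspace_scale[OF subspace_L] subspace_0[OF subspace_L])

lemma dual_gradient_sum:
  assumes "v \<in> dual" "gradient p P" "gradient q R"
  shows "v (P \<gamma> + R \<gamma>) = v (P \<gamma>) + v (R \<gamma>)"
    and "v (scale a (R \<gamma>) + scale b (P \<gamma>)) = a * v (R \<gamma>) + b * v (P \<gamma>)"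
  using dualD[OF assms(1)] gradient_in_L[OF assms(2)] gradient_in_L[OF assms(3)]
    subspace_scale[OF subspace_L] by simp_all

lemma gradient_poly_funs:
  assumes "gradient p P"
  shows "p \<in> poly_funs evals" "v \<in> dual \<Longrightarrow> (\<lambda>\<gamma>. v (P \<gamma>)) \<in> poly_funs evals"
proof -
  have p: "p \<in> poly_funs evals" if "gradient p P" for p P
    using that by induction (auto intro: poly_funs.intros)
  then show "p \<in> poly_funs evals" using assms .
  show "(\<lambda>\<gamma>. v (P \<gamma>)) \<in> poly_funs evals" if "v \<in> dual"
    using assms
  proof induction
    case (gradient_mult p P q R)
    then show ?case
      unfolding dual_gradient_sum[OF that gradient_mult.hyps]
      by (intro poly_funs.add poly_funs.mult p[OF gradient_mult.hyps(1)] p[OF gradient_mult.hyps(2)])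
  qed (auto intro: poly_funs.add poly_funs.const simp: dual_gradient_sum[OF that])
qed

text \<open>The chain rule on an affine line. Values and derivatives share one witness
  \<open>q\<close>, as the product rule requires in the induction.\<close>

lemma gradient_line:
  assumes "gradient p P" and v: "v \<in> dual"
  shows "\<exists>q. \<forall>t. p (\<lambda>x. \<beta> x + t * v x) = poly q t \<and>
    v (P (\<lambda>x. \<beta> x + t * v x)) = poly (pderiv q) t"
  using assms(1)
proof induction
  case (gradient_eval \<eta>)
  show ?case by (rule exI[of _ "[:\<beta> \<eta>, v \<eta>:]"]) (simp add: pderiv_pCons)
next
  case (gradient_const c)
  show ?case by (rule exI[of _ "[:c:]"]) (simp add: dualD(4)[OF v])
next
  case (gradient_add p P q R)
  then obtain f g where
    "\<forall>t. p (\<lambda>x. \<beta> x + t * v x) = poly f t \<and> v (P (\<lambda>x. \<beta> x + t * v x)) = poly (pderiv f) t"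
    "\<forall>t. q (\<lambda>x. \<beta> x + t * v x) = poly g t \<and> v (R (\<lambda>x. \<beta> x + t * v x)) = poly (pderiv g) t"
    by blast
  then show ?case
    by (intro exI[of _ "f + g"]) (simp add: pderiv_add dual_gradient_sum(1)[OF v gradient_add.hyps])
next
  case (gradient_mult p P q R)
  then obtain f g where
    "\<forall>t. p (\<lambda>x. \<beta> x + t * v x) = poly f t \<and> v (P (\<lambda>x. \<beta> x + t * v x)) = poly (pderiv f) t"
    "\<forall>t. q (\<lambda>x. \<beta> x + t * v x) = poly g t \<and> v (R (\<lambda>x. \<beta> x + t * v x)) = poly (pderiv g) t"
    by blast
  then show ?case
    by (intro exI[of _ "f * g"]) (simp add: pderiv_mult dual_gradient_sum(2)[OF v gradient_mult.hyps])
qed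

lemma poly_funs_line:
  assumes "p \<in> poly_funs evals" "v \<in> dual"
  obtains q where "\<And>t. p (\<lambda>x. \<beta> x + t * v x) = poly q t"
  using exists_gradient[OF assms(1)] gradient_line[OF _ assms(2)] by metis

text \<open>On the line joining \<open>\<beta>\<close> and \<open>\<gamma>\<close> both functions
  become nonzero polynomials in one variable, and these have a common non-root.\<close>

lemma dual_irreducible:
  assumes p: "p \<in> poly_funs evals" "\<beta> \<in> dual" "p \<beta> \<noteq> 0"
    and q: "q \<in> poly_funs evals" "\<gamma> \<in> dual" "q \<gamma> \<noteq> 0"
  obtains \<delta> where "\<delta> \<in> dual" "p \<delta> \<noteq> 0" "q \<delta> \<noteq> 0"
proof -
  define v where "v x = \<gamma> x + - 1 * \<beta> x" for x
  have v: "v \<in> dual" unfolding v_def by (rule dual_add[OF q(2) p(2)])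
  obtain f where f: "\<And>t. p (\<lambda>x. \<beta> x + t * v x) = poly f t" using poly_funs_line[OF p(1) v] by blast
  obtain g where g: "\<And>t. q (\<lambda>x. \<beta> x + t * v x) = poly g t" using poly_funs_line[OF q(1) v] by blast
  have "f \<noteq> 0" using f[of 0] p(3) by auto
  moreover have "g \<noteq> 0" using g[of 1] q(3) by (auto simp: v_def)
  ultimately obtain t where "poly (f * g) t \<noteq> 0"
    using exists_non_root[of "f * g"] by auto
  then have "p (\<lambda>x. \<beta> x + t * v x) \<noteq> 0" "q (\<lambda>x. \<beta> x + t * v x) \<noteq> 0" by (auto simp: f g)
  then show ?thesis by (rule that[OF dual_add[OF p(2) v]])
qed

text \<open>Directional derivatives of a polynomial vanishing on \<open>Z\<close> vanish on
  \<open>Z\<close> again. Restrict to a line through a point of \<open>Z\<close>: by induction on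
  the degree the derivative of the restriction is zero, so in characteristic zero the restriction is
  constant, and it is \<open>0\<close> at that point.\<close>

lemma dense_if_gradients_vanish:
  assumes Z: "Z \<subseteq> dual" "Z \<noteq> {}"
    and grad: "\<And>p P \<beta>. gradient p P \<Longrightarrow> (\<And>\<gamma>. \<gamma> \<in> Z \<Longrightarrow> p \<gamma> = 0) \<Longrightarrow> \<beta> \<in> Z \<Longrightarrow> P \<beta> = 0"
    and p: "p \<in> poly_funs evals" "\<And>\<gamma>. \<gamma> \<in> Z \<Longrightarrow> p \<gamma> = 0" and \<gamma>: "\<gamma> \<in> dual"
  shows "p \<gamma> = 0"
proof -
  obtain \<beta> where \<beta>: "\<beta> \<in> Z" using Z(2) by blast
  define v where "v x = \<gamma> x + - 1 * \<beta> x" for x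
  have v: "v \<in> dual" unfolding v_def using dual_add \<gamma> \<beta> Z(1) by blast
  have main: "q = 0"
    if "p \<in> poly_funs evals" "\<And>\<gamma>. \<gamma> \<in> Z \<Longrightarrow> p \<gamma> = 0" "\<And>t. p (\<lambda>x. \<beta> x + t * v x) = poly q t" for p q
    using that
  proof (induction "degree q" arbitrary: p q rule: less_induct)
    case less
    obtain P where P: "gradient p P" using exists_gradient[OF less.prems(1)] by blast
    obtain q' where q': "\<And>t. p (\<lambda>x. \<beta> x + t * v x) = poly q' t"
      "\<And>t. v (P (\<lambda>x. \<beta> x + t * v x)) = poly (pderiv q') t"
      using gradient_line[OF P v] by blast
    have "q' = q" using q'(1) less.prems(3) by (intro poly_eq_all) simp
    have "v (P \<gamma>) = 0" if "\<gamma> \<in> Z" for \<gamma>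
      using grad[OF P less.prems(2) that] dualD(4)[OF v] by simp
    note IH = less.hyps[OF _ gradient_poly_funs(2)[OF P v] this, of "pderiv q"]
    have "degree q = 0"
    proof (rule ccontr)
      assume "degree q \<noteq> 0"
      then have "pderiv q = 0" using IH q'(2) \<open>q' = q\<close> by (simp add: degree_pderiv)
      then show False using \<open>degree q \<noteq> 0\<close> by (simp add: pderiv_eq_0_iff)
    qed
    then obtain c where "q = [:c:]" by (rule degree_eq_zeroE)
    moreover have "poly q 0 = 0" using less.prems(3)[of 0] less.prems(2)[OF \<beta>] by simp
    ultimately show ?case by simp
  qed
  obtain q where q: "\<And>t. p (\<lambda>x. \<beta> x + t * v x) = poly q t" using poly_funs_line[OF p(1) v] by blast
  have "q = 0" by (rule main[OF p q])
  then have "p (\<lambda>x. \<beta> x + 1 * v x) = 0" unfolding q by simp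
  then show ?thesis by (simp add: v_def)
qed

lemma openin_dual_zariski_nonempty:
  assumes "openin dual_zariski U" "U \<noteq> {}"
  obtains f \<beta> where "f \<in> poly_funs evals" "\<beta> \<in> dual" "f \<beta> \<noteq> 0"
    "\<And>\<gamma>. \<gamma> \<in> dual \<Longrightarrow> f \<gamma> \<noteq> 0 \<Longrightarrow> \<gamma> \<in> U"
proof -
  obtain F where F: "F \<subseteq> poly_funs evals" "U = dual - {\<gamma> \<in> dual. \<forall>f\<in>F. f \<gamma> = 0}"
    using assms(1) unfolding dual_zariski_def openin_zariski by blast
  then obtain \<beta> f where "\<beta> \<in> dual" "f \<in> F" "f \<beta> \<noteq> 0" using assms(2) by blast
  with F that show ?thesis by blast
qed

lemma openin_dual_zariski_basic:
  assumes "p \<in> poly_funs evals"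
  shows "openin dual_zariski {\<gamma> \<in> dual. p \<gamma> \<noteq> 0}"
  unfolding dual_zariski_def openin_zariski using assms by (intro exI[of _ "{p}"]) auto

end

section \<open>Left invariant derivations and the adjoint action\<close>

lemma on_group_simps [simp]: "x \<in> carrier Q \<Longrightarrow> on_group Q f x = f x" "x \<notin> carrier Q \<Longrightarrow> on_group Q f x = 0"
  by (simp_all add: on_group_def)

context affine_algebraic_group
begin

sublocale lie: lie_algebra scale_op "Lie Q" commutator
  by (rule lie_algebra_Lie)

abbreviation \<O> :: "('k ^ 'n \<Rightarrow> 'k) set" where "\<O> \<equiv> coordinate_ring Q"

lemma coordinate_ringI: "p \<in> poly_funs coords \<Longrightarrow> on_group Q p \<in> \<O>"
  by (simp add: coordinate_ring_def)

lemma coordinate_ring_outside: "f \<in> \<O> \<Longrightarrow> x \<notin> carrier Q \<Longrightarrow> f x = 0"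
  by (auto simp: coordinate_ring_def)

lemma coordinate_ring_on_group: "f \<in> \<O> \<Longrightarrow> on_group Q f = f"
  by (auto simp: coordinate_ring_outside on_group_def fun_eq_iff)

lemma coordinate_ring_eqI:
  "f \<in> \<O> \<Longrightarrow> g \<in> \<O> \<Longrightarrow> (\<And>x. x \<in> carrier Q \<Longrightarrow> f x = g x) \<Longrightarrow> f = g"
  using coordinate_ring_outside by (metis ext)

lemma coordinate_ring_cong:
  "g \<in> \<O> \<Longrightarrow> (\<And>x. x \<in> carrier Q \<Longrightarrow> f x = g x) \<Longrightarrow> on_group Q f \<in> \<O>"
proof -
  assume "g \<in> \<O>" and fg: "\<And>x. x \<in> carrier Q \<Longrightarrow> f x = g x"
  moreover have "on_group Q f = on_group Q g" using fg by (auto simp: on_group_def fun_eq_iff)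
  ultimately show ?thesis using coordinate_ring_on_group by simp
qed

lemma coordinate_ring_mult: "f \<in> \<O> \<Longrightarrow> g \<in> \<O> \<Longrightarrow> f * g \<in> \<O>"
proof -
  assume "f \<in> \<O>" "g \<in> \<O>"
  then obtain p q where pq: "p \<in> poly_funs coords" "q \<in> poly_funs coords"
    "f = on_group Q p" "g = on_group Q q" unfolding coordinate_ring_def by blast
  then have "f * g = on_group Q (\<lambda>x. p x * q x)" by (simp add: on_group_def fun_eq_iff)
  then show ?thesis using coordinate_ringI[OF poly_funs.mult[OF pq(1,2)]] by simp
qed

lemma coordinate_ring_const: "on_group Q (\<lambda>_. c) \<in> \<O>"
  by (rule coordinate_ringI[OF poly_funs.const])

lemma coordinate_ring_sum: "(\<And>i. i \<in> J \<Longrightarrow> f i \<in> \<O>) \<Longrightarrow> (\<lambda>x. \<Sum>i\<in>J. f i x) \<in> \<O>"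
proof (induction J rule: infinite_finite_induct)
  case (insert j J)
  then show ?case
    using coordinate_ring_add[of "f j" Q "\<lambda>x. \<Sum>i\<in>J. f i x"] by (simp add: plus_fun_def)
qed (use coordinate_ring_zero in \<open>simp_all add: zero_fun_def\<close>)

text \<open>A point built from a homomorphism is known only through its values on polynomials; this
  puts it into the group.\<close>

lemma carrier_zariski_closed:
  assumes "\<And>p. p \<in> poly_funs coords \<Longrightarrow> (\<And>y. y \<in> carrier Q \<Longrightarrow> p y = 0) \<Longrightarrow> p x = 0"
  shows "x \<in> carrier Q"
proof -
  obtain F where F: "F \<subseteq> poly_funs coords"
    "UNIV - carrier Q = UNIV - {x \<in> UNIV. \<forall>f\<in>F. f x = 0}"
    using closed_carrier unfolding closedin_def topspace_zariski openin_zariski by blast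
  then have "carrier Q = {x. \<forall>f\<in>F. f x = 0}" by blast
  with F(1) assms show ?thesis by blast
qed

section \<open>Comultiplication of the coordinate ring\<close>

inductive_set tensors :: "('k ^ 'n \<Rightarrow> 'k ^ 'n \<Rightarrow> 'k) set" where
  basic: "u \<in> \<O> \<Longrightarrow> w \<in> \<O> \<Longrightarrow> (\<lambda>x y. u x * w y) \<in> tensors"
| add: "h \<in> tensors \<Longrightarrow> k \<in> tensors \<Longrightarrow> (\<lambda>x y. h x y + k x y) \<in> tensors"

lemma tensors_mult:
  assumes "h \<in> tensors" "k \<in> tensors"
  shows "(\<lambda>x y. h x y * k x y) \<in> tensors"
  using assms(1)
proof induction
  case (basic u w)
  show ?case
    using assms(2)
  proof induction
    case (basic u' w')
    have "(\<lambda>x y. (u * u') x * (w * w') y) \<in> tensors"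
      using basic \<open>u \<in> \<O>\<close> \<open>w \<in> \<O>\<close> by (intro tensors.basic coordinate_ring_mult)
    then show ?case by (simp add: mult_ac)
  next
    case (add h k)
    then show ?case using tensors.add by (fastforce simp: distrib_left)
  qed
next
  case (add h k)
  then show ?case using tensors.add by (fastforce simp: distrib_right)
qed

lemma sum_shift:
  fixes a b :: "nat \<Rightarrow> 'c::comm_monoid_add"
  shows "(\<Sum>j<N + M. if j < N then a j else b (j - N)) = (\<Sum>j<N. a j) + (\<Sum>j<M. b j)"
  by (induction M) (simp_all add: add.assoc)

lemma tensorsE:
  assumes "h \<in> tensors"
  obtains N :: nat and u w where "\<And>j. j < N \<Longrightarrow> u j \<in> \<O>" "\<And>j. j < N \<Longrightarrow> w j \<in> \<O>"
    "\<And>x y. h x y = (\<Sum>j<N. u j x * w j y)"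
proof -
  have "\<exists>N u w. (\<forall>j<N. u j \<in> \<O> \<and> w j \<in> \<O>) \<and> (\<forall>x y. h x y = (\<Sum>j<N::nat. u j x * w j y))"
    using assms
  proof induction
    case (basic u w)
    then show ?case by (intro exI[of _ 1] exI[of _ "\<lambda>_. u"] exI[of _ "\<lambda>_. w"]) auto
  next
    case (add h k)
    then obtain N u w M u' w' where *: "\<forall>j<N. u j \<in> \<O> \<and> w j \<in> \<O>" "\<forall>x y. h x y = (\<Sum>j<N::nat. u j x * w j y)"
      "\<forall>j<M. u' j \<in> \<O> \<and> w' j \<in> \<O>" "\<forall>x y. k x y = (\<Sum>j<M::nat. u' j x * w' j y)" by blast
    have "(\<Sum>j<N + M. (if j < N then u j else u' (j - N)) x * (if j < N then w j else w' (j - N)) y) =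
        h x y + k x y" for x y
      using sum_shift[where N = N and M = M and a = "\<lambda>j. u j x * w j y" and b = "\<lambda>j. u' j x * w' j y"] *(2,4)
      by (simp add: if_distrib if_distribR cong: if_cong)
    then show ?case
      using *(1,3)
      by (intro exI[of _ "N + M"] exI[of _ "\<lambda>j. if j < N then u j else u' (j - N)"]
          exI[of _ "\<lambda>j. if j < N then w j else w' (j - N)"]) auto
  qed
  with that show ?thesis by blast
qed

lemma tensors_left: "u \<in> \<O> \<Longrightarrow> \<exists>h\<in>tensors. \<forall>x\<in>carrier Q. \<forall>y\<in>carrier Q. u x = h x y"
  by (rule bexI[OF _ tensors.basic[OF _ coordinate_ring_const[of 1]]]) auto

lemma tensors_right: "w \<in> \<O> \<Longrightarrow> \<exists>h\<in>tensors. \<forall>x\<in>carrier Q. \<forall>y\<in>carrier Q. w y = h x y"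
  by (rule bexI[OF _ tensors.basic[OF coordinate_ring_const[of 1]]]) auto

text \<open>Functions of two variables that agree on the group with a tensor form an algebra. It
  contains the coordinates of both arguments, hence those of the product, and hence every polynomial
  in them.\<close>

lemma comultiplication_tensor:
  assumes "f \<in> \<O>"
  shows "\<exists>h\<in>tensors. \<forall>x\<in>carrier Q. \<forall>y\<in>carrier Q. f (x \<otimes> y) = h x y"
proof -
  define S where "S k \<longleftrightarrow> (\<exists>h\<in>tensors. \<forall>x\<in>carrier Q. \<forall>y\<in>carrier Q. k x y = h x y)"
    for k :: "'k ^ 'n \<Rightarrow> 'k ^ 'n \<Rightarrow> 'k"
  have S_add: "S (\<lambda>x y. h x y + k x y)" and S_mult: "S (\<lambda>x y. h x y * k x y)" if "S h" "S k" for h k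
  proof -
    from that obtain h' k' where *: "h' \<in> tensors" "k' \<in> tensors"
      "\<forall>x\<in>carrier Q. \<forall>y\<in>carrier Q. h x y = h' x y" "\<forall>x\<in>carrier Q. \<forall>y\<in>carrier Q. k x y = k' x y"
      unfolding S_def by blast
    then show "S (\<lambda>x y. h x y + k x y)" "S (\<lambda>x y. h x y * k x y)"
      unfolding S_def using tensors.add[OF *(1,2)] tensors_mult[OF *(1,2)]
      by (auto intro!: bexI)
  qed
  have S_const: "S (\<lambda>_ _. c)" for c
    using tensors_left[OF coordinate_ring_const[of c]] unfolding S_def by auto
  have coord: "(\<lambda>x. x $ i) \<in> poly_funs coords" for i :: 'n
    by (intro poly_funs.gen) (auto simp: coords_def)
  have S_coords2: "S (\<lambda>x y. P (x, y))" if "P \<in> poly_funs coords2" for P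
    using that
  proof induction
    case (gen P)
    then obtain i where "P = (\<lambda>(x, y). x $ i) \<or> P = (\<lambda>(x, y). y $ i)" unfolding coords2_def by blast
    then show ?case
      using tensors_left[OF coordinate_ringI[OF coord[of i]]]
        tensors_right[OF coordinate_ringI[OF coord[of i]]] unfolding S_def by auto
  qed (auto intro: S_const S_add S_mult)
  obtain p where p: "p \<in> poly_funs coords" "f = on_group Q p"
    using assms unfolding coordinate_ring_def by blast
  from p(1) have "S (\<lambda>x y. p (x \<otimes> y))"
  proof induction
    case (gen p)
    then obtain i where i: "p = (\<lambda>x. x $ i)" unfolding coords_def by blast
    obtain P where "P \<in> poly_funs coords2" "\<forall>x\<in>carrier Q. \<forall>y\<in>carrier Q. (x \<otimes> y) $ i = P (x, y)"
      using mult_poly by blast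
    with S_coords2[of P] show ?case unfolding S_def i by auto
  qed (auto intro: S_const S_add S_mult)
  then show ?thesis unfolding S_def p(2) by auto
qed

text \<open>Presents all translates of \<open>f\<close> as combinations of finitely many functions
  with coefficients in the coordinate ring. Derivations can thus be applied term by term, and
  functions defined through translates are seen to be regular.\<close>

lemma comultiplication:
  assumes "f \<in> \<O>"
  obtains N :: nat and u w where "\<And>j. j < N \<Longrightarrow> u j \<in> \<O>" "\<And>j. j < N \<Longrightarrow> w j \<in> \<O>"
    "\<And>x y. x \<in> carrier Q \<Longrightarrow> y \<in> carrier Q \<Longrightarrow> f (x \<otimes> y) = (\<Sum>j<N. u j x * w j y)"
proof -
  obtain h where h: "h \<in> tensors" "\<And>x y. x \<in> carrier Q \<Longrightarrow> y \<in> carrier Q \<Longrightarrow> f (x \<otimes> y) = h x y"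
    using comultiplication_tensor[OF assms] by blast
  from tensorsE[OF h(1)] obtain N :: nat and u w where
    "\<And>j. j < N \<Longrightarrow> u j \<in> \<O>" "\<And>j. j < N \<Longrightarrow> w j \<in> \<O>" "\<And>x y. h x y = (\<Sum>j<N. u j x * w j y)"
    by blast
  with h(2) show ?thesis by (intro that[of N u w]) auto
qed

lemma coordinate_ring_translate:
  assumes "f \<in> \<O>" "a \<in> carrier Q"
  shows "on_group Q (\<lambda>x. f (a \<otimes> x)) \<in> \<O>" "on_group Q (\<lambda>x. f (x \<otimes> a)) \<in> \<O>"
proof -
  obtain N :: nat and u w where uw: "\<And>j. j < N \<Longrightarrow> u j \<in> \<O>" "\<And>j. j < N \<Longrightarrow> w j \<in> \<O>"
    "\<And>x y. x \<in> carrier Q \<Longrightarrow> y \<in> carrier Q \<Longrightarrow> f (x \<otimes> y) = (\<Sum>j<N. u j x * w j y)"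
    using comultiplication[OF assms(1)] by blast
  have 1: "(\<lambda>x. \<Sum>j<N. u j a * w j x) \<in> \<O>" and 2: "(\<lambda>x. \<Sum>j<N. w j a * u j x) \<in> \<O>"
    using uw(1,2) by (auto intro!: coordinate_ring_sum coordinate_ring_scale)
  show "on_group Q (\<lambda>x. f (a \<otimes> x)) \<in> \<O>"
    by (rule coordinate_ring_cong[OF 1]) (use uw(3) assms(2) in simp)
  show "on_group Q (\<lambda>x. f (x \<otimes> a)) \<in> \<O>"
    by (rule coordinate_ring_cong[OF 2]) (use uw(3) assms(2) in \<open>simp add: mult.commute\<close>)
qed

lemma coordinate_ring_inv:
  assumes "f \<in> \<O>"
  shows "on_group Q (\<lambda>x. f (inv x)) \<in> \<O>"
proof -
  obtain p where p: "p \<in> poly_funs coords" "f = on_group Q p"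
    using assms unfolding coordinate_ring_def by blast
  from p(1) have "\<exists>q\<in>poly_funs coords. \<forall>x\<in>carrier Q. p (inv x) = q x"
  proof induction
    case (gen p)
    then show ?case using inv_poly unfolding coords_def by blast
  next
    case (const c)
    then show ?case by (intro bexI[of _ "\<lambda>_. c"] poly_funs.const) auto
  next
    case (add f g)
    then show ?case using poly_funs.add by (metis (no_types, lifting))
  next
    case (mult f g)
    then show ?case using poly_funs.mult by (metis (no_types, lifting))
  qed
  then obtain q where "q \<in> poly_funs coords" "\<forall>x\<in>carrier Q. p (inv x) = q x" by blast
  then show ?thesis using coordinate_ring_cong[OF coordinate_ringI, of q] p(2) by simp
qed

section \<open>Left invariant derivations and their values at the identity\<close>

lemma left_translate_apply: "a \<in> carrier Q \<Longrightarrow> x \<in> carrier Q \<Longrightarrow> left_translate Q a f x = f (inv a \<otimes> x)"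
  by (simp add: left_translate_def)

lemma left_translate_closed: "f \<in> \<O> \<Longrightarrow> a \<in> carrier Q \<Longrightarrow> left_translate Q a f \<in> \<O>"
  unfolding left_translate_def by (intro coordinate_ring_translate) auto

lemma left_translate_mult: "left_translate Q a (f * g) = left_translate Q a f * left_translate Q a g"
  by (simp add: left_translate_def on_group_def fun_eq_iff)

lemma left_translate_compose:
  assumes "a \<in> carrier Q" "b \<in> carrier Q"
  shows "left_translate Q a (left_translate Q b f) = left_translate Q (a \<otimes> b) f"
  using assms by (auto simp: left_translate_def on_group_def fun_eq_iff inv_mult_group m_assoc)

lemma left_translate_one: "f \<in> \<O> \<Longrightarrow> left_translate Q \<one> f = f"
  by (auto simp: left_translate_def on_group_def fun_eq_iff coordinate_ring_outside)

lemma Lie_sum: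
  assumes D: "D \<in> Lie Q" and f: "\<And>i. i \<in> J \<Longrightarrow> f i \<in> \<O>"
  shows "D (\<lambda>x. \<Sum>i\<in>J. c i * f i x) = (\<lambda>x. \<Sum>i\<in>J. c i * D (f i) x)"
  using f
proof (induction J rule: infinite_finite_induct)
  case (insert j J)
  have 1: "(\<lambda>x. c j * f j x) \<in> \<O>" "(\<lambda>x. \<Sum>i\<in>J. c i * f i x) \<in> \<O>"
    using insert.prems by (auto intro!: coordinate_ring_sum coordinate_ring_scale)
  have "(\<lambda>x. \<Sum>i\<in>insert j J. c i * f i x) = (\<lambda>x. c j * f j x) + (\<lambda>x. \<Sum>i\<in>J. c i * f i x)"
    using insert.hyps by (simp add: fun_eq_iff)
  then have "D (\<lambda>x. \<Sum>i\<in>insert j J. c i * f i x) = (\<lambda>x. c j * D (f j) x) + (\<lambda>x. \<Sum>i\<in>J. c i * D (f i) x)"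
    using LieD(3)[OF D 1] LieD(4)[OF D insert.prems, of j "c j"] insert by simp
  then show ?case using insert.hyps by (simp add: fun_eq_iff)
qed (use Lie_apply_zero[OF D] in \<open>simp_all add: zero_fun_def\<close>)

lemma Lie_const:
  assumes D: "D \<in> Lie Q"
  shows "D (on_group Q (\<lambda>_. c)) = 0"
proof -
  let ?e = "on_group Q (\<lambda>_. 1)"
  have "?e * ?e = ?e" by (auto simp: on_group_def fun_eq_iff)
  then have "D ?e = D ?e * ?e + ?e * D ?e"
    using LieD(5)[OF D coordinate_ring_const[of 1] coordinate_ring_const[of 1]] by simp
  also have "\<dots> = D ?e + D ?e"
    using coordinate_ring_outside[OF Lie_apply_closed[OF D, of ?e]] by (auto simp: fun_eq_iff on_group_def)
  finally have "D ?e = 0" by simp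
  moreover have "on_group Q (\<lambda>_. c) = (\<lambda>x. c * ?e x)" by (auto simp: on_group_def fun_eq_iff)
  then have "D (on_group Q (\<lambda>_. c)) = (\<lambda>x. c * D ?e x)"
    using LieD(4)[OF D coordinate_ring_const[of 1], of c] by simp
  ultimately show ?thesis by (simp add: fun_eq_iff)
qed

lemma Lie_at_one:
  assumes D: "D \<in> Lie Q" and f: "f \<in> \<O>" and x: "x \<in> carrier Q"
  shows "D f x = D (left_translate Q (inv x) f) \<one>"
  using LieD(6)[OF D inv_closed[OF x] f] x by (simp add: left_translate_apply)

text \<open>Left invariance moves the evaluation at \<open>x\<close> to the identity, so a
  derivation acts on the second tensor factor only.\<close>

lemma Lie_comultiplication:
  assumes D: "D \<in> Lie Q" and f: "f \<in> \<O>" and w: "\<And>j. j < N \<Longrightarrow> w j \<in> \<O>"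
    and split: "\<And>x y. x \<in> carrier Q \<Longrightarrow> y \<in> carrier Q \<Longrightarrow> f (x \<otimes> y) = (\<Sum>j<N. u j x * w j y)"
    and x: "x \<in> carrier Q"
  shows "D f x = (\<Sum>j<N. u j x * D (w j) \<one>)"
proof -
  have "left_translate Q (inv x) f = (\<lambda>y. \<Sum>j<N. u j x * w j y)"
    using split x w by (auto simp: left_translate_def on_group_def fun_eq_iff coordinate_ring_outside)
  then show ?thesis unfolding Lie_at_one[OF D f x] using Lie_sum[OF D, of "{..<N}" w] w by simp
qed

lemma Lie_eqI:
  assumes D: "D \<in> Lie Q" and E: "E \<in> Lie Q" and eq: "\<And>f. f \<in> \<O> \<Longrightarrow> D f \<one> = E f \<one>"
  shows "D = E"
proof
  fix f
  show "D f = E f"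
  proof (cases "f \<in> \<O>")
    case True
    show ?thesis
      by (rule coordinate_ring_eqI[OF LieD(1)[OF D True] LieD(1)[OF E True]])
        (simp add: Lie_at_one[OF D True] Lie_at_one[OF E True] eq left_translate_closed True)
  qed (simp add: LieD(2)[OF D] LieD(2)[OF E])
qed

definition coordinate :: "'n \<Rightarrow> 'k ^ 'n \<Rightarrow> 'k" where
  "coordinate i = on_group Q (\<lambda>x. x $ i)"

lemma coordinate_closed: "coordinate i \<in> \<O>"
  unfolding coordinate_def by (intro coordinate_ringI poly_funs.gen) (auto simp: coords_def)

text \<open>A left invariant derivation is known from its values at the identity, and these obey the
  Leibniz rule, so the coordinates suffice. This is what makes \<open>Lie Q\<close> finite
  dimensional.\<close>

lemma Lie_eq_coordinates:
  assumes D: "D \<in> Lie Q" and E: "E \<in> Lie Q"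
    and eq: "\<And>i. D (coordinate i) \<one> = E (coordinate i) \<one>"
  shows "D = E"
proof (rule Lie_eqI[OF D E])
  fix f assume "f \<in> \<O>"
  then obtain p where p: "p \<in> poly_funs coords" "f = on_group Q p" unfolding coordinate_ring_def by blast
  have "D (on_group Q p) \<one> = E (on_group Q p) \<one>"
    using p(1)
  proof induction
    case (gen p)
    then show ?case using eq unfolding coords_def coordinate_def by auto
  next
    case (const c)
    show ?case by (simp add: Lie_const[OF D] Lie_const[OF E])
  next
    case (add p q)
    have 1: "on_group Q (\<lambda>x. p x + q x) = on_group Q p + on_group Q q"
      by (auto simp: on_group_def fun_eq_iff)
    note cl = coordinate_ringI[OF add.hyps(1)] coordinate_ringI[OF add.hyps(2)]
    have "D (on_group Q (\<lambda>x. p x + q x)) = D (on_group Q p) + D (on_group Q q)"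
      "E (on_group Q (\<lambda>x. p x + q x)) = E (on_group Q p) + E (on_group Q q)"
      unfolding 1 by (rule LieD(3)[OF D cl] LieD(3)[OF E cl])+
    then show ?case by (simp add: add.IH)
  next
    case (mult p q)
    have 1: "on_group Q (\<lambda>x. p x * q x) = on_group Q p * on_group Q q"
      by (auto simp: on_group_def fun_eq_iff)
    note cl = coordinate_ringI[OF mult.hyps(1)] coordinate_ringI[OF mult.hyps(2)]
    have "D (on_group Q (\<lambda>x. p x * q x)) = D (on_group Q p) * on_group Q q + on_group Q p * D (on_group Q q)"
      "E (on_group Q (\<lambda>x. p x * q x)) = E (on_group Q p) * on_group Q q + on_group Q p * E (on_group Q q)"
      unfolding 1 by (rule LieD(5)[OF D cl] LieD(5)[OF E cl])+
    then show ?case by (simp add: mult.IH)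
  qed
  then show "D f \<one> = E f \<one>" by (simp add: p(2))
qed

text \<open>The \<open>e i\<close> span \<open>Lie Q\<close> but need not be linearly independent.\<close>

lemma Lie_spanning_family:
  obtains e where "\<And>i. e i \<in> Lie Q"
    "\<And>D. D \<in> Lie Q \<Longrightarrow> D = (\<Sum>i\<in>UNIV. scale_op (D (coordinate i) \<one>) (e i))"
proof -
  define \<kappa> :: "('k, 'n) operator \<Rightarrow> 'k ^ 'n" where "\<kappa> D = (\<chi> i. D (coordinate i) \<one>)" for D
  interpret P: vector_space_pair "scale_op :: 'k \<Rightarrow> ('k, 'n) operator \<Rightarrow> _" "(*s) :: 'k \<Rightarrow> 'k ^ 'n \<Rightarrow> _"
    by unfold_locales
  have lin: "Vector_Spaces.linear scale_op (*s) \<kappa>"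
    by unfold_locales (auto simp: \<kappa>_def scale_op_def vec_eq_iff)
  have inj: "inj_on \<kappa> (Lie Q)"
    by (rule inj_onI, rule Lie_eq_coordinates) (auto simp: \<kappa>_def vec_eq_iff)
  \<comment> \<open>A linear retraction onto \<open>Lie Q\<close> along the embedding
    \<open>\<kappa>\<close>; it carries the standard basis to a spanning family.\<close>
  obtain g where g: "range g \<subseteq> Lie Q" "Vector_Spaces.linear (*s) scale_op g" "\<And>D. D \<in> Lie Q \<Longrightarrow> g (\<kappa> D) = D"
    using P.linear_exists_left_inverse_on[OF lin lie.subspace_L inj] by blast
  interpret g: Vector_Spaces.linear "(*s)" scale_op g by fact
  show ?thesis
  proof (rule that[of "\<lambda>i. g (axis i 1)"])
    show "g (axis i 1) \<in> Lie Q" for i using g(1) by blast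
    fix D assume D: "D \<in> Lie Q"
    have "D = g (\<Sum>i\<in>UNIV. \<kappa> D $ i *s axis i 1)" using g(3)[OF D] by (simp add: basis_expansion)
    also have "\<dots> = (\<Sum>i\<in>UNIV. scale_op (D (coordinate i) \<one>) (g (axis i 1)))"
      by (simp add: g.sum g.scale \<kappa>_def)
    finally show "D = (\<Sum>i\<in>UNIV. scale_op (D (coordinate i) \<one>) (g (axis i 1)))" .
  qed
qed

section \<open>The adjoint action\<close>

abbreviation Int_pb :: "'k ^ 'n \<Rightarrow> ('k ^ 'n \<Rightarrow> 'k) \<Rightarrow> 'k ^ 'n \<Rightarrow> 'k" where
  "Int_pb \<equiv> Int_pullback Q"

lemma Int_pullback_apply:
  "a \<in> carrier Q \<Longrightarrow> x \<in> carrier Q \<Longrightarrow> Int_pb a f x = f (a \<otimes> x \<otimes> inv a)"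
  by (simp add: Int_pullback_def)

lemma Int_pullback_closed:
  assumes "f \<in> \<O>" "a \<in> carrier Q"
  shows "Int_pb a f \<in> \<O>"
proof -
  have "on_group Q (\<lambda>x. on_group Q (\<lambda>x. f (x \<otimes> inv a)) (a \<otimes> x)) \<in> \<O>"
    using assms by (intro coordinate_ring_translate) auto
  moreover have "on_group Q (\<lambda>x. on_group Q (\<lambda>x. f (x \<otimes> inv a)) (a \<otimes> x)) = Int_pb a f"
    using assms(2) by (auto simp: Int_pullback_def on_group_def fun_eq_iff)
  ultimately show ?thesis by simp
qed

lemma Int_pullback_add: "Int_pb a (f + g) = Int_pb a f + Int_pb a g"
  and Int_pullback_diff: "Int_pb a (f - g) = Int_pb a f - Int_pb a g"
  and Int_pullback_mult: "Int_pb a (f * g) = Int_pb a f * Int_pb a g"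
  and Int_pullback_scale: "Int_pb a (\<lambda>x. c * f x) = (\<lambda>x. c * Int_pb a f x)"
  by (auto simp: Int_pullback_def on_group_def fun_eq_iff)

lemma Int_pullback_compose:
  assumes "a \<in> carrier Q" "b \<in> carrier Q"
  shows "Int_pb b (Int_pb a f) = Int_pb (a \<otimes> b) f"
  using assms by (auto simp: Int_pullback_def on_group_def fun_eq_iff inv_mult_group m_assoc)

lemma Int_pullback_one: "f \<in> \<O> \<Longrightarrow> Int_pb \<one> f = f"
  by (auto simp: Int_pullback_def on_group_def fun_eq_iff coordinate_ring_outside)

lemma Int_pullback_inv:
  assumes "f \<in> \<O>" "a \<in> carrier Q"
  shows "Int_pb a (Int_pb (inv a) f) = f" "Int_pb (inv a) (Int_pb a f) = f"
  using assms by (simp_all add: Int_pullback_compose Int_pullback_one)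

text \<open>Conjugation normalises the left translations; hence \<open>Ad\<close> preserves left
  invariance.\<close>

lemma Int_pullback_left_translate:
  assumes "a \<in> carrier Q" "b \<in> carrier Q"
  shows "Int_pb a (left_translate Q b f) = left_translate Q (inv a \<otimes> b \<otimes> a) (Int_pb a f)"
proof
  fix x
  show "Int_pb a (left_translate Q b f) x = left_translate Q (inv a \<otimes> b \<otimes> a) (Int_pb a f) x"
  proof (cases "x \<in> carrier Q")
    case True
    have "a \<otimes> (inv (inv a \<otimes> b \<otimes> a) \<otimes> x) \<otimes> inv a = inv b \<otimes> (a \<otimes> x \<otimes> inv a)"
      using assms True by (simp add: inv_mult_group m_assoc[symmetric])
    then show ?thesis using assms True by (simp add: Int_pullback_apply left_translate_apply)
  qed (simp add: Int_pullback_def left_translate_def)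
qed

lemma Ad_apply: "f \<in> \<O> \<Longrightarrow> Ad Q g D f = Int_pb (inv g) (D (Int_pb g f))"
  by (simp add: Ad_def)

lemma Ad_closed:
  assumes g: "g \<in> carrier Q" and D: "D \<in> Lie Q"
  shows "Ad Q g D \<in> Lie Q"
  unfolding Lie_def mem_Collect_eq
proof (intro conjI ballI allI impI)
  have cl: "Int_pb g f \<in> \<O>" if "f \<in> \<O>" for f using Int_pullback_closed that g by blast
  fix f assume f: "f \<in> \<O>"
  show "Ad Q g D f \<in> \<O>"
    unfolding Ad_apply[OF f] by (intro Int_pullback_closed Lie_apply_closed[OF D] inv_closed g)
  show "Ad Q g D (\<lambda>x. c * f x) = (\<lambda>x. c * Ad Q g D f x)" for c
    unfolding Ad_apply[OF f] Ad_apply[OF coordinate_ring_scale[OF f]] Int_pullback_scale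
      LieD(4)[OF D cl[OF f]] ..
  fix h assume h: "h \<in> \<O>"
  show "Ad Q g D (f + h) = Ad Q g D f + Ad Q g D h"
    unfolding Ad_apply[OF f] Ad_apply[OF h] Ad_apply[OF coordinate_ring_add[OF f h]] Int_pullback_add
      LieD(3)[OF D cl[OF f] cl[OF h]] ..
  show "Ad Q g D (f * h) = Ad Q g D f * h + f * Ad Q g D h"
    unfolding Ad_apply[OF f] Ad_apply[OF h] Ad_apply[OF coordinate_ring_mult[OF f h]] Int_pullback_add
      Int_pullback_mult LieD(5)[OF D cl[OF f] cl[OF h]] Int_pullback_inv[OF f g] Int_pullback_inv[OF h g] ..
next
  fix f assume "f \<notin> \<O>"
  then show "Ad Q g D f = 0" by (simp add: Ad_def)
next
  fix a f assume a: "a \<in> carrier Q" and f: "f \<in> \<O>"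
  have c: "inv g \<otimes> a \<otimes> g \<in> carrier Q" using a g by simp
  have "g \<otimes> (inv g \<otimes> a \<otimes> g) \<otimes> inv g = a"
    using a g by (simp add: m_assoc[symmetric]) (simp add: m_assoc)
  then show "Ad Q g D (left_translate Q a f) = left_translate Q a (Ad Q g D f)"
    unfolding Ad_apply[OF f] Ad_apply[OF left_translate_closed[OF f a]]
      Int_pullback_left_translate[OF g a] LieD(6)[OF D c Int_pullback_closed[OF f g]]
      Int_pullback_left_translate[OF inv_closed[OF g] c] using g by simp
qed

lemma Ad_zero: "Ad Q g 0 = 0"
  by (auto simp: Ad_def fun_eq_iff Int_pullback_def on_group_def)

lemma Ad_add: "Ad Q g (D + E) = Ad Q g D + Ad Q g E"
  by (auto simp: Ad_def fun_eq_iff Int_pullback_def on_group_def)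

lemma Ad_scale: "Ad Q g (scale_op c D) = scale_op c (Ad Q g D)"
  by (auto simp: Ad_def fun_eq_iff Int_pullback_def on_group_def scale_op_def)

lemma Ad_mult:
  assumes g: "g \<in> carrier Q" and h: "h \<in> carrier Q"
  shows "Ad Q g (Ad Q h D) = Ad Q (g \<otimes> h) D"
proof
  fix f
  show "Ad Q g (Ad Q h D) f = Ad Q (g \<otimes> h) D f"
  proof (cases "f \<in> \<O>")
    case True
    then show ?thesis
      using g h
      by (simp add: Ad_apply Int_pullback_closed Int_pullback_compose inv_mult_group)
  qed (simp add: Ad_def)
qed

lemma Ad_one: "D \<in> Lie Q \<Longrightarrow> Ad Q \<one> D = D"
  by (rule ext) (auto simp: Ad_def Int_pullback_one Lie_apply_closed LieD(2))

lemma Ad_inv: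
  assumes "g \<in> carrier Q" "D \<in> Lie Q"
  shows "Ad Q g (Ad Q (inv g) D) = D" "Ad Q (inv g) (Ad Q g D) = D"
  using assms by (simp_all add: Ad_mult Ad_one)

lemma Ad_commutator:
  assumes g: "g \<in> carrier Q" and D: "D \<in> Lie Q" and E: "E \<in> Lie Q"
  shows "Ad Q g (commutator D E) = commutator (Ad Q g D) (Ad Q g E)"
proof
  fix f
  show "Ad Q g (commutator D E) f = commutator (Ad Q g D) (Ad Q g E) f"
  proof (cases "f \<in> \<O>")
    case True
    have 1: "Int_pb g f \<in> \<O>" by (rule Int_pullback_closed[OF True g])
    have "Ad Q g X (Ad Q g Y f) = Int_pb (inv g) (X (Y (Int_pb g f)))" if "Y \<in> Lie Q" for X Y
      using LieD(1)[OF that 1] g True by (simp add: Ad_apply Int_pullback_closed Int_pullback_inv)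
    then show ?thesis using D E True by (simp add: Ad_apply commutator_def Int_pullback_diff)
  next
    case False
    then have "Ad Q g D f = 0" "Ad Q g E f = 0" "Ad Q g (commutator D E) f = 0" by (simp_all add: Ad_def)
    then show ?thesis
      by (simp only: commutator_def Lie_apply_zero[OF Ad_closed[OF g D]]
          Lie_apply_zero[OF Ad_closed[OF g E]] diff_self)
  qed
qed

lemma Ad_at_one: "g \<in> carrier Q \<Longrightarrow> f \<in> \<O> \<Longrightarrow> Ad Q g D f \<one> = D (Int_pb g f) \<one>"
  by (simp add: Ad_apply Int_pullback_apply)

section \<open>The coadjoint action\<close>

definition coadjoint :: "'k ^ 'n \<Rightarrow> (('k, 'n) operator \<Rightarrow> 'k) \<Rightarrow> ('k, 'n) operator \<Rightarrow> 'k" where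
  "coadjoint g w = (\<lambda>\<eta>. if \<eta> \<in> Lie Q then w (Ad Q (inv g) \<eta>) else 0)"

lemma coadjoint_dual:
  assumes "g \<in> carrier Q" "w \<in> lie.dual"
  shows "coadjoint g w \<in> lie.dual"
  using assms lie.dualD(1,2)[OF assms(2)]
  by (auto simp: lie.dual_def coadjoint_def Lie_add Lie_scale Ad_add Ad_scale Ad_closed)

lemma coadjoint_inv:
  assumes "g \<in> carrier Q" "w \<in> lie.dual"
  shows "coadjoint g (coadjoint (inv g) w) = w"
  using assms lie.dualD(3)[OF assms(2)] by (auto simp: coadjoint_def fun_eq_iff Ad_closed Ad_inv)

lemma stabiliser_coadjoint:
  assumes g: "g \<in> carrier Q" and w: "w \<in> lie.dual"
  shows "lie.stabiliser (coadjoint g w) = Ad Q g ` lie.stabiliser w"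
proof -
  have sub: "Ad Q g ` lie.stabiliser w \<subseteq> lie.stabiliser (coadjoint g w)" if g: "g \<in> carrier Q" for g w
  proof
    fix D' assume "D' \<in> Ad Q g ` lie.stabiliser w"
    then obtain D where D: "D' = Ad Q g D" "D \<in> Lie Q" "\<And>\<eta>. \<eta> \<in> Lie Q \<Longrightarrow> w (commutator D \<eta>) = 0"
      by (auto simp: lie.stabiliser_def)
    have "coadjoint g w (commutator D' \<eta>) = 0" if \<eta>: "\<eta> \<in> Lie Q" for \<eta>
    proof -
      have "Ad Q (inv g) (commutator D' \<eta>) = commutator D (Ad Q (inv g) \<eta>)"
        using g D(2) \<eta> by (simp add: D(1) Ad_commutator Ad_closed Ad_inv)
      then show ?thesis using D(3)[OF Ad_closed[OF inv_closed[OF g] \<eta>]] by (simp add: coadjoint_def)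
    qed
    then show "D' \<in> lie.stabiliser (coadjoint g w)"
      using D Ad_closed[OF g] by (simp add: lie.stabiliser_def)
  qed
  have "lie.stabiliser (coadjoint g w) \<subseteq> Ad Q g ` lie.stabiliser w"
  proof
    fix D assume D: "D \<in> lie.stabiliser (coadjoint g w)"
    then have "Ad Q (inv g) D \<in> lie.stabiliser (coadjoint (inv g) (coadjoint g w))"
      using sub[OF inv_closed[OF g]] by blast
    then have "Ad Q (inv g) D \<in> lie.stabiliser w"
      using coadjoint_inv[OF inv_closed[OF g] w] g by simp
    moreover have "D = Ad Q g (Ad Q (inv g) D)" using D g by (simp add: lie.stabiliser_def Ad_inv)
    ultimately show "D \<in> Ad Q g ` lie.stabiliser w" by blast
  qed
  with sub[OF g] show ?thesis by blast
qed

section \<open>Derivative of the adjoint orbit map\<close>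

lemma Lie_sum_mult:
  assumes D: "D \<in> Lie Q" and f: "\<And>i. i \<in> J \<Longrightarrow> f i \<in> \<O>" and h: "\<And>i. i \<in> J \<Longrightarrow> h i \<in> \<O>"
  shows "D (\<lambda>x. \<Sum>i\<in>J. f i x * h i x) y = (\<Sum>i\<in>J. D (f i) y * h i y + f i y * D (h i) y)"
proof -
  have "D (\<lambda>x. \<Sum>i\<in>J. 1 * (f i * h i) x) = (\<lambda>x. \<Sum>i\<in>J. 1 * D (f i * h i) x)"
    using f h by (intro Lie_sum[OF D] coordinate_ring_mult)
  then have "D (\<lambda>x. \<Sum>i\<in>J. f i x * h i x) y = (\<Sum>i\<in>J. D (f i * h i) y)" by simp
  also have "\<dots> = (\<Sum>i\<in>J. D (f i) y * h i y + f i y * D (h i) y)"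
    using f h by (intro sum.cong) (simp_all add: LieD(5)[OF D])
  finally show ?thesis .
qed

text \<open>Differentiate the constant \<open>f (x \<otimes> inv x)\<close> at the identity, with
  \<open>f (x \<otimes> y)\<close> split into a sum of products.\<close>

lemma Lie_inverse:
  assumes D: "D \<in> Lie Q" and f: "f \<in> \<O>"
  shows "D (on_group Q (\<lambda>x. f (inv x))) \<one> = - D f \<one>"
proof -
  obtain N :: nat and u w where uw: "\<And>j. j < N \<Longrightarrow> u j \<in> \<O>" "\<And>j. j < N \<Longrightarrow> w j \<in> \<O>"
    "\<And>x y. x \<in> carrier Q \<Longrightarrow> y \<in> carrier Q \<Longrightarrow> f (x \<otimes> y) = (\<Sum>j<N. u j x * w j y)"
    using comultiplication[OF f] by blast
  define V where "V j = on_group Q (\<lambda>x. w j (inv x))" for j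
  have V: "V j \<in> \<O>" if "j < N" for j unfolding V_def by (rule coordinate_ring_inv[OF uw(2)[OF that]])
  have "on_group Q (\<lambda>_. f \<one>) = (\<lambda>x. \<Sum>j<N. u j x * V j x)"
  proof
    fix x show "on_group Q (\<lambda>_. f \<one>) x = (\<Sum>j<N. u j x * V j x)"
      using uw(3)[of x "inv x"] by (cases "x \<in> carrier Q") (simp_all add: V_def)
  qed
  then have "(\<Sum>j<N. D (u j) \<one> * V j \<one> + u j \<one> * D (V j) \<one>) = 0"
    using Lie_sum_mult[OF D, of "{..<N}" u V \<one>] uw(1) V Lie_const[OF D, of "f \<one>"] by simp
  moreover have "D f \<one> = (\<Sum>j<N. w j \<one> * D (u j) \<one>)"
  proof -
    have "f = (\<lambda>x. \<Sum>j<N. w j \<one> * u j x)"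
    proof
      fix x show "f x = (\<Sum>j<N. w j \<one> * u j x)"
        using uw(3)[of x \<one>] uw(1) f
        by (cases "x \<in> carrier Q") (simp_all add: coordinate_ring_outside mult.commute)
    qed
    then show ?thesis using Lie_sum[OF D, of "{..<N}" u "\<lambda>j. w j \<one>"] uw(1) by simp
  qed
  moreover have "D (on_group Q (\<lambda>x. f (inv x))) \<one> = (\<Sum>j<N. u j \<one> * D (V j) \<one>)"
  proof -
    have "on_group Q (\<lambda>x. f (inv x)) = (\<lambda>x. \<Sum>j<N. u j \<one> * V j x)"
    proof
      fix x show "on_group Q (\<lambda>x. f (inv x)) x = (\<Sum>j<N. u j \<one> * V j x)"
        using uw(3)[of \<one> "inv x"] by (cases "x \<in> carrier Q") (simp_all add: V_def)
    qed
    then show ?thesis using Lie_sum[OF D, of "{..<N}" V "\<lambda>j. u j \<one>"] V by simp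
  qed
  ultimately show ?thesis
    by (simp add: sum.distrib V_def mult.commute eq_neg_iff_add_eq_0 add.commute)
qed

text \<open>In the comultiplication of \<open>w\<close>, the derivation \<open>\<eta>\<close>
  differentiates the left factor and \<open>D\<close> the right one. The same happens in
  \<open>\<eta> (D w)\<close> at the identity, which fixes the order of the composition.\<close>

lemma right_translate_derivative:
  assumes D: "D \<in> Lie Q" and \<eta>: "\<eta> \<in> Lie Q" and w: "w \<in> \<O>"
  defines "W \<equiv> on_group Q (\<lambda>x. \<eta> (on_group Q (\<lambda>y. w (y \<otimes> x))) \<one>)"
  shows "W \<in> \<O>" "W \<one> = \<eta> w \<one>" "D W \<one> = \<eta> (D w) \<one>"
proof -
  obtain N :: nat and p q where pq: "\<And>j. j < N \<Longrightarrow> p j \<in> \<O>" "\<And>j. j < N \<Longrightarrow> q j \<in> \<O>"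
    "\<And>x y. x \<in> carrier Q \<Longrightarrow> y \<in> carrier Q \<Longrightarrow> w (x \<otimes> y) = (\<Sum>j<N. p j x * q j y)"
    using comultiplication[OF w] by blast
  have R: "on_group Q (\<lambda>y. w (y \<otimes> x)) = (\<lambda>y. \<Sum>j<N. q j x * p j y)" if "x \<in> carrier Q" for x
  proof
    fix y show "on_group Q (\<lambda>y. w (y \<otimes> x)) y = (\<Sum>j<N. q j x * p j y)"
      using pq that by (cases "y \<in> carrier Q") (simp_all add: coordinate_ring_outside mult.commute)
  qed
  have W: "W = (\<lambda>x. \<Sum>j<N. \<eta> (p j) \<one> * q j x)"
  proof
    fix x show "W x = (\<Sum>j<N. \<eta> (p j) \<one> * q j x)"
    proof (cases "x \<in> carrier Q")
      case True
      then show ?thesis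
        unfolding W_def using Lie_sum[OF \<eta>, of "{..<N}" p "\<lambda>j. q j x"] pq(1)
        by (simp add: R mult.commute)
    qed (use pq(2) in \<open>simp add: W_def coordinate_ring_outside\<close>)
  qed
  show "W \<in> \<O>" unfolding W using pq(2) by (intro coordinate_ring_sum coordinate_ring_scale) auto
  have "on_group Q (\<lambda>y. w (y \<otimes> \<one>)) = w"
    using w by (auto simp: on_group_def fun_eq_iff coordinate_ring_outside)
  then show "W \<one> = \<eta> w \<one>" by (simp add: W_def)
  have "D w = (\<lambda>y. \<Sum>j<N. D (q j) \<one> * p j y)"
  proof
    fix y show "D w y = (\<Sum>j<N. D (q j) \<one> * p j y)"
      using Lie_comultiplication[OF D w, of N q p y] pq coordinate_ring_outside[OF Lie_apply_closed[OF D]]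
      by (cases "y \<in> carrier Q") (simp_all add: mult.commute coordinate_ring_outside)
  qed
  then show "D W \<one> = \<eta> (D w) \<one>"
    unfolding W using Lie_sum[OF \<eta>, of "{..<N}" p "\<lambda>j. D (q j) \<one>"]
      Lie_sum[OF D, of "{..<N}" q "\<lambda>j. \<eta> (p j) \<one>"] pq(1,2)
    by (simp add: mult.commute)
qed

text \<open>The function differentiated by \<open>\<eta>\<close> is \<open>f\<close> at
  \<open>inv x \<otimes> (y \<otimes> x)\<close>. Splitting \<open>f\<close> once separates the
  factor with \<open>inv x\<close>, which contributes \<open>- D (\<eta> f)\<close>, from the right
  translation by \<open>x\<close>, which contributes \<open>\<eta> (D f)\<close>.\<close>

lemma Ad_orbit_derivative_at_one:
  assumes D: "D \<in> Lie Q" and \<eta>: "\<eta> \<in> Lie Q" and f: "f \<in> \<O>"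
  defines "F \<equiv> on_group Q (\<lambda>x. Ad Q (inv x) \<eta> f \<one>)"
  shows "F \<in> \<O>" "D F \<one> = - commutator D \<eta> f \<one>"
proof -
  obtain N :: nat and u w where uw: "\<And>j. j < N \<Longrightarrow> u j \<in> \<O>" "\<And>j. j < N \<Longrightarrow> w j \<in> \<O>"
    "\<And>x y. x \<in> carrier Q \<Longrightarrow> y \<in> carrier Q \<Longrightarrow> f (x \<otimes> y) = (\<Sum>j<N. u j x * w j y)"
    using comultiplication[OF f] by blast
  define U where "U j = on_group Q (\<lambda>x. u j (inv x))" for j
  define W where "W j = on_group Q (\<lambda>x. \<eta> (on_group Q (\<lambda>y. w j (y \<otimes> x))) \<one>)" for j
  have U: "U j \<in> \<O>" "U j \<one> = u j \<one>" "D (U j) \<one> = - D (u j) \<one>" if "j < N" for j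
    unfolding U_def using coordinate_ring_inv[OF uw(1)[OF that]] Lie_inverse[OF D uw(1)[OF that]] by simp_all
  have W: "W j \<in> \<O>" "W j \<one> = \<eta> (w j) \<one>" "D (W j) \<one> = \<eta> (D (w j)) \<one>" if "j < N" for j
    unfolding W_def using right_translate_derivative[OF D \<eta> uw(2)[OF that]] by simp_all
  have F: "F = (\<lambda>x. \<Sum>j<N. U j x * W j x)"
  proof
    fix x show "F x = (\<Sum>j<N. U j x * W j x)"
    proof (cases "x \<in> carrier Q")
      case True
      have "Int_pb (inv x) f = (\<lambda>y. \<Sum>j<N. u j (inv x) * on_group Q (\<lambda>y. w j (y \<otimes> x)) y)"
      proof
        fix y show "Int_pb (inv x) f y = (\<Sum>j<N. u j (inv x) * on_group Q (\<lambda>y. w j (y \<otimes> x)) y)"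
          using True uw(3)[of "inv x" "y \<otimes> x"]
          by (cases "y \<in> carrier Q") (simp_all add: Int_pullback_apply m_assoc, simp add: Int_pullback_def)
      qed
      then have "\<eta> (Int_pb (inv x) f) \<one> = (\<Sum>j<N. U j x * W j x)"
        using Lie_sum[OF \<eta>, of "{..<N}" "\<lambda>j. on_group Q (\<lambda>y. w j (y \<otimes> x))" "\<lambda>j. u j (inv x)"]
          uw(2) True by (simp add: coordinate_ring_translate U_def W_def)
      then show ?thesis using True f by (simp add: F_def Ad_at_one)
    qed (simp add: F_def U_def)
  qed
  show "F \<in> \<O>"
    unfolding F using coordinate_ring_sum[of "{..<N}" "\<lambda>j. U j * W j"] U(1) W(1) coordinate_ring_mult by simp
  have "D F \<one> = (\<Sum>j<N. - (D (u j) \<one> * \<eta> (w j) \<one>)) + (\<Sum>j<N. u j \<one> * \<eta> (D (w j)) \<one>)"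
    unfolding F using Lie_sum_mult[OF D, of "{..<N}" U W \<one>] U W
    by (simp add: sum.distrib[symmetric])
  moreover have "D (\<eta> f) \<one> = (\<Sum>j<N. D (u j) \<one> * \<eta> (w j) \<one>)"
  proof -
    have "\<eta> f = (\<lambda>y. \<Sum>j<N. \<eta> (w j) \<one> * u j y)"
    proof
      fix y show "\<eta> f y = (\<Sum>j<N. \<eta> (w j) \<one> * u j y)"
        using Lie_comultiplication[OF \<eta> f, of N w u y] uw coordinate_ring_outside[OF Lie_apply_closed[OF \<eta>]]
        by (cases "y \<in> carrier Q") (simp_all add: mult.commute coordinate_ring_outside)
    qed
    then show ?thesis using Lie_sum[OF D, of "{..<N}" u "\<lambda>j. \<eta> (w j) \<one>"] uw(1) by (simp add: mult.commute)
  qed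
  moreover have "\<eta> (D f) \<one> = (\<Sum>j<N. u j \<one> * \<eta> (D (w j)) \<one>)"
  proof -
    have "f = (\<lambda>y. \<Sum>j<N. u j \<one> * w j y)"
    proof
      fix y show "f y = (\<Sum>j<N. u j \<one> * w j y)"
        using uw(3)[of \<one> y] uw(2) f by (cases "y \<in> carrier Q") (simp_all add: coordinate_ring_outside)
    qed
    then have "D f = (\<lambda>y. \<Sum>j<N. u j \<one> * D (w j) y)"
      using Lie_sum[OF D, of "{..<N}" w "\<lambda>j. u j \<one>"] uw(2) by simp
    then show ?thesis
      using Lie_sum[OF \<eta>, of "{..<N}" "\<lambda>j. D (w j)" "\<lambda>j. u j \<one>"] Lie_apply_closed[OF D] by simp
  qed
  ultimately show "D F \<one> = - commutator D \<eta> f \<one>"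
    by (simp add: commutator_def sum_negf)
qed

text \<open>Left translation to the identity replaces \<open>\<eta>\<close> by
  \<open>Ad Q (inv g) \<eta>\<close> in the orbit function.\<close>

lemma Ad_orbit_derivative:
  assumes D: "D \<in> Lie Q" and \<eta>: "\<eta> \<in> Lie Q" and f: "f \<in> \<O>" and g: "g \<in> carrier Q"
  shows "D (on_group Q (\<lambda>x. Ad Q (inv x) \<eta> f \<one>)) g = - commutator D (Ad Q (inv g) \<eta>) f \<one>"
proof -
  let ?F = "on_group Q (\<lambda>x. Ad Q (inv x) \<eta> f \<one>)"
  have "left_translate Q (inv g) ?F = on_group Q (\<lambda>x. Ad Q (inv x) (Ad Q (inv g) \<eta>) f \<one>)"
    using g by (auto simp: left_translate_def on_group_def fun_eq_iff Ad_mult inv_mult_group)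
  then show ?thesis
    using Lie_at_one[OF D Ad_orbit_derivative_at_one(1)[OF D \<eta> f] g]
      Ad_orbit_derivative_at_one(2)[OF D Ad_closed[OF inv_closed[OF g] \<eta>] f] by simp
qed

text \<open>The tangent vector \<open>\<epsilon>\<close> at \<open>g\<close> is spread over the
  group by left translation: for the value at \<open>x\<close>, \<open>f\<close> is translated so
  that \<open>x\<close> is moved to \<open>g\<close>. Comultiplication shows that the result is
  regular. This is how the tangent part of a lifted dual point becomes an element of
  \<open>Lie Q\<close>.\<close>

lemma point_derivation_extends:
  assumes g: "g \<in> carrier Q"
    and add: "\<And>f h. f \<in> \<O> \<Longrightarrow> h \<in> \<O> \<Longrightarrow> \<epsilon> (f + h) = \<epsilon> f + \<epsilon> h"
    and scale: "\<And>f c. f \<in> \<O> \<Longrightarrow> \<epsilon> (\<lambda>x. c * f x) = c * \<epsilon> f"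
    and mult: "\<And>f h. f \<in> \<O> \<Longrightarrow> h \<in> \<O> \<Longrightarrow> \<epsilon> (f * h) = f g * \<epsilon> h + \<epsilon> f * h g"
  obtains D where "D \<in> Lie Q" "\<And>f. f \<in> \<O> \<Longrightarrow> D f g = \<epsilon> f"
proof -
  define D where "D f = (if f \<in> \<O> then on_group Q (\<lambda>x. \<epsilon> (left_translate Q (g \<otimes> inv x) f)) else 0)" for f
  have zero: "\<epsilon> 0 = 0" using scale[OF coordinate_ring_zero, of 0] by (simp add: zero_fun_def)
  have sum: "\<epsilon> (\<lambda>x. \<Sum>j\<in>J. c j * f j x) = (\<Sum>j\<in>J. c j * \<epsilon> (f j))"
    if "\<And>j. j \<in> J \<Longrightarrow> f j \<in> \<O>" for J :: "nat set" and c f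
    using that
  proof (induction J rule: infinite_finite_induct)
    case (insert j J)
    have 1: "(\<lambda>x. c j * f j x) \<in> \<O>" "(\<lambda>x. \<Sum>i\<in>J. c i * f i x) \<in> \<O>"
      using insert.prems by (auto intro!: coordinate_ring_sum coordinate_ring_scale)
    have "(\<lambda>x. \<Sum>i\<in>insert j J. c i * f i x) = (\<lambda>x. c j * f j x) + (\<lambda>x. \<Sum>i\<in>J. c i * f i x)"
      using insert.hyps by (simp add: fun_eq_iff)
    then show ?case using add[OF 1] scale insert by simp
  qed (use zero in \<open>simp_all add: zero_fun_def\<close>)
  have lt: "left_translate Q (g \<otimes> inv x) f \<in> \<O>" if "f \<in> \<O>" "x \<in> carrier Q" for f x
    using left_translate_closed that g by simp
  have lt_g: "left_translate Q (g \<otimes> inv x) f g = f x" if "x \<in> carrier Q" for f x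
    using that g by (simp add: left_translate_apply inv_mult_group m_assoc)
  have "D \<in> Lie Q"
    unfolding Lie_def mem_Collect_eq
  proof (intro conjI ballI allI impI)
    fix f assume f: "f \<in> \<O>"
    obtain N :: nat and u w where uw: "\<And>j. j < N \<Longrightarrow> u j \<in> \<O>" "\<And>j. j < N \<Longrightarrow> w j \<in> \<O>"
      "\<And>x y. x \<in> carrier Q \<Longrightarrow> y \<in> carrier Q \<Longrightarrow> f (x \<otimes> y) = (\<Sum>j<N. u j x * w j y)"
      using comultiplication[OF f] by blast
    have "D f x = (\<Sum>j<N. \<epsilon> (left_translate Q g (w j)) * u j x)" if x: "x \<in> carrier Q" for x
    proof -
      have "left_translate Q (g \<otimes> inv x) f = (\<lambda>y. \<Sum>j<N. u j x * left_translate Q g (w j) y)"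
        using uw(3) x g by (auto simp: left_translate_def on_group_def fun_eq_iff inv_mult_group m_assoc)
      then show ?thesis
        using sum[of "{..<N}" "\<lambda>j. left_translate Q g (w j)" "\<lambda>j. u j x"] uw(2) left_translate_closed g f x
        by (simp add: D_def mult.commute)
    qed
    moreover have "(\<lambda>x. \<Sum>j<N. \<epsilon> (left_translate Q g (w j)) * u j x) \<in> \<O>"
      using uw(1) by (intro coordinate_ring_sum coordinate_ring_scale) auto
    ultimately have "on_group Q (D f) \<in> \<O>" by (intro coordinate_ring_cong) auto
    moreover have "on_group Q (D f) = D f" using f by (auto simp: D_def on_group_def fun_eq_iff)
    ultimately show "D f \<in> \<O>" by simp
    show "D (\<lambda>x. c * f x) = (\<lambda>x. c * D f x)" for c
      using f scale[OF lt[OF f]] by (auto simp: D_def coordinate_ring_scale left_translate_scale on_group_def fun_eq_iff)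
    fix h assume h: "h \<in> \<O>"
    show "D (f + h) = D f + D h"
      using f h add[OF lt[OF f] lt[OF h]]
      by (auto simp: D_def coordinate_ring_add left_translate_add on_group_def fun_eq_iff)
    show "D (f * h) = D f * h + f * D h"
      using f h mult[OF lt[OF f] lt[OF h]] lt_g
      by (auto simp: D_def coordinate_ring_mult left_translate_mult on_group_def fun_eq_iff algebra_simps)
  next
    fix f assume "f \<notin> \<O>"
    then show "D f = 0" by (simp add: D_def)
  next
    fix a f assume a: "a \<in> carrier Q" and f: "f \<in> \<O>"
    show "D (left_translate Q a f) = left_translate Q a (D f)"
    proof
      fix x show "D (left_translate Q a f) x = left_translate Q a (D f) x"
      proof (cases "x \<in> carrier Q")
        case True
        have "g \<otimes> inv x \<otimes> a = g \<otimes> inv (inv a \<otimes> x)"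
          using a g True by (simp add: inv_mult_group m_assoc)
        then show ?thesis
          using a f g True left_translate_closed[OF f a]
          by (simp add: left_translate_apply D_def left_translate_compose)
      qed (auto simp: left_translate_def D_def)
    qed
  qed
  moreover have "D f g = \<epsilon> f" if "f \<in> \<O>" for f
    using that g by (simp add: D_def left_translate_one)
  ultimately show ?thesis using that by blast
qed

end

section \<open>The theorem\<close>

context affine_algebraic_group
begin

section \<open>Derivative of the coadjoint orbit map\<close>

lemma Lie_dual_expand:
  assumes e: "\<And>i. e i \<in> Lie Q" "\<And>D. D \<in> Lie Q \<Longrightarrow> D = (\<Sum>i\<in>UNIV. scale_op (D (coordinate i) \<one>) (e i))"
    and w: "w \<in> lie.dual" and D: "D \<in> Lie Q"
  shows "w D = (\<Sum>i\<in>UNIV. D (coordinate i) \<one> * w (e i))"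
proof -
  have "w D = w (\<Sum>i\<in>UNIV. scale_op (D (coordinate i) \<one>) (e i))" using e(2)[OF D] by simp
  also have "\<dots> = (\<Sum>i\<in>UNIV. w (scale_op (D (coordinate i) \<one>) (e i)))"
    by (rule lie.dualD(7)[OF w]) (simp add: Lie_scale e(1))
  also have "\<dots> = (\<Sum>i\<in>UNIV. D (coordinate i) \<one> * w (e i))" by (simp add: lie.dualD(2)[OF w] e(1))
  finally show ?thesis .
qed

lemma commutator_zero_right: "D \<in> Lie Q \<Longrightarrow> commutator D 0 = 0"
  using lie.bracket_scale_right[OF _ Lie_zero, of D 0] by (simp only: lie.scale_zero_left)

text \<open>The velocity at \<open>g\<close> of the orbit of \<open>w\<close> in direction
  \<open>D\<close>. Being a functional, it obeys the sum and product rules for gradients.\<close>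

lemma infinitesimal_coadjoint_dual:
  assumes w: "w \<in> lie.dual" and D: "D \<in> Lie Q" and g: "g \<in> carrier Q"
  shows "(\<lambda>\<xi>. if \<xi> \<in> Lie Q then - w (commutator D (Ad Q (inv g) \<xi>)) else 0) \<in> lie.dual"
proof -
  have cl: "Ad Q (inv g) \<xi> \<in> Lie Q" if "\<xi> \<in> Lie Q" for \<xi> using Ad_closed g that by simp
  then show ?thesis
    using D by (simp add: lie.dual_def Lie_add Lie_scale Ad_add Ad_scale lie.bracket_add_right
        lie.bracket_scale_right lie.dualD[OF w] commutator_closed)
qed

text \<open>For an evaluation, expanding \<open>w\<close> in the spanning family reduces the claim
  to the adjoint orbit functions of the coordinates. Sums and products follow because pairing the
  orbit velocity with gradients satisfies the same rules as the derivation \<open>D\<close>.\<close>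

lemma coadjoint_orbit_chain_rule:
  assumes pP: "lie.gradient p P" and w: "w \<in> lie.dual" and D: "D \<in> Lie Q"
  shows "on_group Q (\<lambda>x. p (coadjoint x w)) \<in> \<O> \<and> (\<forall>g\<in>carrier Q.
    D (on_group Q (\<lambda>x. p (coadjoint x w))) g = - w (commutator D (Ad Q (inv g) (P (coadjoint g w)))))"
  using pP
proof induction
  case (gradient_eval \<eta>)
  obtain e where e: "\<And>i. e i \<in> Lie Q"
    "\<And>D. D \<in> Lie Q \<Longrightarrow> D = (\<Sum>i\<in>UNIV. scale_op (D (coordinate i) \<one>) (e i))"
    using Lie_spanning_family by blast
  define F where "F i = on_group Q (\<lambda>x. Ad Q (inv x) \<eta> (coordinate i) \<one>)" for i
  have F: "F i \<in> \<O>" for i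
    unfolding F_def by (rule Ad_orbit_derivative_at_one(1)[OF D gradient_eval coordinate_closed])
  have eq: "on_group Q (\<lambda>x. coadjoint x w \<eta>) = (\<lambda>x. \<Sum>i\<in>UNIV. w (e i) * F i x)"
  proof
    fix x show "on_group Q (\<lambda>x. coadjoint x w \<eta>) x = (\<Sum>i\<in>UNIV. w (e i) * F i x)"
    proof (cases "x \<in> carrier Q")
      case True
      then show ?thesis
        using Lie_dual_expand[OF e w Ad_closed[OF inv_closed gradient_eval]] gradient_eval
        by (simp add: coadjoint_def F_def mult.commute)
    qed (simp add: F_def)
  qed
  have "D (on_group Q (\<lambda>x. coadjoint x w \<eta>)) g = - w (commutator D (Ad Q (inv g) \<eta>))"
    if g: "g \<in> carrier Q" for g
  proof -
    have "D (on_group Q (\<lambda>x. coadjoint x w \<eta>)) g = (\<Sum>i\<in>UNIV. w (e i) * D (F i) g)"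
      unfolding eq using Lie_sum[OF D, of UNIV F "\<lambda>i. w (e i)"] F by simp
    also have "\<dots> = - (\<Sum>i\<in>UNIV. commutator D (Ad Q (inv g) \<eta>) (coordinate i) \<one> * w (e i))"
      unfolding F_def Ad_orbit_derivative[OF D gradient_eval coordinate_closed g]
      by (simp add: sum_negf mult.commute)
    also have "\<dots> = - w (commutator D (Ad Q (inv g) \<eta>))"
      using Lie_dual_expand[OF e w commutator_closed[OF D Ad_closed[OF inv_closed[OF g] gradient_eval]]]
      by simp
    finally show ?thesis .
  qed
  moreover have "on_group Q (\<lambda>x. coadjoint x w \<eta>) \<in> \<O>"
    unfolding eq using F by (intro coordinate_ring_sum coordinate_ring_scale)
  ultimately show ?case by blast
next
  case (gradient_const c)
  show ?case
    unfolding Ad_zero commutator_zero_right[OF D] lie.dualD(4)[OF w] Lie_const[OF D]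
    using coordinate_ring_const by simp
next
  case (gradient_add p P q R)
  let ?f = "on_group Q (\<lambda>x. p (coadjoint x w))" and ?h = "on_group Q (\<lambda>x. q (coadjoint x w))"
  have cl: "?f \<in> \<O>" "?h \<in> \<O>" using gradient_add.IH by auto
  have eq: "on_group Q (\<lambda>x. p (coadjoint x w) + q (coadjoint x w)) = ?f + ?h"
    by (auto simp: on_group_def fun_eq_iff)
  have D_eq: "D (on_group Q (\<lambda>x. p (coadjoint x w) + q (coadjoint x w))) = D ?f + D ?h"
    unfolding eq by (rule LieD(3)[OF D cl])
  show ?case
    unfolding D_eq
  proof (intro conjI ballI)
    show "on_group Q (\<lambda>x. p (coadjoint x w) + q (coadjoint x w)) \<in> \<O>"
      unfolding eq by (rule coordinate_ring_add[OF cl])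
    fix g assume g: "g \<in> carrier Q"
    show "(D ?f + D ?h) g = - w (commutator D (Ad Q (inv g) (P (coadjoint g w) + R (coadjoint g w))))"
      using lie.dual_gradient_sum(1)[OF infinitesimal_coadjoint_dual[OF w D g] gradient_add.hyps]
        gradient_add.IH g lie.gradient_in_L[OF gradient_add.hyps(1)]
        lie.gradient_in_L[OF gradient_add.hyps(2)] by (simp add: Lie_add)
  qed
next
  case (gradient_mult p P q R)
  let ?f = "on_group Q (\<lambda>x. p (coadjoint x w))" and ?h = "on_group Q (\<lambda>x. q (coadjoint x w))"
  have cl: "?f \<in> \<O>" "?h \<in> \<O>" using gradient_mult.IH by auto
  have eq: "on_group Q (\<lambda>x. p (coadjoint x w) * q (coadjoint x w)) = ?f * ?h"
    by (auto simp: on_group_def fun_eq_iff)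
  have D_eq: "D (on_group Q (\<lambda>x. p (coadjoint x w) * q (coadjoint x w))) = D ?f * ?h + ?f * D ?h"
    unfolding eq by (rule LieD(5)[OF D cl])
  show ?case
    unfolding D_eq
  proof (intro conjI ballI)
    show "on_group Q (\<lambda>x. p (coadjoint x w) * q (coadjoint x w)) \<in> \<O>"
      unfolding eq by (rule coordinate_ring_mult[OF cl])
    fix g assume g: "g \<in> carrier Q"
    show "(D ?f * ?h + ?f * D ?h) g = - w (commutator D (Ad Q (inv g)
        (scale_op (p (coadjoint g w)) (R (coadjoint g w)) + scale_op (q (coadjoint g w)) (P (coadjoint g w)))))"
      using lie.dual_gradient_sum(2)[OF infinitesimal_coadjoint_dual[OF w D g] gradient_mult.hyps,
          of "p (coadjoint g w)" "coadjoint g w" "q (coadjoint g w)"]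
        gradient_mult.IH g lie.gradient_in_L[OF gradient_mult.hyps(1)]
        lie.gradient_in_L[OF gradient_mult.hyps(2)] by (simp add: Lie_add Lie_scale)
  qed
qed

end

lemma sum_fun_apply: "sum F J x = (\<Sum>i\<in>J. F i x)"
  by (induction J rule: infinite_finite_induct) simp_all

text \<open>For the action map \<open>Q \<times> V \<rightarrow> \<qq>\<^sup>*\<close>, where \<open>V\<close> is the annihilator of \<open>N\<close>: if it is
  dominant then general points \<open>\<beta>\<close>, with any tangent vectors \<open>v\<close> there, lift.\<close>

lemma coadjoint_saturation_lift:
  fixes Q :: "('k::{alg_closed_field, field_char_0} ^ 'n) monoid" (structure)
  assumes Q: "affine_algebraic_group Q" and N: "N \<subseteq> Lie Q"
  defines "dual \<equiv> lie_algebra.dual scale_op (Lie Q)"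
    and "evals \<equiv> (\<lambda>\<xi> \<gamma> :: ('k, 'n) operator \<Rightarrow> 'k. \<gamma> \<xi>) ` Lie Q"
    and "coad \<equiv> affine_algebraic_group.coadjoint Q"
  defines "V \<equiv> {w \<in> dual. \<forall>\<eta>\<in>N. w \<eta> = 0}"
  assumes dense: "\<And>p. p \<in> poly_funs evals \<Longrightarrow>
    \<forall>g\<in>carrier Q. \<forall>w\<in>V. p (coad g w) = 0 \<Longrightarrow> \<forall>\<beta>\<in>dual. p \<beta> = 0"
  shows "\<exists>p\<in>poly_funs evals. (\<exists>\<beta>\<in>dual. p \<beta> \<noteq> 0) \<and>
    (\<forall>\<beta>\<in>dual. \<forall>v\<in>dual. p \<beta> \<noteq> 0 \<longrightarrow> (\<exists>g\<in>carrier Q. \<exists>w\<in>V. \<exists>w'\<in>V. \<exists>D\<in>Lie Q.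
       \<beta> = coad g w \<and> (\<forall>\<eta>\<in>Lie Q. v \<eta> = w' (Ad Q (inv g) \<eta>) - w (commutator D (Ad Q (inv g) \<eta>)))))"
proof -
  interpret affine_algebraic_group Q by fact
  define X where "X = carrier Q \<times> V"
  define \<Phi> where "\<Phi> x = coad (fst x) (snd x)" for x
  define I where "I = {f :: ('k ^ 'n) \<times> (('k, 'n) operator \<Rightarrow> 'k) \<Rightarrow> 'k. \<forall>x\<in>X. f x = 0}"
  \<comment> \<open>Pulled-back functions are only prescribed on \<open>X\<close>, so
    \<open>A\<close> contains \<open>I\<close>.\<close>
  define A where "A = {f. \<exists>p\<in>poly_funs evals. \<forall>x\<in>X. f x = p (\<Phi> x)}"
  obtain e where e: "\<And>i. e i \<in> Lie Q"
    "\<And>D. D \<in> Lie Q \<Longrightarrow> D = (\<Sum>i\<in>UNIV. scale_op (D (coordinate i) \<one>) (e i))"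
    using Lie_spanning_family by blast
  \<comment> \<open>Coordinates on the source: the matrix of coordinates of the group element is
    finite, and \<open>w\<close> is determined by its values on the spanning family.\<close>
  define gc where "gc i = (\<lambda>x :: ('k ^ 'n) \<times> (('k, 'n) operator \<Rightarrow> 'k). fst x $ i)" for i
  define wc where "wc i = (\<lambda>x :: ('k ^ 'n) \<times> (('k, 'n) operator \<Rightarrow> 'k). snd x (e i))" for i
  have V_dual: "w \<in> dual" if "w \<in> V" for w using that by (simp add: V_def)
  have \<Phi>_dual: "\<Phi> x \<in> dual" if "x \<in> X" for x
    using that coadjoint_dual V_dual by (auto simp: X_def \<Phi>_def coad_def dual_def)
  have rep_zero: "p \<beta> = 0" if "p \<in> poly_funs evals" "\<And>x. x \<in> X \<Longrightarrow> p (\<Phi> x) = 0" "\<beta> \<in> dual" for p \<beta>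
  proof -
    have "p (coad g w) = 0" if "g \<in> carrier Q" "w \<in> V" for g w
      using \<open>\<And>x. x \<in> X \<Longrightarrow> p (\<Phi> x) = 0\<close>[of "(g, w)"] that by (simp add: X_def \<Phi>_def)
    then show ?thesis using dense[OF that(1)] that(3) by blast
  qed
  have A_sub: "unital_subring A"
    unfolding unital_subring_def
  proof (intro conjI ballI)
    show "1 \<in> A" unfolding A_def by (auto intro!: bexI[of _ "\<lambda>_. 1"] poly_funs.const)
    fix f h assume "f \<in> A" "h \<in> A"
    then obtain p q where pq: "p \<in> poly_funs evals" "\<forall>x\<in>X. f x = p (\<Phi> x)"
      "q \<in> poly_funs evals" "\<forall>x\<in>X. h x = q (\<Phi> x)" unfolding A_def by blast
    show "f - h \<in> A" unfolding A_def using pq poly_funs_diff[OF pq(1,3)] by (auto intro!: bexI)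
    show "f * h \<in> A" unfolding A_def using pq poly_funs.mult[OF pq(1,3)] by (auto intro!: bexI)
  qed
  have IA: "I \<subseteq> A" unfolding I_def A_def by (auto intro!: bexI[of _ "\<lambda>_. 0"] poly_funs.const)
  have X_ne: "(\<one>, \<lambda>_. 0) \<in> X" using lie.zero_in_dual by (auto simp: X_def V_def dual_def)
  have one_I: "1 \<notin> I" using X_ne by (auto simp: I_def)
  \<comment> \<open>By density, \<open>A\<close> modulo \<open>I\<close> is the ring of polynomial
    functions on the dual, and the dual is irreducible.\<close>
  have prime: "f \<in> I \<or> h \<in> I" if fh: "f \<in> A" "h \<in> A" "f * h \<in> I" for f h
  proof -
    from fh obtain p q where pq: "p \<in> poly_funs evals" "\<forall>x\<in>X. f x = p (\<Phi> x)"
      "q \<in> poly_funs evals" "\<forall>x\<in>X. h x = q (\<Phi> x)" unfolding A_def by blast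
    show ?thesis
    proof (rule ccontr)
      assume "\<not> (f \<in> I \<or> h \<in> I)"
      then obtain x y where "x \<in> X" "f x \<noteq> 0" "y \<in> X" "h y \<noteq> 0" unfolding I_def by blast
      then have "p (\<Phi> x) \<noteq> 0" "q (\<Phi> y) \<noteq> 0" "\<Phi> x \<in> dual" "\<Phi> y \<in> dual" using pq \<Phi>_dual by auto
      then obtain \<delta> where \<delta>: "\<delta> \<in> dual" "p \<delta> \<noteq> 0" "q \<delta> \<noteq> 0"
        using lie.dual_irreducible[folded dual_def evals_def, of p "\<Phi> x" q "\<Phi> y"] pq(1,3) by blast
      have "p \<delta> * q \<delta> = 0"
        by (rule rep_zero[OF poly_funs.mult[OF pq(1,3)] _ \<delta>(1)]) (use fh(3) pq in \<open>auto simp: I_def\<close>)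
      with \<delta> show False by simp
    qed
  qed
  have "\<exists>a\<in>A. a \<notin> I \<and> (\<forall>\<phi> \<delta> :: _ \<Rightarrow> 'k. dual_point A I \<phi> \<delta> \<longrightarrow> \<phi> a \<noteq> 0 \<longrightarrow>
    (\<exists>S \<phi>' \<delta>'. unital_subring S \<and> A \<union> (range gc \<union> range wc) \<subseteq> S \<and> dual_point S I \<phi>' \<delta>' \<and>
       (\<forall>x\<in>A. \<phi>' x = \<phi> x \<and> \<delta>' x = \<delta> x)))"
  proof (rule dual_point_extension[OF A_sub _ _ _ _ one_I prime])
    show "finite (range gc \<union> range wc)" by simp
    show "0 \<in> I" "\<And>x y. x \<in> I \<Longrightarrow> y \<in> I \<Longrightarrow> x + y \<in> I" "\<And>r x. x \<in> I \<Longrightarrow> r * x \<in> I"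
      by (auto simp: I_def)
    fix n :: nat assume "n > 0"
    then show "\<exists>y. y * of_nat n = (1 :: ('k ^ 'n) \<times> (('k, 'n) operator \<Rightarrow> 'k) \<Rightarrow> 'k)"
      by (intro exI[of _ "\<lambda>_. 1 / of_nat n"]) (simp add: fun_eq_iff)
  qed
  then obtain a where a: "a \<in> A" "a \<notin> I" and
    ext: "\<And>\<phi> \<delta> :: _ \<Rightarrow> 'k. dual_point A I \<phi> \<delta> \<Longrightarrow> \<phi> a \<noteq> 0 \<Longrightarrow>
    \<exists>S \<phi>' \<delta>'. unital_subring S \<and> A \<union> (range gc \<union> range wc) \<subseteq> S \<and> dual_point S I \<phi>' \<delta>' \<and>
       (\<forall>x\<in>A. \<phi>' x = \<phi> x \<and> \<delta>' x = \<delta> x)" by blast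
  obtain p0 where p0: "p0 \<in> poly_funs evals" "\<And>x. x \<in> X \<Longrightarrow> a x = p0 (\<Phi> x)" using a(1) unfolding A_def by blast
  obtain x0 where x0: "x0 \<in> X" "p0 (\<Phi> x0) \<noteq> 0" using a(2) p0(2) unfolding I_def by auto
  show ?thesis
  proof (intro bexI[of _ p0] conjI ballI impI)
    show "p0 \<in> poly_funs evals" by (fact p0(1))
    show "\<exists>\<beta>\<in>dual. p0 \<beta> \<noteq> 0" using \<Phi>_dual[OF x0(1)] x0(2) by blast
    fix \<beta> v assume \<beta>: "\<beta> \<in> dual" and v: "v \<in> dual" and nz: "p0 \<beta> \<noteq> 0"
    \<comment> \<open>The point \<open>\<beta>\<close> with tangent vector \<open>v\<close> is the
      dual point that restricts a polynomial to the line through \<open>\<beta>\<close> in direction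
      \<open>v\<close> and takes value and derivative at \<open>0\<close>.\<close>
    define rep where "rep f = (SOME p. p \<in> poly_funs evals \<and> (\<forall>x\<in>X. f x = p (\<Phi> x)))" for f
    define line where "line p = (SOME q. \<forall>t. p (\<lambda>x. \<beta> x + t * v x) = poly q t)" for p
    define \<phi> where "\<phi> f = poly (line (rep f)) 0" for f
    define \<delta> where "\<delta> f = poly (pderiv (line (rep f))) 0" for f
    have line_dual: "(\<lambda>x. \<beta> x + t * v x) \<in> dual" for t
      by (rule lie.dual_add[folded dual_def, OF \<beta> v])
    have line: "\<exists>q. \<forall>t. p (\<lambda>x. \<beta> x + t * v x) = poly q t" if "p \<in> poly_funs evals" for p
      by (rule lie.poly_funs_line[folded dual_def evals_def, OF that v, of \<beta>]) blast
    \<comment> \<open>Two polynomials representing the same element of \<open>A\<close> agree on the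
      whole dual by density, so the choices made in \<open>rep\<close> and \<open>line\<close> do
      not matter.\<close>
    have val: "\<phi> f = poly q 0 \<and> \<delta> f = poly (pderiv q) 0"
      if p: "p \<in> poly_funs evals" "\<And>x. x \<in> X \<Longrightarrow> f x = p (\<Phi> x)"
        and q: "\<And>t. p (\<lambda>x. \<beta> x + t * v x) = poly q t" for f p q
    proof -
      have "rep f \<in> poly_funs evals \<and> (\<forall>x\<in>X. f x = rep f (\<Phi> x))"
        unfolding rep_def by (rule someI[of _ p]) (use p in blast)
      then have r: "rep f \<in> poly_funs evals" "\<And>x. x \<in> X \<Longrightarrow> f x = rep f (\<Phi> x)" by blast+
      have l: "\<And>t. rep f (\<lambda>x. \<beta> x + t * v x) = poly (line (rep f)) t"
        using someI_ex[OF line[OF r(1)]] unfolding line_def by blast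
      have "rep f \<gamma> - p \<gamma> = 0" if "\<gamma> \<in> dual" for \<gamma>
        by (rule rep_zero[OF poly_funs_diff[OF r(1) p(1)] _ that]) (use r(2) p(2) in auto)
      then have "rep f (\<lambda>x. \<beta> x + t * v x) = p (\<lambda>x. \<beta> x + t * v x)" for t using line_dual[of t] by simp
      then have "line (rep f) = q" using l q by (intro poly_eq_all) simp
      then show ?thesis by (simp add: \<phi>_def \<delta>_def)
    qed
    have A_line: "\<exists>p q. p \<in> poly_funs evals \<and> (\<forall>x\<in>X. f x = p (\<Phi> x)) \<and>
        (\<forall>t. p (\<lambda>x. \<beta> x + t * v x) = poly q t)" if "f \<in> A" for f
      using that line unfolding A_def by blast
    have "dual_point A I \<phi> \<delta>"
      unfolding dual_point_def
    proof (intro conjI ballI)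
      show "\<phi> 1 = 1" using val[of "\<lambda>_. 1" 1 "[:1:]"] by (simp add: poly_funs.const)
    next
      fix f h assume f: "f \<in> A" and h: "h \<in> A"
      obtain p q where 1: "p \<in> poly_funs evals" "\<And>x. x \<in> X \<Longrightarrow> f x = p (\<Phi> x)"
        "\<And>t. p (\<lambda>x. \<beta> x + t * v x) = poly q t" using A_line[OF f] by blast
      obtain p' q' where 2: "p' \<in> poly_funs evals" "\<And>x. x \<in> X \<Longrightarrow> h x = p' (\<Phi> x)"
        "\<And>t. p' (\<lambda>x. \<beta> x + t * v x) = poly q' t" using A_line[OF h] by blast
      have "\<phi> (f + h) = poly (q + q') 0 \<and> \<delta> (f + h) = poly (pderiv (q + q')) 0"
        by (rule val[OF poly_funs.add[OF 1(1) 2(1)]]) (simp_all add: 1 2)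
      then show "\<phi> (f + h) = \<phi> f + \<phi> h" "\<delta> (f + h) = \<delta> f + \<delta> h"
        using val[OF 1] val[OF 2] by (simp_all add: pderiv_add)
      have "\<phi> (f * h) = poly (q * q') 0 \<and> \<delta> (f * h) = poly (pderiv (q * q')) 0"
        by (rule val[OF poly_funs.mult[OF 1(1) 2(1)]]) (simp_all add: 1 2)
      then show "\<phi> (f * h) = \<phi> f * \<phi> h" "\<delta> (f * h) = \<phi> f * \<delta> h + \<delta> f * \<phi> h"
        using val[OF 1] val[OF 2] by (simp_all add: pderiv_mult algebra_simps)
    next
      fix f assume "f \<in> A \<inter> I"
      then have "\<phi> f = poly 0 0 \<and> \<delta> f = poly (pderiv 0) 0"
        by (intro val[of "\<lambda>_. 0"] poly_funs.const) (auto simp: I_def)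
      then show "\<phi> f = 0" "\<delta> f = 0" by simp_all
    qed
    moreover have "\<phi> a \<noteq> 0"
    proof -
      obtain q where q: "\<And>t. p0 (\<lambda>x. \<beta> x + t * v x) = poly q t" using line[OF p0(1)] by blast
      show ?thesis using val[OF p0 q] q[of 0] nz by simp
    qed
    ultimately have "\<exists>S \<phi>' \<delta>'. unital_subring S \<and> A \<union> (range gc \<union> range wc) \<subseteq> S \<and>
        dual_point S I \<phi>' \<delta>' \<and> (\<forall>x\<in>A. \<phi>' x = \<phi> x \<and> \<delta>' x = \<delta> x)" by (rule ext)
    then obtain S \<phi>' \<delta>' where S0: "unital_subring S" "A \<union> (range gc \<union> range wc) \<subseteq> S"
      and pt: "dual_point S I \<phi>' \<delta>'" and agree0: "\<forall>x\<in>A. \<phi>' x = \<phi> x \<and> \<delta>' x = \<delta> x"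
      by (elim exE conjE)
    have S: "unital_subring S" "A \<subseteq> S" "\<And>i. gc i \<in> S" "\<And>i. wc i \<in> S" using S0 by auto
    have agree: "\<And>f. f \<in> A \<Longrightarrow> \<phi>' f = \<phi> f \<and> \<delta>' f = \<delta> f" using agree0 by simp
    note SD = unital_subringD[OF S(1)] and pd = dual_pointD[OF S(1) pt]
    have mod_I: "h \<in> S \<and> \<phi>' h = \<phi>' f \<and> \<delta>' h = \<delta>' f" if "f \<in> S" "\<And>x. x \<in> X \<Longrightarrow> h x = f x" for f h
    proof -
      have "h - f \<in> I" using that(2) by (simp add: I_def)
      then have "h - f \<in> S" using IA S(2) by blast
      then show ?thesis
        using that(1) SD(5)[of "h - f" f] pd(5,6)[of "h - f" f] pd(9,10)[of "h - f"] \<open>h - f \<in> I\<close> by simp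
    qed
    have const: "(\<lambda>_. c) \<in> S \<and> \<phi>' (\<lambda>_. c) = c \<and> \<delta>' (\<lambda>_. c) = 0" for c
    proof -
      have "(\<lambda>_. c) \<in> A" unfolding A_def by (auto intro!: bexI[of _ "\<lambda>_. c"] poly_funs.const)
      moreover have "\<phi> (\<lambda>_. c) = poly [:c:] 0 \<and> \<delta> (\<lambda>_. c) = poly (pderiv [:c:]) 0"
        by (rule val[OF poly_funs.const]) auto
      ultimately show ?thesis using agree S(2) by (auto simp: pderiv_pCons)
    qed
    \<comment> \<open>The lifted group element, read off from the images of its coordinates.\<close>
    define g where "g = (\<chi> i. \<phi>' (gc i))"
    have poly_g: "(\<lambda>x. p (fst x)) \<in> S \<and> \<phi>' (\<lambda>x. p (fst x)) = p g" if "p \<in> poly_funs coords" for p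
      using that
    proof induction
      case (gen p)
      then obtain i where "p = (\<lambda>x. x $ i)" unfolding coords_def by blast
      then show ?case using S(3)[of i] by (simp add: gc_def g_def)
    next
      case (const c)
      then show ?case using \<open>\<And>c. (\<lambda>_. c) \<in> S \<and> \<phi>' (\<lambda>_. c) = c \<and> \<delta>' (\<lambda>_. c) = 0\<close> by blast
    next
      case (add p q)
      then show ?case
        using SD(5)[of "\<lambda>x. p (fst x)" "\<lambda>x. q (fst x)"] pd(5)[of "\<lambda>x. p (fst x)" "\<lambda>x. q (fst x)"]
        by (simp add: plus_fun_def)
    next
      case (mult p q)
      then show ?case
        using SD(6)[of "\<lambda>x. p (fst x)" "\<lambda>x. q (fst x)"] pd(7)[of "\<lambda>x. p (fst x)" "\<lambda>x. q (fst x)"]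
        by (simp add: times_fun_def)
    qed
    \<comment> \<open>The equations of the group belong to \<open>I\<close>, hence are sent to
      zero.\<close>
    have g: "g \<in> carrier Q"
    proof (rule carrier_zariski_closed)
      fix p assume p: "p \<in> poly_funs coords" "\<And>y. y \<in> carrier Q \<Longrightarrow> p y = 0"
      then have "(\<lambda>x. p (fst x)) \<in> I" by (auto simp: I_def X_def)
      then show "p g = 0" using poly_g[OF p(1)] pd(9) by metis
    qed
    have ring_g: "(\<lambda>x. f (fst x)) \<in> S \<and> \<phi>' (\<lambda>x. f (fst x)) = f g" if "f \<in> coordinate_ring Q" for f
    proof -
      from that obtain p where p: "p \<in> poly_funs coords" "f = on_group Q p" unfolding coordinate_ring_def by blast
      have "f (fst x) = p (fst x)" if "x \<in> X" for x using that by (auto simp: X_def p(2))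
      then show ?thesis using mod_I[of "\<lambda>x. p (fst x)" "\<lambda>x. f (fst x)"] poly_g[OF p(1)] g p(2) by simp
    qed
    \<comment> \<open>The tangent component along the group is a point derivation at
      \<open>g\<close> and thus comes from some \<open>D\<close> in \<open>Lie Q\<close>.\<close>
    define \<epsilon> where "\<epsilon> f = \<delta>' (\<lambda>x. f (fst x))" for f
    obtain D where D: "D \<in> Lie Q" "\<And>f. f \<in> coordinate_ring Q \<Longrightarrow> D f g = \<epsilon> f"
    proof (rule point_derivation_extends[OF g])
      fix f h assume f: "f \<in> coordinate_ring Q" and h: "h \<in> coordinate_ring Q"
      show "\<epsilon> (f + h) = \<epsilon> f + \<epsilon> h"
        unfolding \<epsilon>_def using pd(6)[of "\<lambda>x. f (fst x)" "\<lambda>x. h (fst x)"] ring_g[OF f] ring_g[OF h]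
        by (simp add: plus_fun_def)
      show "\<epsilon> (f * h) = f g * \<epsilon> h + \<epsilon> f * h g"
        unfolding \<epsilon>_def using pd(8)[of "\<lambda>x. f (fst x)" "\<lambda>x. h (fst x)"] ring_g[OF f] ring_g[OF h]
        by (simp add: times_fun_def)
    next
      fix f c assume f: "f \<in> coordinate_ring Q"
      show "\<epsilon> (\<lambda>x. c * f x) = c * \<epsilon> f"
        unfolding \<epsilon>_def using pd(8)[of "\<lambda>_. c" "\<lambda>x. f (fst x)"] ring_g[OF f] const[of c]
        by (simp add: times_fun_def)
    qed (rule that)
    \<comment> \<open>The lifted functional and its tangent component \<open>w'\<close>. Since the
      \<open>e i\<close> may be dependent, both are defined through the coordinates of
      \<open>\<eta>\<close> instead of by values on the family.\<close>
    define w where "w \<eta> = (if \<eta> \<in> Lie Q then \<Sum>i\<in>UNIV. \<eta> (coordinate i) \<one> * \<phi>' (wc i) else 0)" for \<eta>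
    define w' where "w' \<eta> = (if \<eta> \<in> Lie Q then \<Sum>i\<in>UNIV. \<eta> (coordinate i) \<one> * \<delta>' (wc i) else 0)" for \<eta>
    have lin: "(\<lambda>\<eta>. if \<eta> \<in> Lie Q then \<Sum>i\<in>UNIV. \<eta> (coordinate i) \<one> * c i else 0) \<in> dual" for c
    proof -
      have "scale_op a D f x = a * D f x" for a and D :: "('k, 'n) operator" and f x
        by (simp add: scale_op_def)
      then show ?thesis
        unfolding dual_def lie.dual_def
        by (auto simp: Lie_add Lie_scale sum.distrib[symmetric] distrib_right sum_distrib_left mult.assoc)
    qed
    have comb: "(\<lambda>x. \<Sum>i\<in>UNIV. f i (fst x) * wc i x) \<in> S \<and>
        \<phi>' (\<lambda>x. \<Sum>i\<in>UNIV. f i (fst x) * wc i x) = (\<Sum>i\<in>UNIV. f i g * \<phi>' (wc i)) \<and>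
        \<delta>' (\<lambda>x. \<Sum>i\<in>UNIV. f i (fst x) * wc i x) = (\<Sum>i\<in>UNIV. f i g * \<delta>' (wc i) + \<epsilon> (f i) * \<phi>' (wc i))"
      if f: "\<And>i. f i \<in> coordinate_ring Q" for f :: "'n \<Rightarrow> 'k ^ 'n \<Rightarrow> 'k"
    proof -
      have eq: "(\<lambda>x. \<Sum>i\<in>UNIV. f i (fst x) * wc i x) = (\<Sum>i\<in>UNIV. (\<lambda>x. f i (fst x)) * wc i)"
        by (simp add: fun_eq_iff sum_fun_apply)
      have cl: "(\<lambda>x. f i (fst x)) * wc i \<in> S" for i using SD(6) ring_g[OF f] S(4) by blast
      show ?thesis
        unfolding eq \<epsilon>_def using cl ring_g[OF f] S(4) by (simp add: SD(9) pd(7,8,15,16))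
    qed
    \<comment> \<open>The linear equations defining \<open>V\<close> also belong to
      \<open>I\<close>; their coefficients are constants and have no tangent component.\<close>
    have vanish: "w \<eta> = 0 \<and> w' \<eta> = 0" if \<eta>: "\<eta> \<in> N" for \<eta>
    proof -
      have \<eta>L: "\<eta> \<in> Lie Q" using N \<eta> by blast
      let ?c = "\<lambda>i. on_group Q (\<lambda>_. \<eta> (coordinate i) \<one>)"
      have inI: "(\<lambda>x. \<Sum>i\<in>UNIV. ?c i (fst x) * wc i x) \<in> I"
      proof -
        have "(\<Sum>i\<in>UNIV. \<eta> (coordinate i) \<one> * u (e i)) = 0" if "u \<in> V" for u
          using Lie_dual_expand[OF e _ \<eta>L, of u] that \<eta> by (simp add: V_def dual_def)
        then show ?thesis by (auto simp: I_def X_def wc_def)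
      qed
      have \<epsilon>0: "\<epsilon> (?c i) = 0" for i
        using D(2)[OF coordinate_ring_const] Lie_const[OF D(1)] by (metis zero_fun_apply)
      note c = comb[of ?c, OF coordinate_ring_const]
      from pd(9)[OF conjunct1[OF c] inI] pd(10)[OF conjunct1[OF c] inI] c
      have "(\<Sum>i\<in>UNIV. ?c i g * \<phi>' (wc i)) = 0"
        "(\<Sum>i\<in>UNIV. ?c i g * \<delta>' (wc i) + \<epsilon> (?c i) * \<phi>' (wc i)) = 0" by simp_all
      then show ?thesis using g \<eta>L by (simp add: w_def w'_def \<epsilon>0)
    qed
    have wV: "w \<in> V" and w'V: "w' \<in> V"
      using lin[of "\<lambda>i. \<phi>' (wc i)", folded w_def] lin[of "\<lambda>i. \<delta>' (wc i)", folded w'_def] vanish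
      unfolding V_def by blast+
    \<comment> \<open>The pulled-back evaluation at \<open>\<eta>\<close> is computed twice: as an
      element of \<open>A\<close> it gives \<open>\<beta> \<eta>\<close> and
      \<open>v \<eta>\<close>; as a sum of products of group and linear coordinates it gives the
      right-hand sides, the product rule producing the two tangent terms.\<close>
    have main: "\<beta> \<eta> = w (Ad Q (inv g) \<eta>) \<and>
        v \<eta> = w' (Ad Q (inv g) \<eta>) - w (commutator D (Ad Q (inv g) \<eta>))" if \<eta>: "\<eta> \<in> Lie Q" for \<eta>
    proof -
      define F where "F i = on_group Q (\<lambda>x. Ad Q (inv x) \<eta> (coordinate i) \<one>)" for i
      have F: "F i \<in> coordinate_ring Q" for i
        unfolding F_def by (rule Ad_orbit_derivative_at_one(1)[OF D(1) \<eta> coordinate_closed])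
      have Ad\<eta>: "Ad Q (inv g) \<eta> \<in> Lie Q" using Ad_closed g \<eta> by simp
      have eval: "(\<lambda>\<gamma>. \<gamma> \<eta>) \<in> poly_funs evals" unfolding evals_def using \<eta> by (intro poly_funs.gen) blast
      then have inA: "(\<lambda>x. \<Phi> x \<eta>) \<in> A"
        unfolding A_def by (intro CollectI bexI[of _ "\<lambda>\<gamma>. \<gamma> \<eta>"]) auto
      have "\<phi> (\<lambda>x. \<Phi> x \<eta>) = poly [:\<beta> \<eta>, v \<eta>:] 0 \<and> \<delta> (\<lambda>x. \<Phi> x \<eta>) = poly (pderiv [:\<beta> \<eta>, v \<eta>:]) 0"
        by (rule val[OF eval]) auto
      then have 1: "\<phi>' (\<lambda>x. \<Phi> x \<eta>) = \<beta> \<eta>" "\<delta>' (\<lambda>x. \<Phi> x \<eta>) = v \<eta>"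
        using agree[OF inA] by (auto simp: pderiv_pCons)
      have "\<Phi> x \<eta> = (\<Sum>i\<in>UNIV. F i (fst x) * wc i x)" if "x \<in> X" for x
      proof -
        from that have x: "fst x \<in> carrier Q" "snd x \<in> dual" using V_dual by (auto simp: X_def)
        then show ?thesis
          using Lie_dual_expand[OF e _ Ad_closed[OF inv_closed[OF x(1)] \<eta>], of "snd x"] \<eta>
          by (simp add: \<Phi>_def coad_def coadjoint_def F_def wc_def dual_def)
      qed
      from mod_I[OF conjunct1[OF comb[OF F]] this]
      have 2: "\<phi>' (\<lambda>x. \<Phi> x \<eta>) = (\<Sum>i\<in>UNIV. F i g * \<phi>' (wc i))"
        "\<delta>' (\<lambda>x. \<Phi> x \<eta>) = (\<Sum>i\<in>UNIV. F i g * \<delta>' (wc i) + \<epsilon> (F i) * \<phi>' (wc i))"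
        using comb[OF F] by auto
      have "\<epsilon> (F i) = - commutator D (Ad Q (inv g) \<eta>) (coordinate i) \<one>" for i
        using D(2)[OF F] Ad_orbit_derivative[OF D(1) \<eta> coordinate_closed g] by (simp add: F_def)
      then show ?thesis
        using 1 2 Ad\<eta> g commutator_closed[OF D(1) Ad\<eta>]
        by (simp add: w_def w'_def F_def sum_subtractf)
    qed
    have "\<beta> = coad g w"
    proof
      fix \<eta> show "\<beta> \<eta> = coad g w \<eta>"
        using main[of \<eta>] lie.dualD(3)[of \<beta> \<eta>] \<beta> by (auto simp: coad_def coadjoint_def dual_def)
    qed
    with main g wV w'V D(1) show "\<exists>g\<in>carrier Q. \<exists>w\<in>V. \<exists>w'\<in>V. \<exists>D\<in>Lie Q.
       \<beta> = coad g w \<and> (\<forall>\<eta>\<in>Lie Q. v \<eta> = w' (Ad Q (inv g) \<eta>) - w (commutator D (Ad Q (inv g) \<eta>)))"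
      by blast
  qed
qed

section \<open>From contact forms to generic stabilisers\<close>

lemma contact_imp_generic_stabiliser:
  fixes Q :: "('k::{alg_closed_field, field_char_0} ^ 'n) monoid" (structure)
  assumes Q: "affine_algebraic_group Q" and contact: "lie_algebra.contact scale_op (Lie Q) commutator"
  shows "has_generic_stabiliser Q"
proof -
  interpret affine_algebraic_group Q by fact
  obtain \<alpha> \<eta>0 where \<alpha>: "\<alpha> \<in> lie.dual" and \<eta>0: "\<eta>0 \<in> Lie Q" "\<alpha> \<eta>0 \<noteq> 0"
    and ker: "\<And>\<xi>. \<xi> \<in> lie.stabiliser \<alpha> \<Longrightarrow> \<alpha> \<xi> = 0 \<Longrightarrow> \<xi> = 0"
    using lie.contact_imp_trivial_kernel[OF contact] by blast
  \<comment> \<open>With \<open>N\<close> the kernel of \<open>\<alpha>\<close>, the annihilator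
    \<open>V\<close> is the line spanned by \<open>\<alpha>\<close>.\<close>
  define N where "N = {x \<in> Lie Q. \<alpha> x = 0}"
  define V where "V = {w \<in> lie.dual. \<forall>\<eta>\<in>N. w \<eta> = 0}"
  have V_multiple: "w = (\<lambda>x. (w \<eta>0 / \<alpha> \<eta>0) * \<alpha> x)" if w: "w \<in> V" for w
  proof
    fix x show "w x = (w \<eta>0 / \<alpha> \<eta>0) * \<alpha> x"
    proof (cases "x \<in> Lie Q")
      case True
      let ?y = "x - scale_op (\<alpha> x / \<alpha> \<eta>0) \<eta>0"
      have c: "scale_op (\<alpha> x / \<alpha> \<eta>0) \<eta>0 \<in> Lie Q" by (rule Lie_scale[OF \<eta>0(1)])
      have "?y \<in> Lie Q" by (rule lie.subspace_diff[OF lie.subspace_L True c])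
      moreover have "\<alpha> ?y = 0"
        unfolding lie.dualD(6)[OF \<alpha> True c] lie.dualD(2)[OF \<alpha> \<eta>0(1)] using \<eta>0(2) by simp
      ultimately have "w ?y = 0" using w by (simp only: V_def N_def mem_Collect_eq)
      moreover have wd: "w \<in> lie.dual" using w by (simp add: V_def)
      ultimately show ?thesis
        unfolding lie.dualD(6)[OF wd True c] lie.dualD(2)[OF wd \<eta>0(1)] by simp
    next
      case False
      then show ?thesis using w lie.dualD(3)[OF \<alpha> False] lie.dualD(3)[of w, OF _ False] by (simp add: V_def)
    qed
  qed
  \<comment> \<open>The zero multiple is left out because the tangent vectors used for the gradients
    would degenerate there.\<close>
  define Z where "Z = {coadjoint g (\<lambda>x. c * \<alpha> x) |g c. g \<in> carrier Q \<and> c \<noteq> 0}"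
  have Z_dual: "Z \<subseteq> lie.dual" using coadjoint_dual lie.dual_scale[OF \<alpha>] by (auto simp: Z_def)
  have Z_scale: "(\<lambda>x. \<beta> x + t * \<beta> x) \<in> Z" if "\<beta> \<in> Z" "t \<noteq> - 1" for \<beta> t
  proof -
    obtain g c where gc: "g \<in> carrier Q" "c \<noteq> 0" "\<beta> = coadjoint g (\<lambda>x. c * \<alpha> x)" using \<open>\<beta> \<in> Z\<close> Z_def by auto
    have "(\<lambda>x. \<beta> x + t * \<beta> x) = coadjoint g (\<lambda>x. ((1 + t) * c) * \<alpha> x)"
      by (auto simp: gc(3) coadjoint_def fun_eq_iff algebra_simps)
    moreover have "(1 + t) * c \<noteq> 0" using gc(2) that(2) by (simp add: add_eq_0_iff)
    ultimately show ?thesis using gc(1) unfolding Z_def by blast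
  qed
  have grad: "P \<beta> = 0"
    if pP: "lie.gradient p P" and pZ: "\<And>\<gamma>. \<gamma> \<in> Z \<Longrightarrow> p \<gamma> = 0" and \<beta>: "\<beta> \<in> Z" for p P \<beta>
  proof -
    obtain g c where g: "g \<in> carrier Q" and c: "c \<noteq> 0" and \<beta>_eq: "\<beta> = coadjoint g (\<lambda>x. c * \<alpha> x)"
      using \<beta> Z_def by auto
    have PL: "P \<beta> \<in> Lie Q" by (rule lie.gradient_in_L[OF pP])
    define \<zeta> where "\<zeta> = Ad Q (inv g) (P \<beta>)"
    have \<zeta>L: "\<zeta> \<in> Lie Q" unfolding \<zeta>_def using Ad_closed g PL by simp
    \<comment> \<open>\<open>p\<close> vanishes on the line through \<open>\<beta>\<close> and the
      origin, except possibly at the origin itself, which is \<open>t = - 1\<close>.\<close>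
    have "\<beta> (P \<beta>) = 0"
    proof -
      obtain q where q: "\<And>t. p (\<lambda>x. \<beta> x + t * \<beta> x) = poly q t"
        "\<And>t. \<beta> (P (\<lambda>x. \<beta> x + t * \<beta> x)) = poly (pderiv q) t"
        using lie.gradient_line[OF pP, of \<beta> \<beta>] \<beta> Z_dual by blast
      have "q = 0" using q(1) pZ[OF Z_scale[OF \<beta>]] by (intro poly_zero_cofinite[of "- 1"]) metis
      then show ?thesis using q(2)[of 0] by simp
    qed
    then have "\<alpha> \<zeta> = 0" using c PL by (simp add: \<beta>_eq coadjoint_def \<zeta>_def)
    \<comment> \<open>\<open>p\<close> is also constant along the orbit of the multiple of
      \<open>\<alpha>\<close>, so all orbit velocities kill its gradient.\<close>
    moreover have "\<zeta> \<in> lie.stabiliser \<alpha>"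
      unfolding lie.stabiliser_def
    proof (intro CollectI conjI ballI \<zeta>L)
      fix D assume D: "D \<in> Lie Q"
      have zero: "on_group Q (\<lambda>x. p (coadjoint x (\<lambda>x. c * \<alpha> x))) = 0"
        using pZ c by (auto simp: fun_eq_iff on_group_def Z_def)
      have "D (on_group Q (\<lambda>x. p (coadjoint x (\<lambda>x. c * \<alpha> x)))) g = - (c * \<alpha> (commutator D \<zeta>))"
        using coadjoint_orbit_chain_rule[OF pP lie.dual_scale[OF \<alpha>] D] g unfolding \<zeta>_def \<beta>_eq by blast
      then have "\<alpha> (commutator D \<zeta>) = 0" using c unfolding zero Lie_apply_zero[OF D] by simp
      then show "\<alpha> (commutator \<zeta> D) = 0"
        using lie.bracket_skew[OF \<zeta>L D] lie.dualD(5)[OF \<alpha> commutator_closed[OF D \<zeta>L]] by simp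
    qed
    ultimately have "\<zeta> = 0" using ker by blast
    then show "P \<beta> = 0" using Ad_inv(1)[OF g PL] Ad_zero[of g] unfolding \<zeta>_def by metis
  qed
  have Z_ne: "Z \<noteq> {}" unfolding Z_def using zero_neq_one by (metis (mono_tags, lifting) Collect_empty_eq one_closed)
  have \<alpha>V: "(\<lambda>x. c * \<alpha> x) \<in> V" for c using lie.dual_scale[OF \<alpha>] by (auto simp: V_def N_def)
  have dense: "\<forall>\<beta>\<in>lie.dual. p \<beta> = 0" if p: "p \<in> poly_funs lie.evals"
    "\<forall>g\<in>carrier Q. \<forall>w\<in>V. p (coadjoint g w) = 0" for p
  proof
    fix \<beta> assume \<beta>: "\<beta> \<in> lie.dual"
    have "p \<gamma> = 0" if "\<gamma> \<in> Z" for \<gamma>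
    proof -
      from that obtain g c where "g \<in> carrier Q" "\<gamma> = coadjoint g (\<lambda>x. c * \<alpha> x)" unfolding Z_def by blast
      then show ?thesis using p(2) \<alpha>V by blast
    qed
    then show "p \<beta> = 0"
      using lie.dense_if_gradients_vanish[OF Z_dual Z_ne, of p \<beta>] grad p(1) \<beta> by metis
  qed
  have N: "N \<subseteq> Lie Q" by (auto simp: N_def)
  have "\<exists>p\<in>poly_funs lie.evals. (\<exists>\<beta>\<in>lie.dual. p \<beta> \<noteq> 0) \<and>
    (\<forall>\<beta>\<in>lie.dual. \<forall>v\<in>lie.dual. p \<beta> \<noteq> 0 \<longrightarrow> (\<exists>g\<in>carrier Q. \<exists>w\<in>V. \<exists>w'\<in>V. \<exists>D\<in>Lie Q.
       \<beta> = coadjoint g w \<and> (\<forall>\<eta>\<in>Lie Q. v \<eta> = w' (Ad Q (inv g) \<eta>) - w (commutator D (Ad Q (inv g) \<eta>)))))"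
    by (rule coadjoint_saturation_lift[OF Q N, folded V_def]) (rule dense)
  then obtain p \<beta>0 where p: "p \<in> poly_funs lie.evals" "\<beta>0 \<in> lie.dual" "p \<beta>0 \<noteq> 0"
    and lift0: "\<forall>\<beta>\<in>lie.dual. \<forall>v\<in>lie.dual. p \<beta> \<noteq> 0 \<longrightarrow> (\<exists>g\<in>carrier Q. \<exists>w\<in>V. \<exists>w'\<in>V. \<exists>D\<in>Lie Q.
       \<beta> = coadjoint g w \<and> (\<forall>\<eta>\<in>Lie Q. v \<eta> = w' (Ad Q (inv g) \<eta>) - w (commutator D (Ad Q (inv g) \<eta>))))"
    by (elim bexE conjE)
  note lift = lift0[rule_format]
  have \<eta>0_eval: "(\<lambda>\<gamma>. \<gamma> \<eta>0) \<in> poly_funs lie.evals" using \<eta>0(1) by (intro poly_funs.gen) blast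
  \<comment> \<open>The factor \<open>\<gamma> \<eta>0\<close> excludes the zero functional, so the
    multiple of \<open>\<alpha>\<close> found below is nonzero.\<close>
  define U where "U = {\<gamma> \<in> lie.dual. p \<gamma> * \<gamma> \<eta>0 \<noteq> 0}"
  have "openin lie.dual_zariski U"
    unfolding U_def by (rule lie.openin_dual_zariski_basic[OF poly_funs.mult[OF p(1) \<eta>0_eval]])
  moreover have "U \<noteq> {}"
  proof -
    obtain \<delta> where "\<delta> \<in> lie.dual" "p \<delta> \<noteq> 0" "\<delta> \<eta>0 \<noteq> 0"
      by (rule lie.dual_irreducible[of p \<beta>0 "\<lambda>\<gamma>. \<gamma> \<eta>0" \<alpha>, OF p \<eta>0_eval \<alpha> \<eta>0(2)])
    then have "\<delta> \<in> U" by (simp add: U_def)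
    then show ?thesis by blast
  qed
  moreover have "\<exists>g\<in>carrier Q. Ad Q g ` lie.stabiliser \<alpha> = lie.stabiliser \<beta>" if \<beta>: "\<beta> \<in> U" for \<beta>
  proof -
    have "\<beta> \<in> lie.dual" "p \<beta> \<noteq> 0" "\<beta> \<eta>0 \<noteq> 0" using \<beta> by (auto simp: U_def)
    \<comment> \<open>Only the point has to be lifted here, hence the tangent vector zero.\<close>
    from lift[OF this(1) lie.zero_in_dual this(2)] obtain g w where g: "g \<in> carrier Q"
      and w: "w \<in> V" "\<beta> = coadjoint g w" by blast
    obtain c where c: "w = (\<lambda>x. c * \<alpha> x)" using V_multiple[OF w(1)] by blast
    have "c \<noteq> 0" using \<open>\<beta> \<eta>0 \<noteq> 0\<close> \<eta>0(1) by (auto simp: w(2) c coadjoint_def)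
    then have "lie.stabiliser w = lie.stabiliser \<alpha>" by (auto simp: lie.stabiliser_def c)
    moreover have "w \<in> lie.dual" using w(1) by (simp add: V_def)
    ultimately show ?thesis using stabiliser_coadjoint[OF g] g w(2) by metis
  qed
  ultimately show ?thesis using \<alpha> unfolding has_generic_stabiliser_def by blast
qed

section \<open>From generic stabilisers to contact forms\<close>

lemma generic_stabiliser_imp_contact:
  fixes Q :: "('k::{alg_closed_field, field_char_0} ^ 'n) monoid" (structure)
  assumes Q: "affine_algebraic_group Q"
    and index: "lie_algebra.index scale_op (Lie Q) commutator = 1"
    and generic: "has_generic_stabiliser Q"
  shows "lie_algebra.contact scale_op (Lie Q) commutator"
proof (rule ccontr)
  interpret affine_algebraic_group Q by fact
  assume not_contact: "\<not> lie.contact"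
  obtain e where e: "\<And>i. e i \<in> Lie Q"
    "\<And>D. D \<in> Lie Q \<Longrightarrow> D = (\<Sum>i\<in>UNIV. scale_op (D (coordinate i) \<one>) (e i))"
    using Lie_spanning_family by blast
  have fin: "finite (range e)" by simp
  have span: "Lie Q \<subseteq> lie.span (range e)"
  proof
    fix D assume D: "D \<in> Lie Q"
    show "D \<in> lie.span (range e)"
      by (subst e(2)[OF D]) (intro lie.span_sum lie.span_scale lie.span_base rangeI)
  qed
  have ex: "\<exists>d. \<exists>\<gamma>\<in>lie.dual. d = lie.dim (lie.stabiliser \<gamma>)" using lie.zero_in_dual by blast
  obtain \<beta>0 where \<beta>0: "\<beta>0 \<in> lie.dual" "lie.dim (lie.stabiliser \<beta>0) = 1"
    using LeastI_ex[OF ex] index unfolding lie.index_def by metis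
  have min: "lie.dim (lie.stabiliser \<gamma>) \<ge> 1" if "\<gamma> \<in> lie.dual" for \<gamma>
    using Least_le[of "\<lambda>d. \<exists>\<gamma>\<in>lie.dual. d = lie.dim (lie.stabiliser \<gamma>)"] that index
    unfolding lie.index_def by (metis (no_types, lifting))
  obtain \<xi>0 where \<xi>0: "\<xi>0 \<in> lie.stabiliser \<beta>0" "lie.stabiliser \<beta>0 \<subseteq> range (\<lambda>c. scale_op c \<xi>0)" "\<xi>0 \<noteq> 0"
  proof -
    obtain B where B: "B \<subseteq> lie.stabiliser \<beta>0" "lie.independent B" "lie.stabiliser \<beta>0 \<subseteq> lie.span B" "card B = 1"
      using lie.basis_exists[of "lie.stabiliser \<beta>0"] \<beta>0(2) by metis
    obtain \<xi> where "B = {\<xi>}" using B(4) card_1_singletonE by blast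
    then show ?thesis using that[of \<xi>] B lie.dependent_zero[of B] by (auto simp: lie.span_singleton)
  qed
  obtain s \<alpha> where s: "s \<in> poly_funs lie.evals" "s \<beta>0 \<noteq> 0" and \<alpha>: "\<alpha> \<in> lie.dual"
    and s_ker: "\<And>\<gamma> \<eta>. \<gamma> \<in> lie.dual \<Longrightarrow> s \<gamma> \<noteq> 0 \<Longrightarrow> \<eta> \<in> lie.stabiliser \<gamma> \<Longrightarrow> \<alpha> \<eta> = 0 \<Longrightarrow> \<eta> = 0"
    using lie.stabiliser_semicontinuous[OF fin span \<beta>0(1) \<xi>0] by blast
  obtain \<gamma> U where \<gamma>: "\<gamma> \<in> lie.dual" and U: "openin lie.dual_zariski U" "U \<noteq> {}"
    and conj: "\<And>\<beta>. \<beta> \<in> U \<Longrightarrow> \<exists>g\<in>carrier Q. Ad Q g ` lie.stabiliser \<gamma> = lie.stabiliser \<beta>"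
    using generic unfolding has_generic_stabiliser_def by blast
  obtain f \<beta>1 where f: "f \<in> poly_funs lie.evals" "\<beta>1 \<in> lie.dual" "f \<beta>1 \<noteq> 0"
    "\<And>\<gamma>. \<gamma> \<in> lie.dual \<Longrightarrow> f \<gamma> \<noteq> 0 \<Longrightarrow> \<gamma> \<in> U"
    using lie.openin_dual_zariski_nonempty[OF U] by blast
  have U_dual: "\<beta> \<in> lie.dual" if "\<beta> \<in> U" for \<beta>
    using openin_subset[OF U(1)] that unfolding lie.dual_zariski_def topspace_zariski by blast
  have stab_sub: "lie.subspace (lie.stabiliser \<beta>)" if \<beta>: "\<beta> \<in> lie.dual" for \<beta>
    by (rule lie.subspaceI)
      (auto simp: lie.stabiliser_def Lie_zero Lie_add Lie_scale lie.bracket_add_left lie.bracket_scale_left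
        lie.dualD[OF \<beta>] commutator_closed lie.bracket_scale_left[where c = 0, simplified])
  \<comment> \<open>\<open>\<gamma>\<close> itself need not be regular. Its stabiliser is a line
    because it is conjugate to that of some \<open>\<beta>\<close> in the open set where moreover
    \<open>s\<close> does not vanish.\<close>
  obtain \<xi> where \<xi>: "\<xi> \<in> lie.stabiliser \<gamma>" "\<xi> \<noteq> 0" "lie.stabiliser \<gamma> \<subseteq> range (\<lambda>c. scale_op c \<xi>)"
  proof -
    obtain \<beta> where \<beta>: "\<beta> \<in> lie.dual" "f \<beta> \<noteq> 0" "s \<beta> \<noteq> 0"
      using lie.dual_irreducible[of f \<beta>1 s \<beta>0, OF f(1-3) s(1) \<beta>0(1) s(2)] by blast
    obtain g where g: "g \<in> carrier Q" "Ad Q g ` lie.stabiliser \<gamma> = lie.stabiliser \<beta>"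
      using conj[OF f(4)[OF \<beta>(1,2)]] by blast
    have inj: "D = E" if "Ad Q g D = Ad Q g E" "D \<in> Lie Q" "E \<in> Lie Q" for D E
      using that Ad_inv(2)[OF g(1)] by metis
    have stabL: "D \<in> Lie Q" if "D \<in> lie.stabiliser \<gamma>" for D \<gamma> using that by (simp add: lie.stabiliser_def)
    have "\<not> lie.stabiliser \<beta> \<subseteq> {0}"
    proof
      assume "lie.stabiliser \<beta> \<subseteq> {0}"
      then have "lie.dim (lie.stabiliser \<beta>) = 0"
        using lie.subspace_0[OF stab_sub[OF \<beta>(1)]]
        by (intro lie.dim_unique[of "{}"]) (auto simp: lie.independent_empty)
      then show False using min[OF \<beta>(1)] by simp
    qed
    then obtain \<xi>' where \<xi>': "\<xi>' \<in> lie.stabiliser \<beta>" "\<xi>' \<noteq> 0" by blast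
    then have \<alpha>\<xi>': "\<alpha> \<xi>' \<noteq> 0" using s_ker[OF \<beta>(1,3)] by blast
    have multiple: "\<eta> = scale_op (\<alpha> \<eta> / \<alpha> \<xi>') \<xi>'" if \<eta>: "\<eta> \<in> lie.stabiliser \<beta>" for \<eta>
    proof -
      let ?\<zeta> = "\<eta> - scale_op (\<alpha> \<eta> / \<alpha> \<xi>') \<xi>'"
      have "?\<zeta> \<in> lie.stabiliser \<beta>"
        using lie.subspace_diff[OF stab_sub[OF \<beta>(1)] \<eta> lie.subspace_scale[OF stab_sub[OF \<beta>(1)] \<xi>'(1)]] .
      moreover have "\<alpha> ?\<zeta> = 0"
        unfolding lie.dualD(6)[OF \<alpha> stabL[OF \<eta>] Lie_scale[OF stabL[OF \<xi>'(1)]]]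
          lie.dualD(2)[OF \<alpha> stabL[OF \<xi>'(1)]] using \<alpha>\<xi>' by simp
      ultimately have "?\<zeta> = 0" using s_ker[OF \<beta>(1,3)] by blast
      then show ?thesis by simp
    qed
    obtain \<xi> where \<xi>: "\<xi> \<in> lie.stabiliser \<gamma>" "\<xi>' = Ad Q g \<xi>" using \<xi>'(1) g(2) by blast
    have "\<xi> \<noteq> 0" using \<xi>' \<xi>(2) Ad_zero by metis
    moreover have "\<eta> = scale_op (\<alpha> (Ad Q g \<eta>) / \<alpha> \<xi>') \<xi>" if "\<eta> \<in> lie.stabiliser \<gamma>" for \<eta>
    proof (rule inj)
      show "Ad Q g \<eta> = Ad Q g (scale_op (\<alpha> (Ad Q g \<eta>) / \<alpha> \<xi>') \<xi>)"
        unfolding Ad_scale \<xi>(2)[symmetric] by (rule multiple) (use g(2) that in blast)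
    qed (use that \<xi>(1) stabL Lie_scale in blast)+
    ultimately show ?thesis using that[OF \<xi>(1)] by blast
  qed
  have \<xi>L: "\<xi> \<in> Lie Q" using \<xi>(1) by (simp add: lie.stabiliser_def)
  have Ad_\<xi>: "Ad Q g \<xi> \<in> lie.stabiliser \<beta> \<and> lie.stabiliser \<beta> \<subseteq> range (\<lambda>c. scale_op c (Ad Q g \<xi>)) \<and> Ad Q g \<xi> \<noteq> 0"
    if g: "g \<in> carrier Q" "Ad Q g ` lie.stabiliser \<gamma> = lie.stabiliser \<beta>" for g \<beta>
  proof (intro conjI)
    show "Ad Q g \<xi> \<in> lie.stabiliser \<beta>" using g(2) \<xi>(1) by blast
    show "lie.stabiliser \<beta> \<subseteq> range (\<lambda>c. scale_op c (Ad Q g \<xi>))"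
      unfolding g(2)[symmetric] using \<xi>(3) Ad_scale by blast
    show "Ad Q g \<xi> \<noteq> 0" using Ad_inv(2)[OF g(1) \<xi>L] \<xi>(2) Ad_zero by metis
  qed
  \<comment> \<open>The annihilator of \<open>N\<close> consists of the functionals that are
    stabilised by \<open>\<xi>\<close> and vanish on it.\<close>
  define N where "N = insert \<xi> (commutator \<xi> ` Lie Q)"
  define V where "V = {w \<in> lie.dual. \<forall>\<eta>\<in>N. w \<eta> = 0}"
  have U_image: "\<exists>g\<in>carrier Q. \<exists>w\<in>V. \<beta> = coadjoint g w" if \<beta>: "\<beta> \<in> U" for \<beta>
  proof -
    obtain g where g: "g \<in> carrier Q" "Ad Q g ` lie.stabiliser \<gamma> = lie.stabiliser \<beta>" using conj[OF \<beta>] by blast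
    note Ad\<xi> = Ad_\<xi>[OF g]
    \<comment> \<open>Otherwise \<open>\<beta>\<close> would be nonzero on its one-dimensional
      stabiliser, hence a contact form.\<close>
    have "\<beta> (Ad Q g \<xi>) = 0"
      using lie.contactI[OF fin span U_dual[OF \<beta>]] Ad\<xi> not_contact by blast
    moreover have "\<beta> (Ad Q g (commutator \<xi> \<eta>)) = 0" if "\<eta> \<in> Lie Q" for \<eta>
      using Ad\<xi> Ad_closed[OF g(1) that] by (simp add: Ad_commutator[OF g(1) \<xi>L that] lie.stabiliser_def)
    ultimately have "coadjoint (inv g) \<beta> \<in> V"
      using coadjoint_dual[OF inv_closed[OF g(1)] U_dual[OF \<beta>]] g(1) \<xi>L commutator_closed[OF \<xi>L]
      by (auto simp: V_def N_def coadjoint_def)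
    moreover have "\<beta> = coadjoint g (coadjoint (inv g) \<beta>)" using coadjoint_inv[OF g(1) U_dual[OF \<beta>]] by simp
    ultimately show ?thesis using g(1) by blast
  qed
  have dense: "\<forall>\<beta>\<in>lie.dual. p \<beta> = 0" if p: "p \<in> poly_funs lie.evals"
    "\<forall>g\<in>carrier Q. \<forall>w\<in>V. p (coadjoint g w) = 0" for p
  proof (rule ballI, rule ccontr)
    fix \<beta> assume \<beta>: "\<beta> \<in> lie.dual" "p \<beta> \<noteq> 0"
    obtain \<delta> where "\<delta> \<in> lie.dual" "p \<delta> \<noteq> 0" "f \<delta> \<noteq> 0"
      using lie.dual_irreducible[of p \<beta> f \<beta>1, OF p(1) \<beta> f(1-3)] by blast
    with U_image[OF f(4)] p(2) show False by blast
  qed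
  have N: "N \<subseteq> Lie Q" using \<xi>L commutator_closed[OF \<xi>L] by (auto simp: N_def)
  have "\<exists>p\<in>poly_funs lie.evals. (\<exists>\<beta>\<in>lie.dual. p \<beta> \<noteq> 0) \<and>
    (\<forall>\<beta>\<in>lie.dual. \<forall>v\<in>lie.dual. p \<beta> \<noteq> 0 \<longrightarrow> (\<exists>g\<in>carrier Q. \<exists>w\<in>V. \<exists>w'\<in>V. \<exists>D\<in>Lie Q.
       \<beta> = coadjoint g w \<and> (\<forall>\<eta>\<in>Lie Q. v \<eta> = w' (Ad Q (inv g) \<eta>) - w (commutator D (Ad Q (inv g) \<eta>)))))"
    by (rule coadjoint_saturation_lift[OF Q N, folded V_def]) (rule dense)
  then obtain p \<beta>2 where p: "p \<in> poly_funs lie.evals" "\<beta>2 \<in> lie.dual" "p \<beta>2 \<noteq> 0"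
    and lift0: "\<forall>\<beta>\<in>lie.dual. \<forall>v\<in>lie.dual. p \<beta> \<noteq> 0 \<longrightarrow> (\<exists>g\<in>carrier Q. \<exists>w\<in>V. \<exists>w'\<in>V. \<exists>D\<in>Lie Q.
       \<beta> = coadjoint g w \<and> (\<forall>\<eta>\<in>Lie Q. v \<eta> = w' (Ad Q (inv g) \<eta>) - w (commutator D (Ad Q (inv g) \<eta>))))"
    by (elim bexE conjE)
  note lift = lift0[rule_format]
  obtain \<beta> where \<beta>: "\<beta> \<in> lie.dual" "p \<beta> \<noteq> 0" "f \<beta> \<noteq> 0"
    using lie.dual_irreducible[of p \<beta>2 f \<beta>1, OF p f(1-3)] by blast
  obtain h where h: "h \<in> carrier Q" "Ad Q h ` lie.stabiliser \<gamma> = lie.stabiliser \<beta>"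
    using conj[OF f(4)[OF \<beta>(1,3)]] by blast
  note Ad\<xi> = Ad_\<xi>[OF h]
  \<comment> \<open>A tangent direction that is nonzero on the stabiliser line of
    \<open>\<beta>\<close>; no lift can produce it, because both terms of a lifted tangent vector
    vanish on that line.\<close>
  obtain v where v: "v \<in> lie.dual" "v (Ad Q h \<xi>) = 1"
    using lie.exists_dual_nonzero[OF Ad_closed[OF h(1) \<xi>L]] Ad\<xi> by blast
  obtain g w w' D where g: "g \<in> carrier Q" and w: "w \<in> V" "w' \<in> V" and D: "D \<in> Lie Q"
    and \<beta>_eq: "\<beta> = coadjoint g w"
    and v_eq: "\<And>\<eta>. \<eta> \<in> Lie Q \<Longrightarrow> v \<eta> = w' (Ad Q (inv g) \<eta>) - w (commutator D (Ad Q (inv g) \<eta>))"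
    using lift[OF \<beta>(1) v(1) \<beta>(2)] by blast
  have wV: "w \<in> lie.dual" "\<And>\<eta>. \<eta> \<in> Lie Q \<Longrightarrow> w (commutator \<xi> \<eta>) = 0" "w' \<xi> = 0"
    using w by (auto simp: V_def N_def)
  have "\<xi> \<in> lie.stabiliser w" using \<xi>L wV(2) by (simp add: lie.stabiliser_def)
  then have "Ad Q g \<xi> \<in> lie.stabiliser \<beta>" unfolding \<beta>_eq stabiliser_coadjoint[OF g wV(1)] by blast
  \<comment> \<open>\<open>g\<close> comes from the lifting and \<open>h\<close> from conjugacy of
    stabilisers; they may differ, but both carry \<open>\<xi>\<close> into the same line.\<close>
  then obtain c where c: "Ad Q g \<xi> = scale_op c (Ad Q h \<xi>)" using Ad\<xi> by blast
  have "Ad Q g \<xi> \<noteq> 0" using Ad_inv(2)[OF g \<xi>L] \<xi>(2) Ad_zero by metis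
  then have "c \<noteq> 0" using c lie.scale_zero_left by metis
  then have "v (Ad Q g \<xi>) \<noteq> 0" unfolding c using lie.dualD(2)[OF v(1) Ad_closed[OF h(1) \<xi>L]] v(2) by simp
  moreover have "w (commutator D \<xi>) = 0"
    using lie.bracket_skew[OF D \<xi>L] wV(2)[OF D] lie.dualD(5)[OF wV(1) commutator_closed[OF \<xi>L D]] by simp
  ultimately show False using v_eq[OF Ad_closed[OF g \<xi>L]] wV(3) by (simp add: Ad_inv(2)[OF g \<xi>L])
qed

theorem theorem2p2:
  fixes Q :: "('k::{alg_closed_field, field_char_0} ^ 'n) monoid"
  assumes "affine_algebraic_group Q"
    and "connected_group Q"
    and "lie_algebra.index scale_op (Lie Q) commutator = 1"
  shows "lie_algebra.contact scale_op (Lie Q) commutator \<longleftrightarrow> has_generic_stabiliser Q"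
  using contact_imp_generic_stabiliser[OF assms(1)] generic_stabiliser_imp_contact[OF assms(1,3)] by blast

end
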